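(* Let $K\subset\mathbb{R}^2$ be a curvilinear polygon and let $m\geq 1$ be an integer. Then: (a) if $v\in V_m^{\partial K}(K)$ and $w\in V_m^{K}(K)$, then $\int_K\nabla v\cdot\nabla w\,dx=0$; (b) if $v,w\in V_m^{\partial K}(K)$, then $\int_K\nabla v\cdot\nabla w\,dx=\int_{\partial K}\frac{\partial v}{\partial\mathbf{n}}\,w\,ds$; (c) if $v,w\in V_m^{K}(K)$, with $\Delta v=p$ and $\Delta w=q$ in $K$ where $p,q\in\mathbb{P}_{m-2}(K)$, and if $Q\in\mathbb{P}_m(K)$ satisfies $\Delta Q=q$, then $$\int_K\nabla v\cdot\nabla w\,dx=\int_{\partial K}\frac{\partial v}{\partial\mathbf{n}}\,Q\,ds-\int_K pQ\,dx.$$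
   Context: A curvilinear polygon is an open, bounded, simply connected set $K\subset\mathbb{R}^2$ whose Lipschitz boundary $\partial K$ is a union of smooth arcs with disjoint interiors (called edges); $\mathbf{n}$ is the outward unit normal on $\partial K$. For an integer $j$, $\mathbb{P}_j$ is the space of real polynomials on $\mathbb{R}^2$ of total degree at most $j$, with $\mathbb{P}_j=\{0\}$ for $j<0$; $\mathbb{P}_j(S)$ is the space of restrictions of elements of $\mathbb{P}_j$ to $S\subset\mathbb{R}^2$. $\mathbb{P}_m^*(\partial K)$ is the space of continuous functions on $\partial K$ whose restriction to each edge $e$ of $K$ lies in $\mathbb{P}_m(e)$. Define $$V_m^{\partial K}(K)=\{v\in H^1(K):\ \Delta v=0\text{ in }K,\ v|_{\partial K}\in\mathbb{P}_m^*(\partial K)\},$$ $$V_m^{K}(K)=\{v\in H^1(K):\ \Delta v\in\mathbb{P}_{m-2}(K)\text{ in }K,\ v|_{\partial K}=0\}.$$ For $v\in H^1(K)$ with $\Delta v\in L^2(K)$, the normal derivative $\partial v/\partial\mathbf{n}$ is the usual (weak) one in $H^{-1/2}(\partial K)$, and boundary integrals of a normal derivative against a trace are understood as the corresponding $H^{-1/2}$-$H^{1/2}$ duality pairing when necessary. *)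

theory Defs
  imports "HOL-Analysis.Analysis"
begin

section \<open>Smooth functions and classical derivatives\<close>

primrec C_k :: "nat \<Rightarrow> ('a::real_normed_vector \<Rightarrow> 'b::real_normed_vector) \<Rightarrow> bool" where
  "C_k 0 f \<longleftrightarrow> continuous_on UNIV f"
| "C_k (Suc k) f \<longleftrightarrow>
     (\<forall>x. f differentiable (at x)) \<and> (\<forall>h. C_k k (\<lambda>x. frechet_derivative f (at x) h))"

definition smooth :: "('a::real_normed_vector \<Rightarrow> 'b::real_normed_vector) \<Rightarrow> bool" where
  "smooth f \<longleftrightarrow> (\<forall>k. C_k k f)"

definition grad :: "(real^2 \<Rightarrow> real) \<Rightarrow> real^2 \<Rightarrow> real^2" where
  "grad f x = (\<chi> i. frechet_derivative f (at x) (axis i 1))"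

definition laplacian :: "(real^2 \<Rightarrow> real) \<Rightarrow> real^2 \<Rightarrow> real" where
  "laplacian f x = (\<Sum>i\<in>UNIV. grad (\<lambda>y. grad f y $ i) x $ i)"

definition test_functions :: "(real^2) set \<Rightarrow> (real^2 \<Rightarrow> real) set" where
  "test_functions K = {\<phi>. smooth \<phi> \<and> (\<exists>C. compact C \<and> C \<subseteq> K \<and> (\<forall>x. x \<notin> C \<longrightarrow> \<phi> x = 0))}"

section \<open>Polynomials\<close>

text \<open>The degree bound is an integer; the sum is empty, hence only the zero function
  remains, when \<open>j < 0\<close>.\<close>

definition polys :: "int \<Rightarrow> (real^2 \<Rightarrow> real) set" where
  "polys j = {p. \<exists>c :: nat \<Rightarrow> nat \<Rightarrow> real.
     \<forall>x. p x = (\<Sum>(a, b) \<in> {(a, b). int a + int b \<le> j}. c a b * (x $ 1) ^ a * (x $ 2) ^ b)}"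

text \<open>Elements of \<open>\<bbbP>\<^sub>j(S)\<close> are represented by total functions whose values off \<open>S\<close> are irrelevant.\<close>

definition polys_on :: "int \<Rightarrow> (real^2) set \<Rightarrow> (real^2 \<Rightarrow> real) set" where
  "polys_on j S = {f. \<exists>p \<in> polys j. \<forall>x\<in>S. f x = p x}"

section \<open>Curvilinear polygons\<close>

definition smooth_arc :: "(real \<Rightarrow> real^2) \<Rightarrow> bool" where
  "smooth_arc \<gamma> \<longleftrightarrow> arc \<gamma> \<and> (\<exists>g. smooth g \<and> (\<forall>t\<in>{0..1}. g t = \<gamma> t)) \<and>
     (\<forall>t\<in>{0..1}. vector_derivative \<gamma> (at t within {0..1}) \<noteq> 0)"

text \<open>Near each boundary point and after a rigid motion, \<open>K\<close> is the region
  above the graph of a Lipschitz function.\<close>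

definition lipschitz_boundary :: "(real^2) set \<Rightarrow> bool" where
  "lipschitz_boundary K \<longleftrightarrow>
     (\<forall>z \<in> frontier K. \<exists>r > 0. \<exists>R :: real^2 \<Rightarrow> real^2. orthogonal_transformation R \<and>
        (\<exists>\<psi> :: real \<Rightarrow> real. \<exists>L. L-lipschitz_on UNIV \<psi> \<and>
           K \<inter> ball z r = {x \<in> ball z r. R (x - z) $ 2 > \<psi> (R (x - z) $ 1)}))"

text \<open>The subdivision of the boundary into edges is part of the data: \<open>\<Gamma>\<close> contains one
  parametrization over \<open>[0,1]\<close> of each edge.\<close>

definition curvilinear_polygon :: "(real^2) set \<Rightarrow> (real \<Rightarrow> real^2) set \<Rightarrow> bool" where
  "curvilinear_polygon K \<Gamma> \<longleftrightarrow>
     open K \<and> bounded K \<and> simply_connected K \<and> lipschitz_boundary K \<and>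
     finite \<Gamma> \<and> (\<forall>\<gamma>\<in>\<Gamma>. smooth_arc \<gamma>) \<and>
     pairwise (\<lambda>\<gamma> \<delta>. disjnt (\<gamma> ` {0<..<1}) (\<delta> ` {0<..<1})) \<Gamma> \<and>
     frontier K = (\<Union>\<gamma>\<in>\<Gamma>. path_image \<gamma>)"

text \<open>\<open>\<bbbP>\<^sub>m\<^sup>*(\<partial>K)\<close>.\<close>

definition bdry_polys :: "int \<Rightarrow> (real^2) set \<Rightarrow> (real \<Rightarrow> real^2) set \<Rightarrow> (real^2 \<Rightarrow> real) set" where
  "bdry_polys m K \<Gamma> =
     {g. continuous_on (frontier K) g \<and> (\<forall>\<gamma>\<in>\<Gamma>. g \<in> polys_on m (path_image \<gamma>))}"

section \<open>Sobolev space \<open>H\<^sup>1\<close>, weak gradient and weak Laplacian\<close>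

definition L2 :: "'a measure \<Rightarrow> ('a \<Rightarrow> 'b::euclidean_space) set" where
  "L2 M = {f \<in> borel_measurable M. integrable M (\<lambda>x. (norm (f x))\<^sup>2)}"

definition has_weak_grad :: "(real^2) set \<Rightarrow> (real^2 \<Rightarrow> real) \<Rightarrow> (real^2 \<Rightarrow> real^2) \<Rightarrow> bool" where
  "has_weak_grad K v G \<longleftrightarrow> (\<forall>\<phi> \<in> test_functions K.
     (LINT x|lebesgue_on K. v x *\<^sub>R grad \<phi> x) = - (LINT x|lebesgue_on K. \<phi> x *\<^sub>R G x))"

definition H1 :: "(real^2) set \<Rightarrow> (real^2 \<Rightarrow> real) set" where
  "H1 K = {v \<in> L2 (lebesgue_on K). \<exists>G \<in> L2 (lebesgue_on K). has_weak_grad K v G}"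

text \<open>Unique up to null sets for \<open>v \<in> H1 K\<close>.\<close>

definition weak_grad :: "(real^2) set \<Rightarrow> (real^2 \<Rightarrow> real) \<Rightarrow> real^2 \<Rightarrow> real^2" where
  "weak_grad K v = (SOME G. G \<in> L2 (lebesgue_on K) \<and> has_weak_grad K v G)"

definition has_weak_laplacian :: "(real^2) set \<Rightarrow> (real^2 \<Rightarrow> real) \<Rightarrow> (real^2 \<Rightarrow> real) \<Rightarrow> bool" where
  "has_weak_laplacian K v f \<longleftrightarrow> (\<forall>\<phi> \<in> test_functions K.
     (LINT x|lebesgue_on K. v x * laplacian \<phi> x) = (LINT x|lebesgue_on K. f x * \<phi> x))"

definition weak_laplacian :: "(real^2) set \<Rightarrow> (real^2 \<Rightarrow> real) \<Rightarrow> real^2 \<Rightarrow> real" where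
  "weak_laplacian K v = (SOME f. f \<in> L2 (lebesgue_on K) \<and> has_weak_laplacian K v f)"

section \<open>Traces and the weak normal derivative\<close>

text \<open>Arc length, pulled back to the parameter interval:
  \<open>\<integral>\<^sub>e g ds\<close> is the integral of \<open>g \<circ> \<gamma>\<close> with respect to \<open>arc_length \<gamma>\<close>.\<close>

definition arc_length :: "(real \<Rightarrow> real^2) \<Rightarrow> real measure" where
  "arc_length \<gamma> = density (lebesgue_on {0..1})
     (\<lambda>t. ennreal (norm (vector_derivative \<gamma> (at t within {0..1}))))"

definition bdry_L2 :: "(real \<Rightarrow> real^2) set \<Rightarrow> (real^2 \<Rightarrow> real) set" where
  "bdry_L2 \<Gamma> = {g. \<forall>\<gamma>\<in>\<Gamma>. g \<circ> \<gamma> \<in> L2 (arc_length \<gamma>)}"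

text \<open>The trace operator from \<open>H\<^sup>1(K)\<close> to \<open>L\<^sup>2(\<partial>K)\<close> is the continuous extension of the
  restriction map on functions smooth up to the boundary; \<open>has_trace K \<Gamma> v g\<close> is its graph.
  As elements of \<open>L\<^sup>2(\<partial>K)\<close>, traces are determined up to null sets of arc length.\<close>

definition has_trace ::
  "(real^2) set \<Rightarrow> (real \<Rightarrow> real^2) set \<Rightarrow> (real^2 \<Rightarrow> real) \<Rightarrow> (real^2 \<Rightarrow> real) \<Rightarrow> bool" where
  "has_trace K \<Gamma> v g \<longleftrightarrow> v \<in> H1 K \<and> g \<in> bdry_L2 \<Gamma> \<and>
     (\<exists>\<phi> :: nat \<Rightarrow> real^2 \<Rightarrow> real. (\<forall>n. smooth (\<phi> n)) \<and>
        (\<lambda>n. LINT x|lebesgue_on K. (\<phi> n x - v x)\<^sup>2) \<longlonglongrightarrow> 0 \<and>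
        (\<lambda>n. LINT x|lebesgue_on K. (norm (grad (\<phi> n) x - weak_grad K v x))\<^sup>2) \<longlonglongrightarrow> 0 \<and>
        (\<lambda>n. \<Sum>\<gamma>\<in>\<Gamma>. LINT t|arc_length \<gamma>. (\<phi> n (\<gamma> t) - g (\<gamma> t))\<^sup>2) \<longlonglongrightarrow> 0)"

definition bdry_trace :: "(real^2) set \<Rightarrow> (real \<Rightarrow> real^2) set \<Rightarrow> (real^2 \<Rightarrow> real) \<Rightarrow> real^2 \<Rightarrow> real" where
  "bdry_trace K \<Gamma> v = (SOME g. has_trace K \<Gamma> v g)"

text \<open>For \<open>v \<in> H\<^sup>1(K)\<close> with \<open>\<Delta>v \<in> L\<^sup>2(K)\<close>, the outward normal derivative is the functional
  on \<open>H\<^sup>1\<^sup>/\<^sup>2(\<partial>K)\<close>, the space of all traces, with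
  \<open>\<langle>\<partial>v/\<partial>n, g\<rangle> = \<integral>\<^sub>K \<nabla>v \<cdot> \<nabla>W + \<integral>\<^sub>K \<Delta>v W\<close> for every \<open>W \<in> H\<^sup>1(K)\<close> with trace \<open>g\<close>.
  If \<open>v\<close> is smooth up to the boundary, the divergence theorem turns this into
  the integral over \<open>\<partial>K\<close> of \<open>(\<nabla>v \<cdot> n) g\<close>.\<close>

definition normal_deriv ::
  "(real^2) set \<Rightarrow> (real \<Rightarrow> real^2) set \<Rightarrow> (real^2 \<Rightarrow> real) \<Rightarrow> (real^2 \<Rightarrow> real) \<Rightarrow> real" where
  "normal_deriv K \<Gamma> v g = (THE r. \<forall>W. has_trace K \<Gamma> W g \<longrightarrow>
     r = (LINT x|lebesgue_on K. weak_grad K v x \<bullet> weak_grad K W x)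
       + (LINT x|lebesgue_on K. weak_laplacian K v x * W x))"

section \<open>The local spaces\<close>

definition V_bdry :: "int \<Rightarrow> (real^2) set \<Rightarrow> (real \<Rightarrow> real^2) set \<Rightarrow> (real^2 \<Rightarrow> real) set" where
  "V_bdry m K \<Gamma> = {v \<in> H1 K. has_weak_laplacian K v (\<lambda>_. 0) \<and>
     (\<exists>g \<in> bdry_polys m K \<Gamma>. has_trace K \<Gamma> v g)}"

definition V_int :: "int \<Rightarrow> (real^2) set \<Rightarrow> (real \<Rightarrow> real^2) set \<Rightarrow> (real^2 \<Rightarrow> real) set" where
  "V_int m K \<Gamma> = {v \<in> H1 K. (\<exists>p \<in> polys_on (m - 2) K. has_weak_laplacian K v p) \<and>
     has_trace K \<Gamma> v (\<lambda>_. 0)}"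

end

theory Submission
  imports Defs
begin

text \<open>
  Everything follows from Green's formula for functions of zero trace. If \<open>v\<close> has weak gradient \<open>V\<close>
  and weak Laplacian \<open>f\<close>, and \<open>u \<in> H\<^sup>1(K)\<close> has trace 0 and gradient \<open>G\<close>, then
  \<open>\<integral>\<^sub>K V \<cdot> G = - \<integral>\<^sub>K f u\<close> (lemma \<open>zero_trace_green\<close>). Part (a) is the case \<open>f = 0\<close>. For (b) and (c),
  two functions with the same trace differ by one of trace 0, so the formula shows that the expression
  defining \<open>\<langle>\<partial>v/\<partial>n, g\<rangle>\<close> takes the same value on all extensions of \<open>g\<close> (lemma \<open>normal_deriv_eq\<close>). In (b)
  the function \<open>w\<close> is an extension of its trace. In (c) the polynomial \<open>Q\<close> is an extension of its
  restriction to the boundary, and Green's formula with \<open>u = v\<close>, used once for \<open>w\<close> and once for \<open>Q\<close>,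
  gives \<open>\<integral>\<^sub>K \<nabla>w \<cdot> \<nabla>v = - \<integral>\<^sub>K q v = \<integral>\<^sub>K \<nabla>Q \<cdot> \<nabla>v\<close>.

  Weak derivatives are tested against smooth functions with compact support in \<open>K\<close>, whereas trace 0
  only says that \<open>u\<close> is a limit of functions \<open>\<phi>\<^sub>n\<close>, smooth up to the boundary, whose boundary values
  tend to 0 in \<open>L\<^sup>2(\<partial>K)\<close>. Cutoffs mediate between the two: take \<open>\<eta>\<close> with compact support in \<open>K\<close>, equal
  to 1 at distance at least \<open>\<epsilon>\<close> from the boundary, and with \<open>\<bar>\<nabla>\<eta>\<bar> \<le> A/\<epsilon>\<close> (lemma \<open>cutoff_exists\<close>).
  The products \<open>\<eta>\<phi>\<^sub>n\<close> are test functions, and as \<open>n\<close> tends to infinity they give Green's formula up to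
  the error \<open>\<integral>\<^sub>K (V \<cdot> \<nabla>\<eta>) u\<close>. It involves only the strip of width about \<open>\<epsilon>\<close> along the boundary and is
  at most \<open>A/\<epsilon>\<close> times the product of the norms of \<open>V\<close> and \<open>u\<close> over that strip. Hence it suffices that
  the norm of \<open>u\<close> over the strip is \<open>O(\<epsilon>)\<close> times that of \<open>G\<close> over a comparable strip
  (lemma \<open>zero_trace_strip_estimate\<close>).

  That inequality of Hardy type is first proved for smooth \<open>\<phi>\<close>, with an additional boundary term. Near a
  boundary point \<open>K\<close> lies above a Lipschitz graph; on each vertical segment starting at the graph,
  \<open>\<phi>\<close> is its value on the graph plus the integral of a directional derivative, and Tonelli's theorem
  sums over the segments (lemma \<open>strip_estimate_local\<close>). The values on the graph are integrated with respect
  to the abscissa, which is dominated by arc length on each edge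
  (lemma \<open>graph_integral_le_arc_integral\<close>). Along \<open>\<phi>\<^sub>n\<close> this boundary term tends to 0.

  The constants \<open>weak_grad\<close> and \<open>weak_laplacian\<close> are choices. They are compared with explicit
  derivatives by the fundamental lemma of the calculus of variations
  (lemma \<open>test_functions_separate_L2\<close>).
\<close>

section \<open>Calculus of smooth functions\<close>

lemma C_k_imp_continuous: "C_k k f \<Longrightarrow> continuous_on UNIV f"
  by (cases k) (auto intro: continuous_at_imp_continuous_on[OF ballI] differentiable_imp_continuous_within)

lemma C_k_Suc_imp: "C_k (Suc k) f \<Longrightarrow> C_k k f"
proof (induction k arbitrary: f)
  case 0
  then show ?case using C_k_imp_continuous[OF 0] by simp
next
  case (Suc k)
  show ?case
    using Suc.prems Suc.IH by simp
qed

lemma C_k_const: "C_k k (\<lambda>x. c)"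
  by (induction k arbitrary: c) (auto simp: frechet_derivative_const)

lemma C_k_add:
  assumes "C_k k f" "C_k k g"
  shows "C_k k (\<lambda>x. f x + g x)"
  using assms
proof (induction k arbitrary: f g)
  case 0
  then show ?case by (auto intro: continuous_intros)
next
  case (Suc k)
  have "frechet_derivative (\<lambda>x. f x + g x) (at x) h =
      frechet_derivative f (at x) h + frechet_derivative g (at x) h" for x h
    by (rule fun_cong[OF frechet_derivative_at[symmetric]], rule has_derivative_add)
       (use Suc.prems in \<open>auto simp: frechet_derivative_works[symmetric]\<close>)
  with Suc show ?case by auto
qed

lemma frechet_derivative_mult_real:
  fixes f g :: "'a::real_normed_vector \<Rightarrow> real"
  assumes "f differentiable (at x)" "g differentiable (at x)"
  shows "frechet_derivative (\<lambda>x. f x * g x) (at x) h =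
    f x * frechet_derivative g (at x) h + frechet_derivative f (at x) h * g x"
proof -
  have "((\<lambda>x. f x * g x) has_derivative
     (\<lambda>h. f x * frechet_derivative g (at x) h + frechet_derivative f (at x) h * g x)) (at x)"
    using assms by (intro has_derivative_mult) (auto simp: frechet_derivative_works)
  then show ?thesis by (simp add: frechet_derivative_at[symmetric])
qed

lemma C_k_mult:
  fixes f g :: "'a::real_normed_vector \<Rightarrow> real"
  assumes "C_k k f" "C_k k g"
  shows "C_k k (\<lambda>x. f x * g x)"
  using assms
proof (induction k arbitrary: f g)
  case 0
  then show ?case by (auto intro: continuous_intros)
next
  case (Suc k)
  have eq: "frechet_derivative (\<lambda>x. f x * g x) (at x) h =
      f x * frechet_derivative g (at x) h + frechet_derivative f (at x) h * g x" for x h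
    using Suc.prems by (auto intro: frechet_derivative_mult_real)
  have "C_k k f" "C_k k g"
    using Suc.prems C_k_Suc_imp by blast+
  with Suc have "C_k k (\<lambda>x. f x * frechet_derivative g (at x) h + frechet_derivative f (at x) h * g x)" for h
    by (intro C_k_add Suc.IH) auto
  with Suc.prems show ?case by (auto simp: eq)
qed

lemma C_k_compose_affine:
  fixes f :: "'b::real_normed_vector \<Rightarrow> 'c::real_normed_vector" and l :: "'a::real_normed_vector \<Rightarrow> 'b"
  assumes l: "bounded_linear l" and "C_k k f"
  shows "C_k k (\<lambda>x. f (l x + b))"
  using assms(2)
proof (induction k arbitrary: f)
  case 0
  have "continuous_on UNIV (\<lambda>x. l x + b)"
    using l by (auto intro!: continuous_intros simp: linear_continuous_on)
  with 0 show ?case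
    using continuous_on_compose2[of UNIV f UNIV "\<lambda>x. l x + b"] by auto
next
  case (Suc k)
  have D: "((\<lambda>x. f (l x + b)) has_derivative (\<lambda>h. frechet_derivative f (at (l x + b)) (l h))) (at x)" for x
  proof -
    have "((\<lambda>x. l x + b) has_derivative l) (at x)"
      using l by (auto intro!: derivative_eq_intros simp: bounded_linear_imp_has_derivative)
    moreover have "(f has_derivative frechet_derivative f (at (l x + b))) (at (l x + b))"
      using Suc.prems by (auto simp: frechet_derivative_works[symmetric])
    ultimately show ?thesis
      using diff_chain_at[of "\<lambda>x. l x + b" l x f] by (simp add: o_def)
  qed
  then have "frechet_derivative (\<lambda>x. f (l x + b)) (at x) h = frechet_derivative f (at (l x + b)) (l h)" for x h
    using frechet_derivative_at by metis
  moreover have "C_k k (\<lambda>x. frechet_derivative f (at (l x + b)) (l h))" for h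
    using Suc.IH[of "\<lambda>y. frechet_derivative f (at y) (l h)"] Suc.prems by auto
  moreover have "(\<lambda>x. f (l x + b)) differentiable (at x)" for x
    using D differentiableI by blast
  ultimately show ?case by simp
qed

lemma C_k_bounded_linear: "bounded_linear l \<Longrightarrow> C_k k l"
proof (cases k)
  case (Suc n)
  assume l: "bounded_linear l"
  then have "frechet_derivative l (at x) = l" for x
    using frechet_derivative_at[OF bounded_linear_imp_has_derivative] by metis
  with Suc l show ?thesis
    by (auto simp: C_k_const bounded_linear_imp_differentiable)
qed (auto simp: linear_continuous_on)

lemma smooth_const: "smooth (\<lambda>x. c)"
  and smooth_add: "smooth f \<Longrightarrow> smooth g \<Longrightarrow> smooth (\<lambda>x. f x + g x)"
  and smooth_compose_affine: "bounded_linear l \<Longrightarrow> smooth h \<Longrightarrow> smooth (\<lambda>x. h (l x + b))"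
  and smooth_bounded_linear: "bounded_linear l \<Longrightarrow> smooth l"
  by (auto simp: smooth_def C_k_const C_k_add C_k_compose_affine C_k_bounded_linear)

lemma smooth_mult:
  fixes f g :: "'a::real_normed_vector \<Rightarrow> real"
  shows "smooth f \<Longrightarrow> smooth g \<Longrightarrow> smooth (\<lambda>x. f x * g x)"
  by (auto simp: smooth_def C_k_mult)

lemma smooth_diff:
  fixes f g :: "'a::real_normed_vector \<Rightarrow> real"
  shows "smooth f \<Longrightarrow> smooth g \<Longrightarrow> smooth (\<lambda>x. f x - g x)"
  using smooth_add[of f "\<lambda>x. (-1) * g x"] smooth_mult[OF smooth_const, of g "-1"] by simp

lemma smooth_sum: "(\<And>i. i \<in> I \<Longrightarrow> smooth (f i)) \<Longrightarrow> smooth (\<lambda>x. \<Sum>i\<in>I. f i x)"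
  by (induction I rule: infinite_finite_induct) (auto simp: smooth_const smooth_add)

lemma smooth_power:
  fixes f :: "'a::real_normed_vector \<Rightarrow> real"
  shows "smooth f \<Longrightarrow> smooth (\<lambda>x. f x ^ n)"
  by (induction n) (auto simp: smooth_const smooth_mult)

lemma smooth_imp_differentiable: "smooth f \<Longrightarrow> f differentiable (at x)"
  unfolding smooth_def by (metis C_k.simps(2))

lemma smooth_imp_continuous: "smooth f \<Longrightarrow> continuous_on S f"
  unfolding smooth_def using C_k.simps(1) continuous_on_subset by blast

lemma smooth_frechet: "smooth f \<Longrightarrow> smooth (\<lambda>x. frechet_derivative f (at x) h)"
  unfolding smooth_def by (metis C_k.simps(2))

lemma smooth_grad: "smooth \<phi> \<Longrightarrow> smooth (\<lambda>x. grad \<phi> x $ i)"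
  by (simp add: grad_def smooth_frechet)

lemma continuous_on_grad: "smooth \<phi> \<Longrightarrow> continuous_on S (grad \<phi>)"
  by (subst continuous_on_componentwise)
     (auto simp: cart_eq_inner_axis[symmetric] Basis_vec_def inner_axis smooth_imp_continuous smooth_grad)

lemma has_derivative_grad:
  assumes "\<phi> differentiable (at x)"
  shows "(\<phi> has_derivative (\<lambda>h. grad \<phi> x \<bullet> h)) (at x)"
proof -
  let ?D = "frechet_derivative \<phi> (at x)"
  have l: "linear ?D" using assms by (rule linear_frechet_derivative)
  have "?D h = grad \<phi> x \<bullet> h" for h
  proof -
    have "?D h = ?D (\<Sum>i\<in>UNIV. (h $ i) *\<^sub>R axis i 1)"
      by (rule arg_cong[where f = ?D]) (simp add: vec_eq_iff axis_def if_distrib cong: if_cong)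
    also have "\<dots> = (\<Sum>i\<in>UNIV. (h $ i) * ?D (axis i 1))"
      using l by (simp add: linear_sum linear_cmul)
    finally have "?D h = (\<Sum>i\<in>UNIV. (h $ i) * ?D (axis i 1))" .
    then show ?thesis by (simp add: grad_def inner_vec_def mult.commute)
  qed
  then have "?D = (\<lambda>h. grad \<phi> x \<bullet> h)" by auto
  then show ?thesis using assms by (metis frechet_derivative_works)
qed

lemma grad_eqI: "(\<phi> has_derivative (\<lambda>h. g \<bullet> h)) (at x) \<Longrightarrow> grad \<phi> x = g"
  by (simp add: grad_def vec_eq_iff frechet_derivative_at[symmetric] inner_axis)

lemma grad_mult:
  assumes "f differentiable (at x)" "g differentiable (at x)"
  shows "grad (\<lambda>x. f x * g x) x = f x *\<^sub>R grad g x + g x *\<^sub>R grad f x"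
  using assms by (simp add: grad_def vec_eq_iff frechet_derivative_mult_real mult.commute)

lemma grad_diff:
  assumes "f differentiable (at x)" "g differentiable (at x)"
  shows "grad (\<lambda>x. f x - g x) x = grad f x - grad g x"
proof (rule grad_eqI)
  show "((\<lambda>x. f x - g x) has_derivative (\<lambda>h. (grad f x - grad g x) \<bullet> h)) (at x)"
    unfolding inner_diff_left by (intro has_derivative_diff has_derivative_grad assms)
qed

lemma grad_sum:
  assumes "\<And>i. i \<in> I \<Longrightarrow> f i differentiable (at x)"
  shows "grad (\<lambda>x. \<Sum>i\<in>I. f i x) x = (\<Sum>i\<in>I. grad (f i) x)"
proof (rule grad_eqI)
  show "((\<lambda>x. \<Sum>i\<in>I. f i x) has_derivative (\<lambda>h. (\<Sum>i\<in>I. grad (f i) x) \<bullet> h)) (at x)"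
    unfolding inner_sum_left by (intro has_derivative_sum has_derivative_grad assms)
qed

section \<open>A smooth step function\<close>

lemma C_k_inverse:
  fixes f :: "'a::real_normed_vector \<Rightarrow> real"
  assumes "C_k k f" and nz: "\<And>x. f x \<noteq> 0"
  shows "C_k k (\<lambda>x. inverse (f x))"
  using assms(1)
proof (induction k)
  case 0
  then show ?case using nz by (auto intro!: continuous_intros)
next
  case (Suc k)
  have D: "((\<lambda>x. inverse (f x)) has_derivative
      (\<lambda>h. - (inverse (f x) * frechet_derivative f (at x) h * inverse (f x)))) (at x)" for x
    by (rule Deriv.has_derivative_inverse) (use Suc.prems nz in \<open>auto simp: frechet_derivative_works[symmetric]\<close>)
  have eq: "frechet_derivative (\<lambda>x. inverse (f x)) (at x) h =
      (-1) * (inverse (f x) * frechet_derivative f (at x) h * inverse (f x))" for x h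
    by (simp add: frechet_derivative_at[OF D, symmetric])
  have "C_k k (\<lambda>x. inverse (f x))" using Suc.IH Suc.prems C_k_Suc_imp by blast
  with Suc.prems have "C_k k (\<lambda>x. (-1) * (inverse (f x) * frechet_derivative f (at x) h * inverse (f x)))" for h
    by (intro C_k_mult C_k_const) auto
  moreover have "(\<lambda>x. inverse (f x)) differentiable (at x)" for x
    using D differentiableI by blast
  ultimately show ?case by (simp only: C_k.simps eq) blast
qed

lemma smooth_inverse:
  fixes f :: "'a::real_normed_vector \<Rightarrow> real"
  shows "smooth f \<Longrightarrow> (\<And>x. f x \<noteq> 0) \<Longrightarrow> smooth (\<lambda>x. inverse (f x))"
  by (auto simp: smooth_def C_k_inverse)

lemma poly_exp_tendsto_0: "((\<lambda>x::real. poly p x * exp (- x)) \<longlongrightarrow> 0) at_top"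
proof -
  have "((\<lambda>x::real. \<Sum>i\<le>degree p. coeff p i * (x ^ i / exp x)) \<longlongrightarrow> (\<Sum>i\<le>degree p. coeff p i * 0)) at_top"
    by (intro tendsto_intros tendsto_power_div_exp_0)
  then show ?thesis
    by (simp add: poly_altdef exp_minus sum_distrib_right divide_inverse mult.assoc)
qed

text \<open>The functions \<open>p(1/t) e\<^bsup>-1/t\<^esup>\<close>, extended by 0. A single one would do, but only the whole family,
  with \<open>p\<close> arbitrary, is closed under differentiation; this is what makes the induction on the order
  of differentiability work.\<close>

definition flat :: "real poly \<Rightarrow> real \<Rightarrow> real" where
  "flat p t = (if t > 0 then poly p (inverse t) * exp (- inverse t) else 0)"

lemma flat_has_derivative:
  "(flat p has_real_derivative flat ([:0, 0, 1:] * (p - pderiv p)) t) (at t)"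
proof -
  consider "t > 0" | "t < 0" | "t = 0" by linarith
  then show ?thesis
  proof cases
    case 1
    have "((\<lambda>t. poly p (inverse t) * exp (- inverse t)) has_real_derivative
        flat ([:0, 0, 1:] * (p - pderiv p)) t) (at t)"
      using 1 by (auto intro!: derivative_eq_intros poly_DERIV[THEN DERIV_chain2]
          simp: flat_def power2_eq_square field_simps)
    then show ?thesis
      by (rule has_field_derivative_transform_within_open[where S = "{0<..}"]) (use 1 in \<open>auto simp: flat_def\<close>)
  next
    case 2
    have "((\<lambda>t. 0) has_real_derivative flat ([:0, 0, 1:] * (p - pderiv p)) t) (at t)"
      using 2 by (auto simp: flat_def)
    then show ?thesis
      by (rule has_field_derivative_transform_within_open[where S = "{..<0}"]) (use 2 in \<open>auto simp: flat_def\<close>)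
  next
    case 3
    have "((\<lambda>h. (poly (pCons 0 p) (inverse h)) * exp (- inverse h)) \<longlongrightarrow> 0) (at_right 0)"
      using poly_exp_tendsto_0[of "pCons 0 p"] filterlim_inverse_at_top_right
      by (rule filterlim_compose)
    then have "((\<lambda>h. flat p h / h) \<longlongrightarrow> 0) (at_right 0)"
      by (rule tendsto_cong[THEN iffD1, rotated])
         (auto simp: flat_def eventually_at_right_field divide_inverse intro!: exI[of _ 1])
    moreover have "((\<lambda>h. flat p h / h) \<longlongrightarrow> 0) (at_left 0)"
      by (rule tendsto_eventually) (auto simp: flat_def eventually_at_left_field intro!: exI[of _ "-1"])
    ultimately have "((\<lambda>h. flat p h / h) \<longlongrightarrow> 0) (at 0)"
      by (rule filterlim_split_at[rotated])
    then show ?thesis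
      unfolding 3 DERIV_def by (simp add: flat_def)
  qed
qed

lemma smooth_flat: "smooth (flat p)"
proof -
  have "C_k k (flat p)" for k
  proof (induction k arbitrary: p)
    case 0
    then show ?case
      using flat_has_derivative[THEN DERIV_continuous] by (simp add: continuous_at_imp_continuous_on)
  next
    case (Suc k)
    have D: "(flat p has_derivative (\<lambda>h. flat ([:0, 0, 1:] * (p - pderiv p)) t * h)) (at t)" for t
      using flat_has_derivative has_field_derivative_imp_has_derivative by blast
    have "frechet_derivative (flat p) (at t) h = flat ([:0, 0, 1:] * (p - pderiv p)) t * h" for t h
      by (simp add: frechet_derivative_at[OF D, symmetric])
    moreover have "flat p differentiable (at t)" for t
      using D differentiableI by blast
    moreover have "C_k k (\<lambda>t. flat ([:0, 0, 1:] * (p - pderiv p)) t * h)" for h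
      by (intro C_k_mult C_k_const Suc.IH)
    ultimately show ?case by (simp only: C_k.simps) blast
  qed
  then show ?thesis by (simp add: smooth_def)
qed

text \<open>For \<open>f(t) = e\<^bsup>-1/t\<^esup>\<close> the sum \<open>f(t) + f(1 - t)\<close> never vanishes, so the quotient
  \<open>f(t) / (f(t) + f(1 - t))\<close> is smooth; it is a step because \<open>f\<close> vanishes on the negative axis.\<close>

lemma smooth_step_exists:
  obtains s :: "real \<Rightarrow> real" where "smooth s" "\<And>t. t \<le> 0 \<Longrightarrow> s t = 0" "\<And>t. t \<ge> 1 \<Longrightarrow> s t = 1"
    "\<And>t. 0 \<le> s t" "\<And>t. s t \<le> 1"
proof -
  define f where "f = flat 1"
  have f0: "f t = 0" if "t \<le> 0" for t using that by (simp add: f_def flat_def)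
  have fp: "f t > 0" if "t > 0" for t using that by (simp add: f_def flat_def)
  have fn: "f t \<ge> 0" for t using f0[of t] fp[of t] by linarith
  have pos: "f t + f (1 - t) > 0" for t
    using fp[of t] fn[of t] fp[of "1 - t"] fn[of "1 - t"] by (cases "t > 0") auto
  have sm: "smooth f" by (simp add: f_def smooth_flat)
  have "smooth (\<lambda>t. f (- t + 1))"
    by (rule smooth_compose_affine[OF _ sm]) (rule bounded_linear_minus[OF bounded_linear_ident])
  then have "smooth (\<lambda>t. f t + f (1 - t))" using smooth_add[OF sm, of "\<lambda>t. f (1 - t)"] by simp
  then have "smooth (\<lambda>t. f t * inverse (f t + f (1 - t)))"
    by (intro smooth_mult[OF sm] smooth_inverse less_imp_neq[OF pos, symmetric])
  then show ?thesis
  proof (rule that)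
    show "f t * inverse (f t + f (1 - t)) \<le> 1" for t
      using pos[of t] fn[of "1 - t"] by (simp add: field_simps)
    show "f t * inverse (f t + f (1 - t)) = 1" if "t \<ge> 1" for t
      using fp[of t] f0[of "1 - t"] that by simp
  qed (use pos f0 fp fn in \<open>auto simp: divide_inverse[symmetric] less_imp_le\<close>)
qed

section \<open>Cutoff functions\<close>

text \<open>With a smooth step \<open>s\<close>, the translates of \<open>s(t + 1) - s(t)\<close> by integers telescope to 1. The
  bump is nonnegative and hence minimal wherever it vanishes, which kills its derivative there.\<close>

lemma partition_bump_exists:
  obtains \<theta> :: "real \<Rightarrow> real" and M where "smooth \<theta>" "\<And>t. \<bar>t\<bar> \<ge> 1 \<Longrightarrow> \<theta> t = 0" "\<And>t. \<bar>\<theta> t\<bar> \<le> 1"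
    "\<And>t. \<bar>deriv \<theta> t\<bar> \<le> M" "\<And>t. \<bar>t\<bar> \<ge> 1 \<Longrightarrow> deriv \<theta> t = 0"
    "\<And>(N::nat) (t::real). \<bar>t\<bar> \<le> N \<Longrightarrow> (\<Sum>k = - int N..int N. \<theta> (t - of_int k)) = 1"
proof -
  obtain s :: "real \<Rightarrow> real" where s: "smooth s" "\<And>t. t \<le> 0 \<Longrightarrow> s t = 0" "\<And>t. t \<ge> 1 \<Longrightarrow> s t = 1"
    "\<And>t. 0 \<le> s t" "\<And>t. s t \<le> 1" using smooth_step_exists by metis
  define \<theta> where "\<theta> t = s (t + 1) - s t" for t
  have sm: "smooth \<theta>"
    unfolding \<theta>_def using smooth_compose_affine[OF bounded_linear_ident s(1), of 1]
    by (intro smooth_diff s) auto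
  have 0: "\<theta> t = 0" if "\<bar>t\<bar> \<ge> 1" for t
    using that s(2,3)[of t] s(2,3)[of "t + 1"] by (auto simp: \<theta>_def abs_if split: if_splits)
  have ge0: "0 \<le> \<theta> t" for t
    using s(2)[of t] s(3)[of "t + 1"] s(4)[of "t + 1"] s(5)[of t] by (cases "t \<le> 0") (auto simp: \<theta>_def)
  have D: "(\<theta> has_real_derivative deriv \<theta> t) (at t)" for t
    using smooth_imp_differentiable[OF sm] by (simp add: DERIV_deriv_iff_real_differentiable)
  have dd: "deriv \<theta> = (\<lambda>t. frechet_derivative \<theta> (at t) 1)"
    by (simp add: frechet_derivative_at[OF D[THEN has_field_derivative_imp_has_derivative], symmetric])
  have "continuous_on {-1..1} (deriv \<theta>)"
    unfolding dd by (rule smooth_imp_continuous[OF smooth_frechet[OF sm]])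
  then have "bounded (deriv \<theta> ` {-1..1})"
    using compact_continuous_image compact_imp_bounded compact_Icc by blast
  then obtain M where M: "\<forall>y \<in> deriv \<theta> ` {-1..1}. norm y \<le> M"
    unfolding bounded_iff by blast
  have d0: "deriv \<theta> t = 0" if "\<bar>t\<bar> \<ge> 1" for t
    by (rule DERIV_local_min[OF D zero_less_one]) (use 0[OF that] ge0 in auto)
  have M': "\<bar>deriv \<theta> t\<bar> \<le> M" for t
  proof (cases "t \<in> {-1..1}")
    case True
    with M show ?thesis by auto
  next
    case False
    have "0 \<in> {-1..1::real}" by simp
    with M have "norm (deriv \<theta> 0) \<le> M" by blast
    with False d0[of t] show ?thesis by auto
  qed
  have sum: "(\<Sum>k = - int N..int N. \<theta> (t - of_int k)) = 1" if "\<bar>t\<bar> \<le> N" for N :: nat and t :: real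
  proof -
    have "(\<Sum>k = - int N..- int N + int n. \<theta> (t - of_int k)) = s (t + N + 1) - s (t + N - n)" for n
    proof (induction n)
      case (Suc n)
      have "{- int N..- int N + int (Suc n)} = insert (- int N + int (Suc n)) {- int N..- int N + int n}"
        by auto
      with Suc show ?case by (simp add: \<theta>_def algebra_simps)
    qed (simp add: \<theta>_def add_ac)
    from this[of "2 * N"] that s(3)[of "t + N + 1"] s(2)[of "t - N"] show ?thesis
      by (simp add: abs_le_iff)
  qed
  show thesis
  proof (rule that[OF sm 0 _ M' d0 sum])
    show "\<bar>\<theta> t\<bar> \<le> 1" for t
      using s(4)[of t] s(4)[of "t+1"] s(5)[of t] s(5)[of "t+1"] by (simp add: \<theta>_def abs_le_iff)
  qed auto
qed

lemma grad_eq_0_outside: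
  assumes "closed C" "\<And>x. x \<notin> C \<Longrightarrow> \<phi> x = 0" "x \<notin> C"
  shows "grad \<phi> x = 0"
proof (rule grad_eqI)
  have "((\<lambda>x. 0 :: real) has_derivative (\<lambda>h. 0 \<bullet> h)) (at x)" by simp
  then show "(\<phi> has_derivative (\<lambda>h. 0 \<bullet> h)) (at x)"
    by (rule has_derivative_transform_within_open[of _ _ _ UNIV "- C"]) (use assms in auto)
qed

lemma grad_cong_open:
  assumes "open U" "x \<in> U" "\<And>y. y \<in> U \<Longrightarrow> f y = g y" "g differentiable (at x)"
  shows "grad f x = grad g x"
proof (rule grad_eqI)
  show "(f has_derivative (\<lambda>h. grad g x \<bullet> h)) (at x)"
    by (rule has_derivative_transform_within_open[OF has_derivative_grad[OF assms(4)] assms(1,2)])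
      (use assms in auto)
qed

text \<open>A ball is connected: if it met both \<open>K\<close> and the complement, it would meet the frontier.\<close>

lemma ball_subset_of_infdist_frontier:
  fixes K :: "'a::real_normed_vector set"
  assumes "x \<in> K" "infdist x (frontier K) \<ge> \<epsilon>"
  shows "ball x \<epsilon> \<subseteq> K"
proof (rule ccontr)
  assume *: "\<not> ball x \<epsilon> \<subseteq> K"
  then have "ball x \<epsilon> \<noteq> {}" by blast
  then have "x \<in> ball x \<epsilon> \<inter> K" using assms by simp
  with * have "ball x \<epsilon> \<inter> frontier K \<noteq> {}"
    using connected_Int_frontier[of "ball x \<epsilon>" K] by blast
  then obtain y where y: "y \<in> frontier K" "dist x y < \<epsilon>" by auto
  from infdist_le[OF y(1), of x] y(2) assms(2) show False by linarith
qed

lemma frontier_nonempty_of_bounded: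
  fixes K :: "'a::euclidean_space set"
  assumes "bounded K" "x \<in> K"
  shows "frontier K \<noteq> {}"
proof -
  have "K \<noteq> UNIV" using assms(1) not_bounded_UNIV by blast
  then show ?thesis using assms(2) by (auto simp: frontier_eq_empty)
qed

lemma infdist_frontier_pos:
  fixes K :: "'a::euclidean_space set"
  assumes "open K" "bounded K" "x \<in> K"
  shows "infdist x (frontier K) > 0"
  using assms frontier_nonempty_of_bounded[OF assms(2,3)]
  by (intro infdist_pos_not_in_closed frontier_closed) (auto simp: frontier_def interior_open)

lemma card_near_int:
  fixes t :: real
  shows "card {k::int. \<bar>t - of_int k\<bar> < 1} \<le> 2" "finite {k::int. \<bar>t - of_int k\<bar> < 1}"
proof -
  have s: "{k::int. \<bar>t - of_int k\<bar> < 1} \<subseteq> {\<lfloor>t\<rfloor>, \<lfloor>t\<rfloor> + 1}"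
  proof
    fix k assume "k \<in> {k::int. \<bar>t - of_int k\<bar> < 1}"
    then have "of_int k < t + 1" "t - 1 < of_int k" by auto
    then show "k \<in> {\<lfloor>t\<rfloor>, \<lfloor>t\<rfloor> + 1}" by simp linarith
  qed
  from card_mono[OF _ s] finite_subset[OF s] 
  show "card {k::int. \<bar>t - of_int k\<bar> < 1} \<le> 2" "finite {k::int. \<bar>t - of_int k\<bar> < 1}"
    by (auto simp: card_insert_if)
qed

lemma grad_compose_coord:
  fixes \<theta> :: "real \<Rightarrow> real"
  assumes "\<theta> differentiable (at (x $ i / h - c))"
  shows "grad (\<lambda>x. \<theta> (x $ i / h - c)) x = (deriv \<theta> (x $ i / h - c) / h) *\<^sub>R axis i 1"
proof (rule grad_eqI)
  have "(\<theta> has_field_derivative deriv \<theta> (x $ i / h - c)) (at (x $ i / h - c))"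
    using assms by (metis DERIV_deriv_iff_real_differentiable)
  moreover have "((\<lambda>x::real^2. x $ i / h - c) has_derivative (\<lambda>v. v $ i / h)) (at x)"
    unfolding divide_inverse
    by (auto intro!: derivative_eq_intros bounded_linear_imp_has_derivative bounded_linear_vec_nth)
  ultimately have "((\<lambda>x::real^2. \<theta> (x $ i / h - c)) has_derivative (\<lambda>v. deriv \<theta> (x $ i / h - c) * (v $ i / h))) (at x)"
    using diff_chain_at[of "\<lambda>x::real^2. x $ i / h - c" _ x \<theta>] by (fastforce simp: has_field_derivative_def o_def)
  then show "((\<lambda>x. \<theta> (x $ i / h - c)) has_derivative
      (\<lambda>v. (deriv \<theta> (x $ i / h - c) / h) *\<^sub>R axis i 1 \<bullet> v)) (at x)"
    by (simp add: inner_axis')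
qed

lemma test_function_outside:
  assumes "\<phi> \<in> test_functions K" "x \<notin> K"
  shows "\<phi> x = 0" "grad \<phi> x = 0"
  using assms grad_eq_0_outside[OF compact_imp_closed, of _ \<phi> x] by (auto simp: test_functions_def)

definition boundary_cutoff :: "(real^2) set \<Rightarrow> real \<Rightarrow> real \<Rightarrow> (real^2 \<Rightarrow> real) \<Rightarrow> bool" where
  "boundary_cutoff K \<epsilon> A \<eta> \<longleftrightarrow> \<eta> \<in> test_functions K \<and> (\<forall>x. \<bar>\<eta> x\<bar> \<le> A) \<and> (\<forall>x. norm (grad \<eta> x) \<le> A / \<epsilon>) \<and>
    (\<forall>x\<in>K. infdist x (frontier K) \<ge> \<epsilon> \<longrightarrow> \<eta> x = 1) \<and>
    (\<forall>x\<in>K. infdist x (frontier K) > \<epsilon> \<longrightarrow> grad \<eta> x = 0)"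

text \<open>On a square grid of mesh \<open>\<epsilon>/4\<close>, let \<open>\<eta>\<close> be the sum of those products of two bumps whose supporting
  square lies in \<open>K\<close>. At a point at distance at least \<open>\<epsilon>\<close> from the boundary all squares containing the
  point lie in \<open>K\<close>, so the sum is the full partition of unity. At most four bumps are nonzero at any
  point, which makes the bounds independent of \<open>K\<close>.\<close>

lemma cutoff_exists:
  obtains A where "A > 0" "\<And>(K :: (real^2) set) \<epsilon>. open K \<Longrightarrow> bounded K \<Longrightarrow> \<epsilon> > 0 \<Longrightarrow>
    \<exists>\<eta>. boundary_cutoff K \<epsilon> A \<eta>"
proof -
  obtain \<theta> :: "real \<Rightarrow> real" and M where \<theta>: "smooth \<theta>" "\<And>t. \<bar>t\<bar> \<ge> 1 \<Longrightarrow> \<theta> t = 0" "\<And>t. \<bar>\<theta> t\<bar> \<le> 1"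
    "\<And>t. \<bar>deriv \<theta> t\<bar> \<le> M" "\<And>t. \<bar>t\<bar> \<ge> 1 \<Longrightarrow> deriv \<theta> t = 0"
    and sum: "\<And>(N::nat) (t::real). \<bar>t\<bar> \<le> N \<Longrightarrow> (\<Sum>k = - int N..int N. \<theta> (t - of_int k)) = 1"
    using partition_bump_exists by metis
  have M0: "M \<ge> 0" using \<theta>(4)[of 0] by linarith
  define A where "A = 4 + 32 * M"
  have "\<exists>\<eta>. boundary_cutoff K \<epsilon> A \<eta>"
    if K: "open K" "bounded K" and \<epsilon>: "\<epsilon> > 0" for K :: "(real^2) set" and \<epsilon>
  proof -
    define h where "h = \<epsilon> / 4"
    have h: "h > 0" using \<epsilon> by (simp add: h_def)
    define T where "T = (\<lambda>(i::int, j::int) (x::real^2). \<theta> (x $ 1 / h - i) * \<theta> (x $ 2 / h - j))"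
    define Q where "Q = (\<lambda>(i::int, j::int). {x::real^2. \<bar>x $ 1 / h - i\<bar> \<le> 1 \<and> \<bar>x $ 2 / h - j\<bar> \<le> 1})"
    obtain B where B: "\<And>x. x \<in> K \<Longrightarrow> norm x \<le> B" using K by (auto simp: bounded_iff)
    obtain N :: nat where N: "B / h \<le> N" using real_arch_simple by blast
    define G where "G = {- int N..int N} \<times> {- int N..int N}"
    define S where "S = {p \<in> G. Q p \<subseteq> K}"
    have finS: "finite S" "finite G" by (auto simp: S_def G_def)
    define \<eta> where "\<eta> x = (\<Sum>p\<in>S. T p x)" for x
    have smc: "smooth (\<lambda>x::real^2. \<theta> (x $ i / h - c))" for i c
        using smooth_compose_affine[OF _ \<theta>(1), of "\<lambda>x::real^2. x $ i / h" "-c"]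
          bounded_linear_divide[THEN bounded_linear_compose, OF bounded_linear_vec_nth, of i h] by simp
    have smT: "smooth (T p)" for p
      by (cases p) (auto simp: T_def intro!: smooth_mult smc)
    have gT: "grad (T (i, j)) x = \<theta> (x $ 1 / h - i) *\<^sub>R ((deriv \<theta> (x $ 2 / h - j) / h) *\<^sub>R axis 2 1) +
        \<theta> (x $ 2 / h - j) *\<^sub>R ((deriv \<theta> (x $ 1 / h - i) / h) *\<^sub>R axis 1 1)" for i j x
      unfolding T_def using smc \<theta>(1)
      by (simp add: grad_mult grad_compose_coord smooth_imp_differentiable)
    have T0: "T p x = 0 \<and> grad (T p) x = 0"
      if "\<not> (\<bar>x $ 1 / h - fst p\<bar> < 1 \<and> \<bar>x $ 2 / h - snd p\<bar> < 1)" for p :: "int \<times> int" and x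
    proof (cases p)
      case (Pair i j)
      then have "\<bar>x $ 1 / h - i\<bar> \<ge> 1 \<or> \<bar>x $ 2 / h - j\<bar> \<ge> 1" using that by auto
      then show ?thesis
        unfolding Pair gT by (auto simp: T_def \<theta>)
    qed
    have Tb: "\<bar>T p x\<bar> \<le> 1 \<and> norm (grad (T p) x) \<le> 8 * M / \<epsilon>" for p :: "int \<times> int" and x
    proof -
      obtain i j where p: "p = (i, j)" by (cases p)
      have "norm (grad (T p) x) \<le> M / h + M / h"
        unfolding p gT
      proof (intro norm_triangle_le add_mono)
        have *: "\<bar>\<theta> a * (deriv \<theta> b / h)\<bar> \<le> M / h" for a b
          using mult_mono[OF \<theta>(3)[of a] \<theta>(4)[of b]] h by (simp add: abs_mult abs_divide divide_right_mono)
        show "norm (\<theta> (x $ 1 / h - i) *\<^sub>R ((deriv \<theta> (x $ 2 / h - j) / h) *\<^sub>R (axis 2 1 :: real^2))) \<le> M / h"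
          "norm (\<theta> (x $ 2 / h - j) *\<^sub>R ((deriv \<theta> (x $ 1 / h - i) / h) *\<^sub>R (axis 1 1 :: real^2))) \<le> M / h"
          using *  by (simp_all add: norm_axis_1 abs_mult)
      qed
      moreover have "\<bar>T p x\<bar> \<le> 1"
        using mult_mono[OF \<theta>(3)[of "x $ 1 / h - i"] \<theta>(3)[of "x $ 2 / h - j"]] by (simp add: T_def p abs_mult)
      ultimately show ?thesis by (simp add: h_def)
    qed
    define near where "near x = {k::int. \<bar>x $ 1 / h - of_int k\<bar> < 1} \<times> {k::int. \<bar>x $ 2 / h - of_int k\<bar> < 1}"
      for x :: "real^2"
    have Tn: "T p x = 0 \<and> grad (T p) x = 0" if "p \<notin> near x" for p x
      by (rule T0) (use that in \<open>auto simp: near_def mem_Times_iff\<close>)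
    have near: "finite (near x)" "card (near x) \<le> 4" for x
      using card_near_int[of "x $ 1 / h"] card_near_int[of "x $ 2 / h"]
        mult_mono[OF card_near_int(1)[of "x $ 1 / h"] card_near_int(1)[of "x $ 2 / h"]]
      by (auto simp: near_def card_cartesian_product)
    have bnd: "norm (\<Sum>p\<in>S. f p) \<le> 4 * c" if "\<And>p. norm (f p) \<le> c" "\<And>p. p \<notin> near x \<Longrightarrow> f p = 0"
      for f :: "int \<times> int \<Rightarrow> 'a::real_normed_vector" and x c
    proof -
      have "(\<Sum>p\<in>S. f p) = (\<Sum>p\<in>S \<inter> near x. f p)"
        using that finS by (intro sum.mono_neutral_right) auto
      also have "norm \<dots> \<le> (\<Sum>p\<in>S \<inter> near x. c)"
        using that by (intro sum_norm_le) auto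
      also have "\<dots> = card (S \<inter> near x) * c" by simp
      also have "\<dots> \<le> 4 * c"
      proof (rule mult_right_mono)
        have "card (S \<inter> near x) \<le> card (near x)" using near by (intro card_mono) auto
        then show "real (card (S \<inter> near x)) \<le> 4" using near[of x] by linarith
        show "0 \<le> c" using that(1) norm_ge_zero order_trans by blast
      qed
      finally show ?thesis .
    qed
    have test: "\<eta> \<in> test_functions K"
    proof -
      have "compact (Q p)" for p
      proof (cases p)
        case (Pair i j)
        have "Q p = cbox (vector [h * (i - 1), h * (j - 1)]) (vector [h * (i + 1), h * (j + 1)])"
          using h by (auto simp: Pair Q_def mem_box_cart forall_2 abs_le_iff field_simps)
        then show ?thesis by simp
      qed
      then have "compact (\<Union>p\<in>S. Q p)" using finS by blast
      moreover have "\<eta> x = 0" if "x \<notin> (\<Union>p\<in>S. Q p)" for x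
        unfolding \<eta>_def using that T0 by (intro sum.neutral) (force simp: Q_def)
      moreover have "smooth \<eta>" unfolding \<eta>_def by (intro smooth_sum smT)
      moreover have "(\<Union>p\<in>S. Q p) \<subseteq> K" by (auto simp: S_def)
      ultimately show ?thesis unfolding test_functions_def by blast
    qed
    have g: "grad \<eta> x = (\<Sum>p\<in>S. grad (T p) x)" for x
      unfolding \<eta>_def by (intro grad_sum smooth_imp_differentiable smT)
    have 1: "\<eta> x = 1" if x: "x \<in> K" "infdist x (frontier K) \<ge> \<epsilon>" for x
    proof -
      have b: "ball x \<epsilon> \<subseteq> K" using x by (rule ball_subset_of_infdist_frontier)
      have "T p x = 0" if "p \<in> G - S" for p :: "int \<times> int"
      proof (rule ccontr)
        assume "T p x \<noteq> 0"
        then have n: "\<bar>x $ 1 / h - fst p\<bar> < 1" "\<bar>x $ 2 / h - snd p\<bar> < 1" using T0 by blast+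
        have "Q p \<subseteq> ball x \<epsilon>"
        proof
          fix y assume "y \<in> Q p"
          then have y: "\<bar>y $ 1 / h - fst p\<bar> \<le> 1" "\<bar>y $ 2 / h - snd p\<bar> \<le> 1" by (auto simp: Q_def split: prod.splits)
          have "\<bar>x $ 1 / h - y $ 1 / h\<bar> < 2" "\<bar>x $ 2 / h - y $ 2 / h\<bar> < 2" using n y by linarith+
          then have "\<bar>x $ 1 - y $ 1\<bar> < 2 * h" "\<bar>x $ 2 - y $ 2\<bar> < 2 * h"
            using h by (auto simp: diff_divide_distrib[symmetric] abs_divide pos_divide_less_eq)
          then have "norm (x - y) < \<epsilon>"
            using norm_le_l1_cart[of "x - y"] by (simp add: sum_2 h_def)
          then show "y \<in> ball x \<epsilon>" by (simp add: dist_norm)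
        qed
        with b that show False by (auto simp: S_def)
      qed
      then have "\<eta> x = (\<Sum>p\<in>G. T p x)"
        unfolding \<eta>_def using finS by (intro sum.mono_neutral_left) (auto simp: S_def)
      also have "\<dots> = (\<Sum>i = - int N..int N. \<theta> (x $ 1 / h - i)) * (\<Sum>j = - int N..int N. \<theta> (x $ 2 / h - j))"
        unfolding G_def T_def by (simp add: sum_product sum.cartesian_product split_def)
      also have "\<dots> = 1"
      proof -
        have "\<bar>x $ i / h\<bar> \<le> N" for i
        proof -
          have "\<bar>x $ i\<bar> \<le> B" using B[OF x(1)] component_le_norm_cart[of x i] by linarith
          then have "\<bar>x $ i / h\<bar> \<le> B / h" using h by (simp add: abs_divide divide_right_mono)
          with N show ?thesis by linarith
        qed
        then show ?thesis by (simp add: sum)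
      qed
      finally show ?thesis .
    qed
    have "grad \<eta> x = 0" if x: "x \<in> K" "infdist x (frontier K) > \<epsilon>" for x
    proof -
      have "grad \<eta> x = grad (\<lambda>x. 1) x"
      proof (rule grad_cong_open)
        show "open (K \<inter> {x. infdist x (frontier K) > \<epsilon>})"
          using K by (auto intro!: open_Int open_Collect_less continuous_intros)
      qed (use x 1 in auto)
      then show ?thesis by (simp add: grad_def vec_eq_iff frechet_derivative_const)
    qed
    moreover have "\<bar>\<eta> x\<bar> \<le> A" for x
    proof -
      have "norm (\<Sum>p\<in>S. T p x) \<le> 4 * 1"
        by (rule bnd[of _ _ x]) (use Tb Tn in auto)
      then show ?thesis using M0 by (simp add: \<eta>_def A_def)
    qed
    moreover have "norm (grad \<eta> x) \<le> A / \<epsilon>" for x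
    proof -
      have "norm (\<Sum>p\<in>S. grad (T p) x) \<le> 4 * (8 * M / \<epsilon>)"
        by (rule bnd[of _ _ x]) (use Tb Tn in auto)
      also have "\<dots> \<le> A / \<epsilon>" using \<epsilon> by (simp add: A_def divide_right_mono)
      finally show ?thesis by (simp add: g)
    qed
    ultimately show ?thesis unfolding boundary_cutoff_def using test 1 by blast
  qed
  moreover have "A > 0" using M0 by (simp add: A_def)
  ultimately show ?thesis using that by blast
qed

section \<open>Square-integrable functions\<close>

lemma quadratic_nonneg_discriminant:
  fixes A B I :: real
  assumes "B \<ge> 0" and nonneg: "\<And>t. 0 \<le> A - 2 * t * I + t\<^sup>2 * B"
  shows "I\<^sup>2 \<le> A * B"
proof (cases "B = 0")
  case True
  have "I = 0"
  proof (rule ccontr)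
    assume "I \<noteq> 0"
    with nonneg[of "(A + 1) / (2 * I)"] True show False by simp
  qed
  with True show ?thesis by simp
next
  case False
  with assms have B: "B > 0" by simp
  have "0 \<le> A - I\<^sup>2 / B" using nonneg[of "I / B"] B by (simp add: power2_eq_square field_simps)
  with B show ?thesis by (simp add: field_simps)
qed

abbreviation L2_on :: "(real^2) set \<Rightarrow> (real^2 \<Rightarrow> 'b::euclidean_space) set" where
  "L2_on K \<equiv> L2 (lebesgue_on K)"

lemma inner_le_sum_squares: "\<bar>x \<bullet> y\<bar> \<le> (norm x)\<^sup>2 + (norm y)\<^sup>2"
  using Cauchy_Schwarz_ineq2[of x y] sum_squares_bound[of "norm x" "norm y"]
    mult_nonneg_nonneg[OF norm_ge_zero[of x] norm_ge_zero[of y]] by linarith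

lemma norm_add_sq_le: "(norm (x + y))\<^sup>2 \<le> 2 * (norm x)\<^sup>2 + 2 * (norm (y::'a::real_inner))\<^sup>2"
  using inner_ge_zero[of "x - y"] by (simp add: power2_norm_eq_inner inner_simps inner_commute)

lemma norm_diff_sq_le: "(norm (x - y))\<^sup>2 \<le> 2 * (norm x)\<^sup>2 + 2 * (norm (y::'a::real_inner))\<^sup>2"
  using norm_add_sq_le[of x "- y"] by simp

lemma L2_measurable [measurable_dest]: "f \<in> L2 M \<Longrightarrow> f \<in> borel_measurable M"
  and L2_integrable_sq: "f \<in> L2 M \<Longrightarrow> integrable M (\<lambda>x. (norm (f x))\<^sup>2)"
  by (auto simp: L2_def)

lemma L2_integrable_inner:
  assumes "f \<in> L2 M" "g \<in> L2 M"
  shows "integrable M (\<lambda>x. f x \<bullet> g x)"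
proof (rule Bochner_Integration.integrable_bound)
  show "integrable M (\<lambda>x. (norm (f x))\<^sup>2 + (norm (g x))\<^sup>2)"
    using assms by (intro Bochner_Integration.integrable_add L2_integrable_sq)
  show "(\<lambda>x. f x \<bullet> g x) \<in> borel_measurable M"
    using assms by measurable
qed (auto intro: AE_I2 inner_le_sum_squares)

lemma L2_integrable_mult:
  fixes f g :: "'a \<Rightarrow> real"
  shows "f \<in> L2 M \<Longrightarrow> g \<in> L2 M \<Longrightarrow> integrable M (\<lambda>x. f x * g x)"
  using L2_integrable_inner[of f M g] by simp

lemma L2_add:
  assumes "f \<in> L2 M" "g \<in> L2 M"
  shows "(\<lambda>x. f x + g x) \<in> L2 M"
proof -
  have "integrable M (\<lambda>x. (norm (f x + g x))\<^sup>2)"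
  proof (rule Bochner_Integration.integrable_bound)
    show "integrable M (\<lambda>x. 2 * (norm (f x))\<^sup>2 + 2 * (norm (g x))\<^sup>2)"
      using assms L2_integrable_sq by (intro Bochner_Integration.integrable_add integrable_mult_right) auto
    show "(\<lambda>x. (norm (f x + g x))\<^sup>2) \<in> borel_measurable M" using assms by measurable
  qed (auto intro!: AE_I2 norm_add_sq_le)
  with assms show ?thesis by (auto simp: L2_def)
qed

lemma L2_bounded_mult:
  fixes f :: "'a \<Rightarrow> 'b::euclidean_space"
  assumes "f \<in> L2 M" "b \<in> borel_measurable M" "\<And>x. \<bar>b x\<bar> \<le> B"
  shows "(\<lambda>x. b x *\<^sub>R f x) \<in> L2 M"
proof -
  have "integrable M (\<lambda>x. (norm (b x *\<^sub>R f x))\<^sup>2)"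
  proof (rule Bochner_Integration.integrable_bound)
    show "integrable M (\<lambda>x. B\<^sup>2 * (norm (f x))\<^sup>2)" using assms L2_integrable_sq by auto
    show "(\<lambda>x. (norm (b x *\<^sub>R f x))\<^sup>2) \<in> borel_measurable M" using assms by measurable
    have "(norm (b x *\<^sub>R f x))\<^sup>2 \<le> B\<^sup>2 * (norm (f x))\<^sup>2" for x
      using assms(3)[of x] abs_le_square_iff[of "b x" B] by (auto simp: power_mult_distrib intro!: mult_right_mono)
    then show "AE x in M. norm ((norm (b x *\<^sub>R f x))\<^sup>2) \<le> norm (B\<^sup>2 * (norm (f x))\<^sup>2)" by simp
  qed
  with assms show ?thesis by (auto simp: L2_def)
qed

lemma L2_scale: "f \<in> L2 M \<Longrightarrow> (\<lambda>x. c *\<^sub>R f x) \<in> L2 M"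
  by (rule L2_bounded_mult[where B = "\<bar>c\<bar>"]) auto

lemma L2_diff: "f \<in> L2 M \<Longrightarrow> g \<in> L2 M \<Longrightarrow> (\<lambda>x. f x - g x) \<in> L2 M"
  using L2_add[OF _ L2_scale[of g M "-1"], of f] by simp

lemma L2_component:
  fixes f :: "'a \<Rightarrow> real^2"
  assumes "f \<in> L2 M"
  shows "(\<lambda>x. f x $ i) \<in> L2 M"
proof -
  have m: "(\<lambda>x. f x $ i) \<in> borel_measurable M"
    using assms L2_measurable by (auto simp: cart_eq_inner_axis)
  have "integrable M (\<lambda>x. (norm (f x $ i))\<^sup>2)"
  proof (rule Bochner_Integration.integrable_bound[OF L2_integrable_sq[OF assms]])
    show "(\<lambda>x. (norm (f x $ i))\<^sup>2) \<in> borel_measurable M" using m by measurable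
    show "AE x in M. norm ((norm (f x $ i))\<^sup>2) \<le> norm ((norm (f x))\<^sup>2)"
      using power_mono[OF component_le_norm_cart abs_ge_zero, of _ _ 2] by (intro AE_I2) simp
  qed
  with m show ?thesis by (auto simp: L2_def)
qed

lemma L2_Cauchy_Schwarz:
  assumes "f \<in> L2 M" "g \<in> L2 M"
  shows "(LINT x|M. f x \<bullet> g x)\<^sup>2 \<le> (LINT x|M. (norm (f x))\<^sup>2) * (LINT x|M. (norm (g x))\<^sup>2)"
proof (rule quadratic_nonneg_discriminant)
  show "0 \<le> (LINT x|M. (norm (g x))\<^sup>2)" by (rule integral_nonneg_AE) simp
  fix t :: real
  have "0 \<le> (LINT x|M. (norm (f x - t *\<^sub>R g x))\<^sup>2)" by (rule integral_nonneg_AE) simp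
  also have "(\<lambda>x. (norm (f x - t *\<^sub>R g x))\<^sup>2) =
      (\<lambda>x. (norm (f x))\<^sup>2 - 2 * t * (f x \<bullet> g x) + t\<^sup>2 * (norm (g x))\<^sup>2)"
    by (simp add: power2_norm_eq_inner inner_simps inner_commute) (simp add: power2_eq_square algebra_simps)
  also have "(LINT x|M. (norm (f x))\<^sup>2 - 2 * t * (f x \<bullet> g x) + t\<^sup>2 * (norm (g x))\<^sup>2) =
     (LINT x|M. (norm (f x))\<^sup>2) - 2 * t * (LINT x|M. f x \<bullet> g x) + t\<^sup>2 * (LINT x|M. (norm (g x))\<^sup>2)"
    using assms by (simp add: L2_integrable_sq L2_integrable_inner)
  finally show "0 \<le> \<dots>" .
qed

lemma L2_tendsto_inner:
  assumes f: "\<And>n. f n \<in> L2 M" "F \<in> L2 M" and g: "g \<in> L2 M"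
    and lim: "(\<lambda>n. LINT x|M. (norm (f n x - F x))\<^sup>2) \<longlonglongrightarrow> 0"
  shows "(\<lambda>n. LINT x|M. f n x \<bullet> g x) \<longlonglongrightarrow> (LINT x|M. F x \<bullet> g x)"
proof -
  have "(LINT x|M. f n x \<bullet> g x) - (LINT x|M. F x \<bullet> g x) = (LINT x|M. (f n x - F x) \<bullet> g x)" for n
    using assms by (simp add: L2_integrable_inner inner_diff_left)
  moreover have "(\<lambda>n. LINT x|M. (f n x - F x) \<bullet> g x) \<longlonglongrightarrow> 0"
  proof (rule Lim_null_comparison)
    have "\<bar>LINT x|M. (f n x - F x) \<bullet> g x\<bar> \<le> sqrt ((LINT x|M. (norm (f n x - F x))\<^sup>2) * (LINT x|M. (norm (g x))\<^sup>2))" for n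
      using L2_Cauchy_Schwarz[OF L2_diff[OF f(1)[of n] f(2)] g] by (intro real_le_rsqrt) (simp only: power2_abs)
    then show "\<forall>\<^sub>F n in sequentially. norm (LINT x|M. (f n x - F x) \<bullet> g x) \<le>
        sqrt ((LINT x|M. (norm (f n x - F x))\<^sup>2) * (LINT x|M. (norm (g x))\<^sup>2))" by simp
    have "(\<lambda>n. sqrt ((LINT x|M. (norm (f n x - F x))\<^sup>2) * (LINT x|M. (norm (g x))\<^sup>2))) \<longlonglongrightarrow> sqrt (0 * (LINT x|M. (norm (g x))\<^sup>2))"
      by (intro tendsto_intros lim)
    then show "(\<lambda>n. sqrt ((LINT x|M. (norm (f n x - F x))\<^sup>2) * (LINT x|M. (norm (g x))\<^sup>2))) \<longlonglongrightarrow> 0" by simp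
  qed
  ultimately have "(\<lambda>n. (LINT x|M. f n x \<bullet> g x) - (LINT x|M. F x \<bullet> g x)) \<longlonglongrightarrow> 0" by simp
  then show ?thesis by (rule LIM_zero_cancel)
qed

section \<open>Test functions and integration by parts\<close>

lemma test_functions_mono: "K \<subseteq> L \<Longrightarrow> test_functions K \<subseteq> test_functions L"
  unfolding test_functions_def by blast

lemma test_function_smooth: "\<phi> \<in> test_functions K \<Longrightarrow> smooth \<phi>"
  by (simp add: test_functions_def)

lemma test_functions_mult:
  assumes "\<phi> \<in> test_functions K" "smooth \<psi>"
  shows "(\<lambda>x. \<phi> x * \<psi> x) \<in> test_functions K"
proof -
  obtain C where C: "compact C" "C \<subseteq> K" "\<And>x. x \<notin> C \<Longrightarrow> \<phi> x = 0"
    using assms by (auto simp: test_functions_def)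
  then have "\<forall>x. x \<notin> C \<longrightarrow> \<phi> x * \<psi> x = 0" by simp
  with C(1,2) smooth_mult[OF test_function_smooth[OF assms(1)] assms(2)] show ?thesis
    unfolding test_functions_def by blast
qed

lemma test_functions_grad:
  assumes "\<phi> \<in> test_functions K"
  shows "(\<lambda>x. grad \<phi> x $ i) \<in> test_functions K"
proof -
  obtain C where C: "compact C" "C \<subseteq> K" "\<And>x. x \<notin> C \<Longrightarrow> \<phi> x = 0"
    using assms by (auto simp: test_functions_def)
  then have "\<And>x. x \<notin> C \<Longrightarrow> grad \<phi> x $ i = 0"
    using grad_eq_0_outside[OF compact_imp_closed] by (metis zero_index)
  with C assms show ?thesis by (auto simp: test_functions_def smooth_grad)
qed

lemma test_function_bounded:
  assumes "\<phi> \<in> test_functions K"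
  obtains B where "\<And>x. \<bar>\<phi> x\<bar> \<le> B"
proof -
  obtain C where C: "compact C" "C \<subseteq> K" "\<And>x. x \<notin> C \<Longrightarrow> \<phi> x = 0"
    using assms by (auto simp: test_functions_def)
  have "bounded (\<phi> ` C)"
    using assms C by (intro compact_imp_bounded compact_continuous_image smooth_imp_continuous test_function_smooth)
  then obtain B where "\<And>x. x \<in> C \<Longrightarrow> \<bar>\<phi> x\<bar> \<le> B" by (auto simp: bounded_iff)
  then have "\<bar>\<phi> x\<bar> \<le> max B 0" for x using C by (cases "x \<in> C") (auto simp: le_max_iff_disj)
  then show ?thesis using that by blast
qed

lemma continuous_measurable_lebesgue_on:
  fixes f :: "real^2 \<Rightarrow> 'b::euclidean_space"
  assumes "continuous_on UNIV f" "open K"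
  shows "f \<in> borel_measurable (lebesgue_on K)"
  using assms by (intro continuous_imp_measurable_on_sets_lebesgue continuous_on_subset[OF assms(1)]) auto

lemma continuous_L2:
  fixes f :: "real^2 \<Rightarrow> 'b::euclidean_space"
  assumes "continuous_on UNIV f" "open K" "bounded K"
  shows "f \<in> L2_on K"
proof -
  have K: "K \<in> lmeasurable" using assms by (simp add: lmeasurable_open)
  have m: "f \<in> borel_measurable (lebesgue_on K)" using assms by (intro continuous_measurable_lebesgue_on)
  have "compact (f ` closure K)"
    using assms by (intro compact_continuous_image) (auto intro: continuous_on_subset)
  then obtain B where B: "\<And>x. x \<in> K \<Longrightarrow> norm (f x) \<le> B"
    using closure_subset by (fastforce dest!: compact_imp_bounded simp: bounded_iff)
  interpret finite_measure "lebesgue_on K" using K by (rule finite_measure_lebesgue_on)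
  have "integrable (lebesgue_on K) (\<lambda>x. (norm (f x))\<^sup>2)"
  proof (rule integrable_const_bound)
    show "AE x in lebesgue_on K. norm ((norm (f x))\<^sup>2) \<le> B\<^sup>2"
      using B by (intro AE_I2) (auto intro!: power_mono)
    show "(\<lambda>x. (norm (f x))\<^sup>2) \<in> borel_measurable (lebesgue_on K)" using m by measurable
  qed
  with m show ?thesis by (simp add: L2_def)
qed

lemma smooth_L2: "smooth \<phi> \<Longrightarrow> open K \<Longrightarrow> bounded K \<Longrightarrow> \<phi> \<in> L2_on K"
  for \<phi> :: "real^2 \<Rightarrow> real"
  by (intro continuous_L2 smooth_imp_continuous)

lemma grad_L2: "smooth \<phi> \<Longrightarrow> open K \<Longrightarrow> bounded K \<Longrightarrow> grad \<phi> \<in> L2_on K"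
  by (intro continuous_L2 continuous_on_grad)

lemma test_function_L2: "\<phi> \<in> test_functions L \<Longrightarrow> open K \<Longrightarrow> bounded K \<Longrightarrow> \<phi> \<in> L2_on K"
  by (intro smooth_L2 test_function_smooth)

lemma integral_test_function_restrict:
  fixes \<phi> :: "real^2 \<Rightarrow> real"
  assumes "open K" "continuous_on UNIV \<phi>" "\<And>x. x \<notin> K \<Longrightarrow> \<phi> x = 0"
  shows "(LINT x|lebesgue_on K. \<phi> x) = (LINT x|lborel. \<phi> x)"
proof -
  have "(LINT x|lebesgue_on K. \<phi> x) = (LINT x|lebesgue. indicator K x *\<^sub>R \<phi> x)"
    using assms by (intro integral_restrict_space) auto
  also have "(\<lambda>x. indicator K x *\<^sub>R \<phi> x) = \<phi>"
    using assms by (auto simp: indicator_def fun_eq_iff)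
  also have "(LINT x|lebesgue. \<phi> x) = (LINT x|lborel. \<phi> x)"
    using assms by (intro integral_completion borel_measurable_continuous_onI) (simp add: borel_measurable_continuous_onI)
  finally show ?thesis .
qed

text \<open>The integral of the difference quotients vanishes by translation invariance.\<close>

lemma integral_grad_test_function:
  assumes "\<phi> \<in> test_functions UNIV"
  shows "(LINT x|lborel. grad \<phi> x $ i) = 0"
proof -
  obtain C where C: "compact C" "\<And>x. x \<notin> C \<Longrightarrow> \<phi> x = 0"
    using assms by (auto simp: test_functions_def)
  obtain R where R: "R > 0" "\<And>x. x \<in> C \<Longrightarrow> norm x \<le> R"
    using compact_imp_bounded[OF C(1)] by (auto simp: bounded_pos)
  note sm = test_function_smooth[OF assms]
  obtain B where B: "\<And>x. \<bar>grad \<phi> x $ i\<bar> \<le> B"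
    using test_function_bounded[OF test_functions_grad[OF assms, of i]] by metis
  have B0: "B \<ge> 0" using B[of 0] by linarith
  define e where "e n = (1 / real (Suc n)) *\<^sub>R (axis i 1 :: real^2)" for n
  define F where "F n x = real (Suc n) * (\<phi> (x + e n) - \<phi> x)" for n x
  have D: "((\<lambda>t. \<phi> (x + t *\<^sub>R axis i 1)) has_real_derivative grad \<phi> (x + t *\<^sub>R axis i 1) $ i) (at t)" for x t
  proof -
    have "((\<lambda>t::real. x + t *\<^sub>R (axis i 1 :: real^2)) has_derivative (\<lambda>h. h *\<^sub>R axis i 1)) (at t)"
      by (auto intro!: derivative_eq_intros)
    from diff_chain_at[OF this has_derivative_grad[OF smooth_imp_differentiable[OF sm]]]
    show ?thesis
      by (simp add: o_def has_field_derivative_def inner_axis mult_commute_abs)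
  qed
  have cont: "continuous_on UNIV \<phi>" using sm by (rule smooth_imp_continuous)
  have Fle: "\<bar>F n x\<bar> \<le> B" for n x
  proof -
    obtain z where z: "0 < z" "z < 1 / real (Suc n)"
      "\<phi> (x + (1 / real (Suc n)) *\<^sub>R axis i 1) - \<phi> (x + 0 *\<^sub>R axis i 1) =
       (1 / real (Suc n) - 0) * (grad \<phi> (x + z *\<^sub>R axis i 1) $ i)"
      using MVT2[of 0 "1 / real (Suc n)", OF _ D[of x]] by auto
    then have "F n x = grad \<phi> (x + z *\<^sub>R axis i 1) $ i"
      by (simp add: F_def e_def del: of_nat_Suc)
    then show ?thesis using B by simp
  qed
  have Fz: "F n x = 0" if "norm x > R + 1" for n x
  proof -
    have "norm (e n) \<le> 1" by (simp add: e_def)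
    then have "norm (x + e n) > R" using that norm_triangle_ineq4[of "x + e n" "e n"] by simp
    moreover have "norm x > R" using that by simp
    ultimately have "x + e n \<notin> C" "x \<notin> C" using R by force+
    then show ?thesis using C by (simp add: F_def)
  qed
  have int: "integrable lborel \<phi>"
  proof -
    have "integrable lborel (\<lambda>x. indicator C x *\<^sub>R \<phi> x)"
      using C(1) continuous_on_subset[OF cont] by (intro borel_integrable_compact) auto
    moreover have "(\<lambda>x. indicator C x *\<^sub>R \<phi> x) = \<phi>"
      using C(2) by (auto simp: indicator_def fun_eq_iff)
    ultimately show ?thesis by simp
  qed
  have "(\<lambda>n. LINT x|lborel. F n x) \<longlonglongrightarrow> (LINT x|lborel. grad \<phi> x $ i)"
  proof (rule integral_dominated_convergence[where w = "\<lambda>x. indicator (cball 0 (R + 1)) x *\<^sub>R B"])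
    show "integrable lborel (\<lambda>x. indicator (cball (0::real^2) (R + 1)) x *\<^sub>R B)"
      by (intro integrable_scaleR_left integrable_real_indicator) (use emeasure_lborel_cball_finite[of "0::real^2" "R + 1"] in auto)
    show "AE x in lborel. (\<lambda>n. F n x) \<longlonglongrightarrow> grad \<phi> x $ i"
    proof (rule AE_I2)
      fix x :: "real^2"
      have "((\<lambda>h. (\<phi> (x + h *\<^sub>R axis i 1) - \<phi> x) / h) \<longlongrightarrow> grad \<phi> x $ i) (at 0)"
        using D[of x 0] by (simp add: DERIV_def)
      moreover have "filterlim (\<lambda>n. 1 / real (Suc n)) (at 0) sequentially"
        using LIMSEQ_inverse_real_of_nat by (simp add: filterlim_at inverse_eq_divide del: of_nat_Suc)
      ultimately have "((\<lambda>n. (\<phi> (x + (1 / real (Suc n)) *\<^sub>R axis i 1) - \<phi> x) / (1 / real (Suc n))) \<longlongrightarrow> grad \<phi> x $ i) sequentially"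
        by (rule filterlim_compose)
      then show "(\<lambda>n. F n x) \<longlonglongrightarrow> grad \<phi> x $ i"
        by (simp add: F_def e_def mult.commute del: of_nat_Suc)
    qed
    show "AE x in lborel. norm (F n x) \<le> indicator (cball (0::real^2) (R + 1)) x *\<^sub>R B" for n
      using Fle[of n] Fz[of _ n] by (intro AE_I2) (auto simp: indicator_def not_le)
    show "(\<lambda>x. grad \<phi> x $ i) \<in> borel_measurable lborel"
      using smooth_imp_continuous[OF smooth_grad[OF sm]] by (simp add: borel_measurable_continuous_onI)
    have "continuous_on UNIV (F n)" for n
      unfolding F_def by (intro continuous_intros smooth_imp_continuous sm continuous_on_compose2[OF cont]) auto
    then show "F n \<in> borel_measurable lborel" for n
      by (simp add: borel_measurable_continuous_onI)
  qed
  moreover have "(LINT x|lborel. F n x) = 0" for n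
  proof -
    have m: "\<phi> \<in> borel_measurable borel" using cont by (rule borel_measurable_continuous_onI)
    have i2: "integrable lborel (\<lambda>x. \<phi> (e n + x))" "(LINT x|lborel. \<phi> (e n + x)) = (LINT x|lborel. \<phi> x)"
      using integrable_distr_eq[of "(+) (e n)" lborel borel \<phi>] integral_distr[of "(+) (e n)" lborel borel \<phi>]
        int m by (simp_all add: lborel_distr_plus)
    then show ?thesis using int by (simp add: F_def add.commute)
  qed
  ultimately show ?thesis by (simp add: LIMSEQ_const_iff)
qed

lemma grad_by_parts:
  assumes "open K" "bounded K" "\<phi> \<in> test_functions K" "smooth \<psi>"
  shows "(LINT x|lebesgue_on K. \<psi> x * grad \<phi> x $ i) = - (LINT x|lebesgue_on K. \<phi> x * grad \<psi> x $ i)"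
proof -
  have t: "(\<lambda>x. \<phi> x * \<psi> x) \<in> test_functions K" using assms by (intro test_functions_mult)
  note d = smooth_imp_differentiable[OF assms(4)] smooth_imp_differentiable[OF test_function_smooth[OF assms(3)]]
  have "(LINT x|lebesgue_on K. \<psi> x * grad \<phi> x $ i) + (LINT x|lebesgue_on K. \<phi> x * grad \<psi> x $ i) =
     (LINT x|lebesgue_on K. \<psi> x * grad \<phi> x $ i + \<phi> x * grad \<psi> x $ i)"
    using assms test_function_smooth[OF assms(3)]
    by (intro Bochner_Integration.integral_add[symmetric] L2_integrable_mult smooth_L2 smooth_grad)
  also have "\<dots> = (LINT x|lebesgue_on K. grad (\<lambda>x. \<phi> x * \<psi> x) x $ i)"
    using d by (simp add: grad_mult add.commute)
  also have "\<dots> = (LINT x|lborel. grad (\<lambda>x. \<phi> x * \<psi> x) x $ i)"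
    using assms t by (intro integral_test_function_restrict)
      (auto intro!: smooth_imp_continuous smooth_grad test_function_smooth[OF t] simp: test_function_outside(2)[OF t])
  also have "\<dots> = 0"
    using t test_functions_mono[of K UNIV] by (intro integral_grad_test_function) auto
  finally show ?thesis by simp
qed

lemma integral_vec_nth:
  fixes f :: "'a \<Rightarrow> real^2"
  shows "integrable M f \<Longrightarrow> (LINT x|M. f x) $ i = (LINT x|M. f x $ i)"
  by (rule integral_bounded_linear[OF bounded_linear_vec_nth, symmetric])

lemma integrable_vec:
  fixes f :: "'a \<Rightarrow> real^2"
  assumes "\<And>i. integrable M (\<lambda>x. f x $ i)"
  shows "integrable M f"
proof -
  have "integrable M (\<lambda>x. \<Sum>i\<in>UNIV. (f x $ i) *\<^sub>R (axis i 1 :: real^2))"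
    using assms by (intro Bochner_Integration.integrable_sum integrable_scaleR_left) auto
  moreover have "(\<Sum>i\<in>UNIV. (f x $ i) *\<^sub>R (axis i 1 :: real^2)) = f x" for x
    by (simp add: vec_eq_iff axis_def if_distrib cong: if_cong)
  ultimately show ?thesis by simp
qed

text \<open>All products in sight are integrable, so the vector-valued integrals may be taken componentwise;
  without integrability both would be 0 by convention, whatever their components are.\<close>

lemma has_weak_grad_iff:
  assumes K: "open K" "bounded K" and v: "v \<in> L2_on K" and G: "G \<in> L2_on K"
  shows "has_weak_grad K v G \<longleftrightarrow> (\<forall>\<phi> \<in> test_functions K. \<forall>i.
     (LINT x|lebesgue_on K. v x * grad \<phi> x $ i) = - (LINT x|lebesgue_on K. \<phi> x * G x $ i))"
proof -
  have "(LINT x|lebesgue_on K. v x *\<^sub>R grad \<phi> x) $ i = (LINT x|lebesgue_on K. v x * grad \<phi> x $ i)"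
    "(- (LINT x|lebesgue_on K. \<phi> x *\<^sub>R G x)) $ i = - (LINT x|lebesgue_on K. \<phi> x * G x $ i)"
    if "\<phi> \<in> test_functions K" for \<phi> i
  proof -
    have "integrable (lebesgue_on K) (\<lambda>x. v x *\<^sub>R grad \<phi> x)" "integrable (lebesgue_on K) (\<lambda>x. \<phi> x *\<^sub>R G x)"
      using that K v G
      by (auto intro!: integrable_vec L2_integrable_mult L2_component test_function_L2 grad_L2 test_function_smooth)
    then show "(LINT x|lebesgue_on K. v x *\<^sub>R grad \<phi> x) $ i = (LINT x|lebesgue_on K. v x * grad \<phi> x $ i)"
      "(- (LINT x|lebesgue_on K. \<phi> x *\<^sub>R G x)) $ i = - (LINT x|lebesgue_on K. \<phi> x * G x $ i)"
      by (simp_all add: integral_vec_nth)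
  qed
  then show ?thesis
    unfolding has_weak_grad_def vec_eq_iff by simp
qed

lemma has_weak_grad_smooth:
  assumes "open K" "bounded K" "smooth \<psi>"
  shows "has_weak_grad K \<psi> (grad \<psi>)"
  using assms grad_by_parts by (subst has_weak_grad_iff) (auto intro: smooth_L2 grad_L2)

lemma integral_inner_2:
  fixes f g :: "'a \<Rightarrow> real^2"
  assumes "f \<in> L2 M" "g \<in> L2 M"
  shows "(LINT x|M. f x \<bullet> g x) = (\<Sum>i\<in>UNIV. LINT x|M. f x $ i * g x $ i)"
  using assms unfolding inner_vec_def inner_real_def
  by (intro Bochner_Integration.integral_sum L2_integrable_mult L2_component)

lemma has_weak_laplacian_smooth:
  assumes K: "open K" "bounded K" and \<psi>: "smooth \<psi>"
  shows "has_weak_laplacian K \<psi> (laplacian \<psi>)"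
  unfolding has_weak_laplacian_def
proof
  fix \<phi> assume \<phi>: "\<phi> \<in> test_functions K"
  note sm = test_function_smooth[OF \<phi>]
  have "(LINT x|lebesgue_on K. \<psi> x * laplacian \<phi> x) =
      (\<Sum>i\<in>UNIV. LINT x|lebesgue_on K. \<psi> x * grad (\<lambda>y. grad \<phi> y $ i) x $ i)"
    unfolding laplacian_def sum_distrib_left using K \<psi> sm
    by (intro Bochner_Integration.integral_sum L2_integrable_mult smooth_L2 smooth_grad)
  also have "\<dots> = (\<Sum>i\<in>UNIV. LINT x|lebesgue_on K. grad (\<lambda>y. grad \<psi> y $ i) x $ i * \<phi> x)"
  proof (rule sum.cong)
    fix i :: 2
    show "(LINT x|lebesgue_on K. \<psi> x * grad (\<lambda>y. grad \<phi> y $ i) x $ i) =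
       (LINT x|lebesgue_on K. grad (\<lambda>y. grad \<psi> y $ i) x $ i * \<phi> x)"
      using grad_by_parts[OF K test_functions_grad[OF \<phi>, of i] \<psi>, of i]
        grad_by_parts[OF K \<phi> smooth_grad[OF \<psi>, of i], of i] by (simp add: mult.commute)
  qed simp
  also have "\<dots> = (LINT x|lebesgue_on K. laplacian \<psi> x * \<phi> x)"
    unfolding laplacian_def sum_distrib_right using K \<psi> sm
    by (intro Bochner_Integration.integral_sum[symmetric] L2_integrable_mult smooth_L2 smooth_grad)
  finally show "(LINT x|lebesgue_on K. \<psi> x * laplacian \<phi> x) = (LINT x|lebesgue_on K. laplacian \<psi> x * \<phi> x)" .
qed

text \<open>A partial derivative of a test function is again a test function, so the weak gradient can be
  tested against it; summing over the coordinates turns \<open>v \<Delta>\<phi>\<close> into \<open>- G \<cdot> \<nabla>\<phi>\<close>.\<close>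

lemma weak_green_test_function:
  assumes K: "open K" "bounded K" and v: "v \<in> L2_on K" and G: "G \<in> L2_on K"
    and wg: "has_weak_grad K v G" and wl: "has_weak_laplacian K v f" and \<phi>: "\<phi> \<in> test_functions K"
  shows "(LINT x|lebesgue_on K. G x \<bullet> grad \<phi> x) = - (LINT x|lebesgue_on K. f x * \<phi> x)"
proof -
  note sm = test_function_smooth[OF \<phi>]
  have "(LINT x|lebesgue_on K. f x * \<phi> x) = (LINT x|lebesgue_on K. v x * laplacian \<phi> x)"
    using wl \<phi> by (simp add: has_weak_laplacian_def)
  also have "\<dots> = (\<Sum>i\<in>UNIV. LINT x|lebesgue_on K. v x * grad (\<lambda>y. grad \<phi> y $ i) x $ i)"
    unfolding laplacian_def sum_distrib_left using K sm
    by (intro Bochner_Integration.integral_sum L2_integrable_mult[OF v] smooth_L2 smooth_grad)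
  also have "\<dots> = (\<Sum>i\<in>UNIV. - (LINT x|lebesgue_on K. G x $ i * grad \<phi> x $ i))"
    using wg test_functions_grad[OF \<phi>] by (simp add: has_weak_grad_iff[OF K v G] mult.commute)
  also have "\<dots> = - (LINT x|lebesgue_on K. G x \<bullet> grad \<phi> x)"
    using K G sm by (simp add: integral_inner_2 grad_L2 sum_negf)
  finally show ?thesis by simp
qed

section \<open>Uniqueness of weak derivatives\<close>

text \<open>Smooth steps rising from each face of the box become steeper with \<open>n\<close>. Their products stay supported
  in the closed box, so they are test functions on every open set that contains it.\<close>

lemma box_approximation:
  fixes a b :: "real^2"
  obtains \<beta> where "\<And>n. \<beta> n \<in> test_functions (cbox a b)" "\<And>n x. \<bar>\<beta> n x\<bar> \<le> 1"
    "\<And>x. (\<lambda>n. \<beta> n x) \<longlonglongrightarrow> indicator (box a b) x"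
proof -
  obtain s :: "real \<Rightarrow> real" where s: "smooth s" "\<And>t. t \<le> 0 \<Longrightarrow> s t = 0" "\<And>t. t \<ge> 1 \<Longrightarrow> s t = 1"
    "\<And>t. 0 \<le> s t" "\<And>t. s t \<le> 1" using smooth_step_exists by metis
  define g where "g n i x = s (real n * (x $ i - a $ i)) * s (real n * (b $ i - x $ i))" for n i and x :: "real^2"
  define \<beta> where "\<beta> n x = g n 1 x * g n 2 x" for n x
  have g01: "0 \<le> g n i x" "g n i x \<le> 1" for n i x
    using s(4,5) by (auto simp: g_def intro: mult_le_one)
  have out: "g n i x = 0" if "\<not> (a $ i < x $ i \<and> x $ i < b $ i)" for n i x
  proof -
    have "real n * (x $ i - a $ i) \<le> 0 \<or> real n * (b $ i - x $ i) \<le> 0"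
      using that by (auto simp: mult_le_0_iff)
    then show ?thesis using s(2) by (auto simp: g_def)
  qed
  have "smooth (g n i)" for n i
  proof -
    have "bounded_linear (\<lambda>x::real^2. real n * x $ i)" "bounded_linear (\<lambda>x::real^2. (- real n) * x $ i)"
      by (intro bounded_linear_const_mult bounded_linear_vec_nth)+
    from this[THEN smooth_compose_affine[OF _ s(1)]]
    have "smooth (\<lambda>x::real^2. s (real n * x $ i + (- real n * a $ i)))"
      "smooth (\<lambda>x::real^2. s (- real n * x $ i + real n * b $ i))" by blast+
    from smooth_mult[OF this] show ?thesis by (simp add: g_def[abs_def] algebra_simps)
  qed
  then have sm: "smooth (\<beta> n)" for n by (simp add: \<beta>_def[abs_def] smooth_mult)
  show thesis
  proof (rule that)
    show "\<beta> n \<in> test_functions (cbox a b)" for n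
    proof -
      have "\<beta> n x = 0" if "x \<notin> cbox a b" for x
        using that out[of 1 x n] out[of 2 x n] by (force simp: \<beta>_def mem_box_cart forall_2)
      then show ?thesis unfolding test_functions_def using sm by (auto intro!: exI[of _ "cbox a b"])
    qed
    show "\<bar>\<beta> n x\<bar> \<le> 1" for n x
      using g01[of n 1 x] g01[of n 2 x] by (auto simp: \<beta>_def abs_mult intro: mult_le_one)
    show "(\<lambda>n. \<beta> n x) \<longlonglongrightarrow> indicator (box a b) x" for x
    proof (cases "x \<in> box a b")
      case True
      have ev: "\<forall>\<^sub>F n in sequentially. s (real n * c) = 1" if "c > 0" for c
      proof -
        obtain N where "1 / c \<le> real N" using real_arch_simple by blast
        then have "1 \<le> real n * c" if "n \<ge> N" for n
          using that \<open>c > 0\<close> by (simp add: pos_divide_le_eq) (meson of_nat_mono mult_right_mono less_imp_le order_trans)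
        then show ?thesis using s(3) by (auto simp: eventually_sequentially)
      qed
      have "\<forall>\<^sub>F n in sequentially. g n i x = 1" for i
        using ev[of "x $ i - a $ i"] ev[of "b $ i - x $ i"] True
        by (auto simp: g_def mem_box_cart elim: eventually_elim2)
      from this[of 1] this[of 2] have "\<forall>\<^sub>F n in sequentially. \<beta> n x = 1"
        by eventually_elim (simp add: \<beta>_def)
      with True show ?thesis by (auto intro: tendsto_eventually)
    next
      case False
      then have "\<beta> n x = 0" for n
        using out[of 1 x n] out[of 2 x n] by (force simp: \<beta>_def mem_box_cart forall_2)
      with False show ?thesis by simp
    qed
  qed
qed

text \<open>The fundamental lemma of the calculus of variations: approximating indicators shows that \<open>f\<close> has
  integral 0 over every box in \<open>K\<close>, and almost every value of \<open>f\<close> is a limit of averages over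
  shrinking boxes.\<close>

lemma test_functions_separate_L2:
  fixes f :: "real^2 \<Rightarrow> real"
  assumes K: "open K" "bounded K" and f: "f \<in> L2_on K"
    and z: "\<And>\<phi>. \<phi> \<in> test_functions K \<Longrightarrow> (LINT x|lebesgue_on K. f x * \<phi> x) = 0"
  shows "AE x in lebesgue_on K. f x = 0"
proof -
  have Ks: "K \<in> sets lebesgue" using K by auto
  have "integrable (lebesgue_on K) (\<lambda>x. f x * 1)"
    using K by (intro L2_integrable_mult[OF f] continuous_L2) auto
  then have fi: "integrable (lebesgue_on K) f" by simp
  have box0: "(LINT x|lebesgue_on K. f x * indicator (box a b) x) = 0" if ab: "cbox a b \<subseteq> K" for a b
  proof -
    obtain \<beta> where \<beta>: "\<And>n. \<beta> n \<in> test_functions (cbox a b)" "\<And>n x. \<bar>\<beta> n x\<bar> \<le> 1"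
      "\<And>x. (\<lambda>n. \<beta> n x) \<longlonglongrightarrow> indicator (box a b) x" using box_approximation by metis
    have "(\<lambda>n. LINT x|lebesgue_on K. f x * \<beta> n x) \<longlonglongrightarrow> (LINT x|lebesgue_on K. f x * indicator (box a b) x)"
    proof (rule integral_dominated_convergence[where w = "\<lambda>x. \<bar>f x\<bar>"])
      show "AE x in lebesgue_on K. (\<lambda>n. f x * \<beta> n x) \<longlonglongrightarrow> f x * indicator (box a b) x"
        using \<beta>(3) by (intro AE_I2 tendsto_intros)
      show "AE x in lebesgue_on K. norm (f x * \<beta> n x) \<le> \<bar>f x\<bar>" for n
        using \<beta>(2) by (intro AE_I2) (auto simp: abs_mult intro!: mult_left_le)
      show "integrable (lebesgue_on K) (\<lambda>x. \<bar>f x\<bar>)" using fi by simp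
      have m: "f \<in> borel_measurable (lebesgue_on K)" using f by (rule L2_measurable)
      have "\<beta> n \<in> borel_measurable (lebesgue_on K)" for n
        using L2_measurable[OF test_function_L2[OF \<beta>(1) K]] .
      then show "(\<lambda>x. f x * \<beta> n x) \<in> borel_measurable (lebesgue_on K)" for n
        using m by measurable
      have "indicat_real (box a b) \<in> borel_measurable (lebesgue_on K)"
        by (rule measurable_restrict_space1, rule borel_measurable_indicator) simp
      then show "(\<lambda>x. f x * indicator (box a b) x) \<in> borel_measurable (lebesgue_on K)"
        using m by measurable
    qed
    moreover have "(LINT x|lebesgue_on K. f x * \<beta> n x) = 0" for n
      using z \<beta>(1) test_functions_mono[OF ab] by blast
    ultimately show ?thesis by (simp add: LIMSEQ_const_iff)
  qed
  define F where "F x = indicator K x *\<^sub>R f x" for x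
  have Fi: "integrable lebesgue F"
    using fi Ks by (simp add: F_def[abs_def] integrable_restrict_space)
  have F0: "integral (cbox a b) F = 0" if "cbox a b \<subseteq> K" for a b
  proof -
    have ss: "box a b \<subseteq> K" using that box_subset_cbox by blast
    have "integral (cbox a b) F = integral (box a b) F" by (simp add: integral_open_interval)
    also have "\<dots> = (LINT x|lebesgue_on (box a b). F x)"
      by (rule lebesgue_integral_eq_integral[symmetric]) (use integrable_mult_indicator[OF _ Fi, of "box a b"] in \<open>auto simp: integrable_restrict_space\<close>)
    also have "\<dots> = (LINT x|lebesgue. indicator (box a b) x *\<^sub>R F x)"
      by (intro integral_restrict_space) auto
    also have "\<dots> = (LINT x|lebesgue. indicator K x *\<^sub>R (f x * indicator (box a b) x))"
      using ss by (intro Bochner_Integration.integral_cong) (auto simp: F_def indicator_def)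
    also have "\<dots> = (LINT x|lebesgue_on K. f x * indicator (box a b) x)"
      using Ks by (intro integral_restrict_space[symmetric]) auto
    also have "\<dots> = 0" using that by (rule box0)
    finally show ?thesis .
  qed
  have "F integrable_on cbox a b" for a b
    by (rule integrable_on_subcbox[OF integrable_on_lebesgue[OF Fi]]) simp
  then obtain N where N: "negligible N"
    "\<And>x e. \<lbrakk>x \<notin> N; 0 < e\<rbrakk> \<Longrightarrow> \<exists>d>0. \<forall>h. 0 < h \<and> h < d \<longrightarrow>
        norm(integral (cbox x (x + h *\<^sub>R One)) F /\<^sub>R h ^ DIM(real^2) - F x) < e"
    using integrable_ccontinuous_explicit[of F] by metis
  have "f x = 0" if x: "x \<in> K" "x \<notin> N" for x
  proof (rule ccontr)
    assume "f x \<noteq> 0"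
    then obtain d where d: "d > 0" "\<And>h. 0 < h \<Longrightarrow> h < d \<Longrightarrow>
        norm(integral (cbox x (x + h *\<^sub>R One)) F /\<^sub>R h ^ DIM(real^2) - F x) < \<bar>f x\<bar>"
      using N(2)[of x "\<bar>f x\<bar>"] x by auto
    obtain r where r: "r > 0" "ball x r \<subseteq> K" using K x openE by blast
    define h where "h = min (d / 2) (r / 4)"
    have h: "0 < h" "h < d" "2 * h < r" using d r by (auto simp: h_def)
    have "cbox x (x + h *\<^sub>R One) \<subseteq> ball x r"
    proof
      fix y assume "y \<in> cbox x (x + h *\<^sub>R One)"
      then have "x \<bullet> b \<le> y \<bullet> b" "y \<bullet> b \<le> x \<bullet> b + h" if "b \<in> Basis" for b
        using that by (auto simp: mem_box inner_add_left)
      from this[of "axis _ 1"] h(1) have "\<bar>(y - x) $ i\<bar> \<le> h" for i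
        by (simp add: cart_eq_inner_axis inner_diff_left axis_in_Basis_iff abs_le_iff) (smt (verit))
      from this[of 1] this[of 2] have "norm (y - x) \<le> 2 * h"
        using norm_le_l1_cart[of "y - x"] by (simp add: sum_2)
      with h show "y \<in> ball x r" by (simp add: dist_norm norm_minus_commute)
    qed
    with r F0 have "integral (cbox x (x + h *\<^sub>R One)) F = 0" by blast
    with d(2)[OF h(1,2)] x show False by (simp add: F_def)
  qed
  moreover have "AE x in lebesgue. x \<notin> N"
    using N(1) by (simp add: negligible_iff_null_sets AE_not_in)
  ultimately show ?thesis
    using Ks by (subst AE_restrict_space_iff) auto
qed

lemma weak_laplacian_unique:
  assumes K: "open K" "bounded K"
    and f: "f \<in> L2_on K" "has_weak_laplacian K v f"
    and g: "g \<in> L2_on K" "has_weak_laplacian K v g"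
  shows "AE x in lebesgue_on K. f x = g x"
proof -
  have "AE x in lebesgue_on K. f x - g x = 0"
  proof (rule test_functions_separate_L2[OF K L2_diff[OF f(1) g(1)]])
    fix \<phi> assume \<phi>: "\<phi> \<in> test_functions K"
    then have "(LINT x|lebesgue_on K. f x * \<phi> x) = (LINT x|lebesgue_on K. g x * \<phi> x)"
      using f(2) g(2) by (simp add: has_weak_laplacian_def)
    then show "(LINT x|lebesgue_on K. (f x - g x) * \<phi> x) = 0"
      using L2_integrable_mult[OF f(1) test_function_L2[OF \<phi> K]] L2_integrable_mult[OF g(1) test_function_L2[OF \<phi> K]]
      by (simp add: left_diff_distrib)
  qed
  then show ?thesis by simp
qed

lemma weak_laplacian_eq_AE:
  assumes "open K" "bounded K" "f \<in> L2_on K" "has_weak_laplacian K v f"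
  shows "weak_laplacian K v \<in> L2_on K" "has_weak_laplacian K v (weak_laplacian K v)"
    "AE x in lebesgue_on K. weak_laplacian K v x = f x"
proof -
  show *: "weak_laplacian K v \<in> L2_on K" "has_weak_laplacian K v (weak_laplacian K v)"
    unfolding weak_laplacian_def
    using someI[of "\<lambda>f. f \<in> L2_on K \<and> has_weak_laplacian K v f" f] assms by auto
  show "AE x in lebesgue_on K. weak_laplacian K v x = f x"
    using weak_laplacian_unique[OF assms(1,2) * assms(3,4)] .
qed

lemma weak_grad_unique:
  assumes K: "open K" "bounded K" and v: "v \<in> L2_on K"
    and f: "f \<in> L2_on K" "has_weak_grad K v f"
    and g: "g \<in> L2_on K" "has_weak_grad K v g"
  shows "AE x in lebesgue_on K. f x = g x"
proof -
  have "AE x in lebesgue_on K. f x $ i - g x $ i = 0" for i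
  proof (rule test_functions_separate_L2[OF K L2_diff[OF L2_component[OF f(1)] L2_component[OF g(1)]]])
    fix \<phi> assume \<phi>: "\<phi> \<in> test_functions K"
    then have "(LINT x|lebesgue_on K. \<phi> x * f x $ i) = (LINT x|lebesgue_on K. \<phi> x * g x $ i)"
      using f(2) g(2) by (simp add: has_weak_grad_iff[OF K v f(1)] has_weak_grad_iff[OF K v g(1)])
    moreover have "integrable (lebesgue_on K) (\<lambda>x. \<phi> x * f x $ i)" "integrable (lebesgue_on K) (\<lambda>x. \<phi> x * g x $ i)"
      using f(1) g(1) by (intro L2_integrable_mult[OF test_function_L2[OF \<phi> K]] L2_component; simp)+
    ultimately show "(LINT x|lebesgue_on K. (f x $ i - g x $ i) * \<phi> x) = 0"
      by (simp add: right_diff_distrib mult.commute[of _ "\<phi> _"])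
  qed
  from this[of 1] this[of 2] show ?thesis
    by eventually_elim (simp add: vec_eq_iff forall_2)
qed

lemma weak_grad_H1:
  assumes "v \<in> H1 K"
  shows "v \<in> L2_on K" "weak_grad K v \<in> L2_on K" "has_weak_grad K v (weak_grad K v)"
proof -
  obtain G where G: "v \<in> L2_on K" "G \<in> L2_on K" "has_weak_grad K v G"
    using assms by (auto simp: H1_def)
  then show "v \<in> L2_on K" by simp
  show "weak_grad K v \<in> L2_on K" "has_weak_grad K v (weak_grad K v)"
    unfolding weak_grad_def
    using someI[of "\<lambda>G. G \<in> L2_on K \<and> has_weak_grad K v G" G] G by auto
qed

lemma smooth_H1:
  assumes K: "open K" "bounded K" and \<psi>: "smooth \<psi>"
  shows "\<psi> \<in> H1 K" "AE x in lebesgue_on K. weak_grad K \<psi> x = grad \<psi> x"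
proof -
  show H: "\<psi> \<in> H1 K"
    unfolding H1_def using smooth_L2[OF \<psi> K] grad_L2[OF \<psi> K] has_weak_grad_smooth[OF K \<psi>] by blast
  show "AE x in lebesgue_on K. weak_grad K \<psi> x = grad \<psi> x"
    using weak_grad_unique[OF K weak_grad_H1[OF H] grad_L2[OF \<psi> K] has_weak_grad_smooth[OF K \<psi>]] .
qed

section \<open>Orthonormal coordinates\<close>

lemma continuous_on_vector2:
  fixes f g :: "'a::t2_space \<Rightarrow> real"
  assumes "continuous_on S f" "continuous_on S g"
  shows "continuous_on S (\<lambda>x. vector [f x, g x] :: real^2)"
  by (subst continuous_on_componentwise)
     (use assms in \<open>auto simp: Basis_vec_def inner_axis UNIV_2 intro!: continuous_intros\<close>)

text \<open>Tonelli's theorem is about product spaces; this transports it to \<open>real^2\<close>.\<close>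

lemma lborel_real2: "distr lborel borel (\<lambda>p. vector [fst p, snd p] :: real^2) = lborel"
proof (rule lborel_eqI[symmetric])
  have c: "continuous_on UNIV (\<lambda>p. vector [fst p, snd p] :: real^2)"
    by (intro continuous_on_vector2 continuous_intros)
  have m: "(\<lambda>p. vector [fst p, snd p] :: real^2) \<in> lborel \<rightarrow>\<^sub>M borel"
    using borel_measurable_continuous_onI[OF c] by simp
  fix l u :: "real^2" assume lu: "\<And>b. b \<in> Basis \<Longrightarrow> l \<bullet> b \<le> u \<bullet> b"
  then have le: "l $ 1 \<le> u $ 1" "l $ 2 \<le> u $ 2"
    by (auto simp: cart_eq_inner_axis axis_in_Basis_iff)
  have "(\<lambda>p. vector [fst p, snd p] :: real^2) -` box l u = box (l $ 1, l $ 2) (u $ 1, u $ 2)"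
  proof -
    have "(s, t) \<in> box (a, b) (c, d) \<longleftrightarrow> a < s \<and> s < c \<and> b < t \<and> t < d" for s t a b c d :: real
      by (auto simp: mem_box Basis_prod_def)
    then show ?thesis by (auto simp: mem_box_cart forall_2)
  qed
  then have "emeasure (distr lborel borel (\<lambda>p. vector [fst p, snd p] :: real^2)) (box l u) =
      emeasure lborel (box (l $ 1, l $ 2) (u $ 1, u $ 2))"
    using m by (subst emeasure_distr) auto
  also have "\<dots> = ennreal ((u $ 1 - l $ 1) * (u $ 2 - l $ 2))"
    using le by (subst emeasure_lborel_box) (auto simp: Basis_prod_def)
  also have "(u $ 1 - l $ 1) * (u $ 2 - l $ 2) = (\<Prod>b\<in>Basis. (u - l) \<bullet> b)"
    by (simp add: Basis_vec_def UNIV_2 axis_eq_axis inner_axis)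
  finally show "emeasure (distr lborel borel (\<lambda>p. vector [fst p, snd p] :: real^2)) (box l u) =
      (\<Prod>b\<in>Basis. (u - l) \<bullet> b)" .
qed simp

lemma lborel_orthogonal:
  fixes R :: "real^2 \<Rightarrow> real^2"
  assumes R: "orthogonal_transformation R"
  shows "distr lborel borel R = lborel"
proof (rule lborel_eqI[symmetric])
  have m: "R \<in> lborel \<rightarrow>\<^sub>M borel"
    using R by (simp add: borel_measurable_continuous_onI linear_continuous_on orthogonal_transformation_linear linear_conv_bounded_linear[symmetric])
  fix l u :: "real^2" assume lu: "\<And>b. b \<in> Basis \<Longrightarrow> l \<bullet> b \<le> u \<bullet> b"
  have R': "orthogonal_transformation (inv R)" using R by (rule orthogonal_transformation_inv)
  have v: "R -` box l u = inv R ` box l u"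
    using R by (simp add: bij_vimage_eq_inv_image orthogonal_transformation_bij)
  have lm: "inv R ` box l u \<in> lmeasurable" using R' by (rule measurable_orthogonal_image) simp
  have "emeasure (distr lborel borel R) (box l u) = emeasure lebesgue (inv R ` box l u)"
    using m measurable_sets[OF m, of "box l u"] by (simp add: emeasure_distr v)
  also have "\<dots> = emeasure lebesgue (box l u)"
    using lm measure_orthogonal_image[OF R', of "box l u"] by (simp add: emeasure_eq_measure2 fmeasurableD2)
  also have "\<dots> = (\<Prod>b\<in>Basis. (u - l) \<bullet> b)" using lu by simp
  finally show "emeasure (distr lborel borel R) (box l u) = (\<Prod>b\<in>Basis. (u - l) \<bullet> b)" .
qed simp

text \<open>The point with coordinates \<open>(s, t)\<close> in the frame of \<open>lipschitz_boundary\<close>, that is, the inverse of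
  \<open>x \<mapsto> R (x - z)\<close>.\<close>

definition chart :: "(real^2 \<Rightarrow> real^2) \<Rightarrow> real^2 \<Rightarrow> real \<Rightarrow> real \<Rightarrow> real^2" where
  "chart R z s t = z + inv R (vector [s, t])"

lemma chart_coords:
  assumes "orthogonal_transformation R"
  shows "chart R z (R (x - z) $ 1) (R (x - z) $ 2) = x"
    "R (chart R z s t - z) = vector [s, t]"
proof -
  have "vector [R (x - z) $ 1, R (x - z) $ 2] = R (x - z)" by (simp add: vec_eq_iff forall_2)
  then show "chart R z (R (x - z) $ 1) (R (x - z) $ 2) = x"
    using assms by (simp add: chart_def orthogonal_transformation_inj)
  show "R (chart R z s t - z) = vector [s, t]"
    using assms by (simp add: chart_def orthogonal_transformation_surj surj_f_inv_f)
qed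

lemma dist_chart:
  assumes "orthogonal_transformation R"
  shows "dist (chart R z s t) (chart R z s' t') = sqrt ((s - s')\<^sup>2 + (t - t')\<^sup>2)"
proof -
  have R': "orthogonal_transformation (inv R)" using assms by (rule orthogonal_transformation_inv)
  have "dist (chart R z s t) (chart R z s' t') = norm (inv R (vector [s, t] - vector [s', t']))"
    using R' by (simp add: chart_def dist_norm linear_diff orthogonal_transformation_linear)
  also have "\<dots> = norm (vector [s, t] - vector [s', t'] :: real^2)"
    using R' by (rule orthogonal_transformation_norm)
  finally show ?thesis by (simp add: norm_vec_def L2_set_def sum_2)
qed

lemma chart_center: "orthogonal_transformation R \<Longrightarrow> chart R z 0 0 = z"
  using chart_coords(1)[of R z z] orthogonal_transformation_linear[of R] by (simp add: linear_0)

lemma continuous_on_chart [continuous_intros]: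
  fixes f g :: "'a::t2_space \<Rightarrow> real"
  assumes R: "orthogonal_transformation R" and "continuous_on S f" "continuous_on S g"
  shows "continuous_on S (\<lambda>x. chart R z (f x) (g x))"
proof -
  have c: "continuous_on S (\<lambda>x. vector [f x, g x] :: real^2)"
    using assms(2,3) by (rule continuous_on_vector2)
  have "continuous_on UNIV (inv R)"
    using R by (simp add: linear_continuous_on orthogonal_transformation_inv
       orthogonal_transformation_linear linear_conv_bounded_linear[symmetric])
  then show ?thesis
    unfolding chart_def by (intro continuous_intros continuous_on_compose2[OF _ c]) auto
qed

lemma chart_vertical_derivative:
  assumes R: "orthogonal_transformation R"
  shows "((\<lambda>t. chart R z s t) has_derivative (\<lambda>h. h *\<^sub>R inv R (axis 2 1))) (at t)"
proof -
  have l: "linear (inv R)" using R by (simp add: orthogonal_transformation_inv orthogonal_transformation_linear)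
  have "chart R z s = (\<lambda>t. z + inv R (vector [s, 0]) + t *\<^sub>R inv R (axis 2 1))"
  proof
    fix t
    have "vector [s, t] = vector [s, 0] + t *\<^sub>R (axis 2 1 :: real^2)" by (simp add: vec_eq_iff forall_2 axis_def)
    then show "chart R z s t = z + inv R (vector [s, 0]) + t *\<^sub>R inv R (axis 2 1)"
      using l by (simp add: chart_def linear_add linear_cmul)
  qed
  moreover have "((\<lambda>t::real. z + inv R (vector [s, 0]) + t *\<^sub>R inv R (axis 2 1)) has_derivative (\<lambda>h. h *\<^sub>R inv R (axis 2 1))) (at t)"
    by (auto intro!: derivative_eq_intros)
  ultimately show ?thesis by metis
qed

lemma nn_integral_chart:
  fixes f :: "real^2 \<Rightarrow> ennreal"
  assumes R: "orthogonal_transformation R" and f: "f \<in> borel_measurable borel"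
  shows "(\<integral>\<^sup>+x. f x \<partial>lborel) = (\<integral>\<^sup>+s. \<integral>\<^sup>+t. f (chart R z s t) \<partial>lborel \<partial>lborel)"
proof -
  have R': "orthogonal_transformation (inv R)" using R by (rule orthogonal_transformation_inv)
  have mR: "inv R \<in> borel \<rightarrow>\<^sub>M borel"
    using R' by (simp add: borel_measurable_continuous_onI linear_continuous_on orthogonal_transformation_linear linear_conv_bounded_linear[symmetric])
  have c: "continuous_on UNIV (\<lambda>p. vector [fst p, snd p] :: real^2)"
    by (intro continuous_on_vector2 continuous_intros)
  have mJ: "(\<lambda>p. vector [fst p, snd p] :: real^2) \<in> borel \<rightarrow>\<^sub>M borel"
    using borel_measurable_continuous_onI[OF c] by simp
  have mz: "(+) z \<in> borel \<rightarrow>\<^sub>M borel" by measurable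
  note [measurable] = mR mJ mz f
  have "(\<integral>\<^sup>+x. f x \<partial>lborel) = (\<integral>\<^sup>+x. f x \<partial>distr lborel borel ((+) z))"
    by (simp add: lborel_distr_plus)
  also have "\<dots> = (\<integral>\<^sup>+x. f (z + x) \<partial>lborel)" by (subst nn_integral_distr) auto
  also have "\<dots> = (\<integral>\<^sup>+x. f (z + x) \<partial>distr lborel borel (inv R))"
    using R' by (simp add: lborel_orthogonal)
  also have "\<dots> = (\<integral>\<^sup>+x. f (z + inv R x) \<partial>lborel)" by (subst nn_integral_distr) auto
  also have "\<dots> = (\<integral>\<^sup>+x. f (z + inv R x) \<partial>distr lborel borel (\<lambda>p. vector [fst p, snd p]))"
    by (simp add: lborel_real2)
  also have "\<dots> = (\<integral>\<^sup>+p. f (chart R z (fst p) (snd p)) \<partial>lborel)"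
    by (subst nn_integral_distr) (auto simp: chart_def)
  also have "\<dots> = (\<integral>\<^sup>+p. f (chart R z (fst p) (snd p)) \<partial>(lborel \<Otimes>\<^sub>M lborel))"
    by (simp add: lborel_prod)
  also have "\<dots> = (\<integral>\<^sup>+s. \<integral>\<^sup>+t. f (chart R z s t) \<partial>lborel \<partial>lborel)"
  proof (subst lborel.nn_integral_fst[symmetric])
    have "(\<lambda>p. f (z + inv R (vector [fst p, snd p]))) \<in> borel_measurable borel" by measurable
    then show "(\<lambda>p. f (chart R z (fst p) (snd p))) \<in> borel_measurable (lborel \<Otimes>\<^sub>M lborel)"
      by (simp add: lborel_prod chart_def)
  qed simp
  finally show ?thesis .
qed

text \<open>For \<open>t\<close> in the interval, \<open>g t - g p\<close> is the integral of \<open>g'\<close> over an interval of length at most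
  \<open>\<delta>\<close>, so Cauchy-Schwarz bounds its square by \<open>\<delta>\<close> times the integral of \<open>(g')\<^sup>2\<close>. Integrating in
  \<open>t\<close> contributes the other factor \<open>\<delta>\<close>.\<close>

lemma nn_integral_square_le_derivative:
  fixes g g' :: "real \<Rightarrow> real"
  assumes D: "\<And>t. (g has_real_derivative g' t) (at t)" and c: "continuous_on UNIV g'" and \<delta>: "\<delta> \<ge> 0"
  shows "(\<integral>\<^sup>+t. ennreal ((g t)\<^sup>2) * indicator {p<..<p + \<delta>} t \<partial>lborel) \<le>
    ennreal (2 * \<delta>) * ennreal ((g p)\<^sup>2) +
    ennreal (2 * \<delta>\<^sup>2) * (\<integral>\<^sup>+t. ennreal ((g' t)\<^sup>2) * indicator {p<..<p + \<delta>} t \<partial>lborel)"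
proof -
  have int: "set_integrable lborel {a..b} (\<lambda>t. (g' t)\<^sup>2)" "set_integrable lborel {a..b} g'" for a b
    by (intro borel_integrable_atLeastAtMost' continuous_intros continuous_on_subset[OF c]; simp)+
  define I where "I = (LINT t:{p..p + \<delta>}|lborel. (g' t)\<^sup>2)"
  have I0: "I \<ge> 0" unfolding I_def set_lebesgue_integral_def by (intro integral_nonneg_AE) auto
  have pt: "(g t)\<^sup>2 \<le> 2 * (g p)\<^sup>2 + 2 * \<delta> * I" if t: "t \<in> {p<..<p + \<delta>}" for t
  proof -
    let ?f = "\<lambda>u. indicator {p..t} u * g' u" and ?o = "indicator {p..t} :: real \<Rightarrow> real"
    have "(\<lambda>u. (norm (?f u))\<^sup>2) = (\<lambda>u. indicator {p..t} u *\<^sub>R (g' u)\<^sup>2)" "(\<lambda>u. (norm (?o u))\<^sup>2) = ?o"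
      by (auto simp: indicator_def)
    moreover have "?f \<in> borel_measurable lborel"
      using c by (intro borel_measurable_times) (auto simp: borel_measurable_continuous_onI)
    moreover have "integrable lborel ?o"
      using t by (intro integrable_real_indicator) auto
    ultimately have f: "?f \<in> L2 lborel" and o: "?o \<in> L2 lborel"
      using int[of p t] by (auto simp: L2_def set_integrable_def)
    have "(LINT u|lborel. ?f u * ?o u) = (LINT u|lborel. g' u * indicator {p..t} u)"
      by (intro Bochner_Integration.integral_cong) (auto simp: indicator_def)
    also have "\<dots> = g t - g p"
      using t D c by (intro integral_FTC_Icc_real) (auto simp: continuous_on_eq_continuous_at)
    finally have e1: "(LINT u|lborel. ?f u * ?o u) = g t - g p" .
    have e2: "(LINT u|lborel. (norm (?o u))\<^sup>2) = t - p"
    proof -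
      have "(LINT u|lborel. (norm (?o u))\<^sup>2) = (LINT u|lborel. ?o u)"
        by (intro Bochner_Integration.integral_cong) (auto simp: indicator_def)
      with t show ?thesis by simp
    qed
    have e3: "(LINT u|lborel. (norm (?f u))\<^sup>2) \<le> I"
      unfolding I_def set_lebesgue_integral_def
    proof (rule integral_mono)
      show "integrable lborel (\<lambda>u. (norm (?f u))\<^sup>2)" using f by (rule L2_integrable_sq)
      show "integrable lborel (\<lambda>u. indicator {p..p + \<delta>} u *\<^sub>R (g' u)\<^sup>2)"
        using int unfolding set_integrable_def by blast
      show "(norm (?f u))\<^sup>2 \<le> indicator {p..p + \<delta>} u *\<^sub>R (g' u)\<^sup>2" for u
        using t by (auto simp: indicator_def)
    qed
    have "(g t - g p)\<^sup>2 \<le> (LINT u|lborel. (norm (?f u))\<^sup>2) * (t - p)"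
      using L2_Cauchy_Schwarz[OF f o] by (simp only: inner_real_def e1 e2)
    also have "\<dots> \<le> I * \<delta>" using e3 t I0 by (intro mult_mono) auto
    finally have "(g t - g p)\<^sup>2 \<le> \<delta> * I" by (simp add: mult.commute)
    moreover have "(g t)\<^sup>2 \<le> 2 * (g t - g p)\<^sup>2 + 2 * (g p)\<^sup>2"
      using norm_add_sq_le[of "g t - g p" "g p"] by simp
    ultimately show ?thesis by linarith
  qed
  have "(\<integral>\<^sup>+t. ennreal ((g t)\<^sup>2) * indicator {p<..<p + \<delta>} t \<partial>lborel) \<le>
      (\<integral>\<^sup>+t. ennreal (2 * (g p)\<^sup>2 + 2 * \<delta> * I) * indicator {p<..<p + \<delta>} t \<partial>lborel)"
    using pt by (intro nn_integral_mono) (auto simp: indicator_def intro!: ennreal_leI)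
  also have "\<dots> = ennreal (2 * (g p)\<^sup>2 + 2 * \<delta> * I) * ennreal \<delta>"
    using \<delta> by (simp add: nn_integral_cmult_indicator)
  also have "\<dots> = ennreal (2 * \<delta>) * ennreal ((g p)\<^sup>2) + ennreal (2 * \<delta>\<^sup>2) * ennreal I"
    using \<delta> I0 by (simp add: ennreal_mult[symmetric] ennreal_plus[symmetric] power2_eq_square algebra_simps del: ennreal_plus)
  also have "ennreal I = (\<integral>\<^sup>+t. ennreal (indicator {p..p + \<delta>} t *\<^sub>R (g' t)\<^sup>2) \<partial>lborel)"
    unfolding I_def set_lebesgue_integral_def using int
    by (intro nn_integral_eq_integral[symmetric]) (auto simp: set_integrable_def)
  also have "\<dots> = (\<integral>\<^sup>+t. ennreal ((g' t)\<^sup>2) * indicator {p<..<p + \<delta>} t \<partial>lborel)"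
  proof (rule nn_integral_cong_AE)
    have "AE t in lborel. t \<noteq> p" "AE t in lborel. t \<noteq> p + \<delta>" by (rule AE_lborel_singleton)+
    then show "AE t in lborel. ennreal (indicator {p..p + \<delta>} t *\<^sub>R (g' t)\<^sup>2) = ennreal ((g' t)\<^sup>2) * indicator {p<..<p + \<delta>} t"
      by eventually_elim (auto simp: indicator_def)
  qed
  finally show ?thesis .
qed

section \<open>Arc length and graphs\<close>

text \<open>The smooth extension \<open>g\<close> makes the speed of the arc continuous up to both endpoints, where
  \<open>\<gamma>\<close> itself has only one-sided derivatives.\<close>

lemma smooth_arc_derivative:
  assumes "smooth_arc \<gamma>"
  obtains g D where "smooth g" "\<And>t. t \<in> {0..1} \<Longrightarrow> g t = \<gamma> t" "continuous_on UNIV D"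
    "\<And>t. (g has_vector_derivative D t) (at t)"
    "\<And>t. t \<in> {0..1} \<Longrightarrow> vector_derivative \<gamma> (at t within {0..1}) = D t"
proof -
  obtain g where g: "smooth g" "\<And>t. t \<in> {0..1} \<Longrightarrow> g t = \<gamma> t"
    using assms by (auto simp: smooth_arc_def)
  define D where "D t = frechet_derivative g (at t) 1" for t
  have d: "(g has_vector_derivative D t) (at t)" for t
  proof -
    have "g differentiable (at t)" using g(1) by (rule smooth_imp_differentiable)
    then have 1: "(g has_derivative frechet_derivative g (at t)) (at t)"
      by (simp add: frechet_derivative_works[symmetric])
    then have "frechet_derivative g (at t) h = h *\<^sub>R D t" for h
      using linear_cmul[OF has_derivative_linear[OF 1], of h 1] by (simp add: D_def)
    then have "frechet_derivative g (at t) = (\<lambda>h. h *\<^sub>R D t)" by auto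
    with 1 show ?thesis by (simp add: has_vector_derivative_def)
  qed
  have "vector_derivative \<gamma> (at t within {0..1}) = D t" if t: "t \<in> {0..1}" for t
  proof (rule vector_derivative_within_closed_interval)
    have "(g has_vector_derivative D t) (at t within {0..1})"
      using d by (rule has_vector_derivative_at_within)
    then show "(\<gamma> has_vector_derivative D t) (at t within {0..1})"
      using has_vector_derivative_transform[OF t, of \<gamma> g] g(2) by auto
  qed (use t in auto)
  moreover have "continuous_on UNIV D"
    unfolding D_def by (rule smooth_imp_continuous[OF smooth_frechet[OF g(1)]])
  ultimately show ?thesis using that g d by blast
qed

lemma nn_integral_arc_length:
  assumes "smooth_arc \<gamma>" "continuous_on UNIV D"
    and D: "\<And>t. t \<in> {0..1} \<Longrightarrow> vector_derivative \<gamma> (at t within {0..1}) = D t"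
    and h: "continuous_on {0..1} h" "\<And>t. 0 \<le> h t"
  shows "(\<integral>\<^sup>+t. ennreal (h t) \<partial>arc_length \<gamma>) = (\<integral>\<^sup>+t. ennreal (h t * norm (D t)) * indicator {0..1} t \<partial>lborel)"
proof -
  have mD: "(\<lambda>t. norm (D t)) \<in> borel_measurable (lebesgue_on {0..1})"
    by (intro continuous_imp_measurable_on_sets_lebesgue continuous_intros continuous_on_subset[OF assms(2)]) auto
  have mh: "h \<in> borel_measurable (lebesgue_on {0..1})"
    using h by (intro continuous_imp_measurable_on_sets_lebesgue) auto
  have "arc_length \<gamma> = density (lebesgue_on {0..1}) (\<lambda>t. ennreal (norm (D t)))"
    unfolding arc_length_def
  proof (rule density_cong)
    show m: "(\<lambda>t. ennreal (norm (D t))) \<in> borel_measurable (lebesgue_on {0..1})" using mD by measurable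
    then show "(\<lambda>t. ennreal (norm (vector_derivative \<gamma> (at t within {0..1})))) \<in> borel_measurable (lebesgue_on {0..1})"
      by (rule measurable_cong[THEN iffD1, rotated]) (simp add: D)
    show "AE t in lebesgue_on {0..1}. ennreal (norm (vector_derivative \<gamma> (at t within {0..1}))) = ennreal (norm (D t))"
      by (rule AE_I2) (simp add: D)
  qed
  then have "(\<integral>\<^sup>+t. ennreal (h t) \<partial>arc_length \<gamma>) =
      (\<integral>\<^sup>+t. ennreal (norm (D t)) * ennreal (h t) \<partial>lebesgue_on {0..1})"
    using mD mh by (simp add: nn_integral_density)
  also have "\<dots> = (\<integral>\<^sup>+t. ennreal (norm (D t)) * ennreal (h t) * indicator {0..1} t \<partial>lebesgue)"
    by (intro nn_integral_restrict_space) auto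
  also have "\<dots> = (\<integral>\<^sup>+t. ennreal (h t * norm (D t)) * indicator {0..1} t \<partial>lborel)"
    using h(2) by (simp add: nn_integral_completion ennreal_mult mult.commute)
  finally show ?thesis .
qed

text \<open>Let \<open>p(t)\<close> be the abscissa of \<open>\<gamma>(t)\<close>. A point of the graph is determined by its abscissa and
  the arc is injective, so \<open>p\<close> is injective on the parameters that \<open>\<gamma>\<close> maps into the graph. The change of
  variables \<open>s = p(t)\<close> replaces \<open>ds\<close> by \<open>\<bar>p'(t)\<bar> dt\<close>, and \<open>\<bar>p'\<bar> \<le> \<bar>\<gamma>'\<bar>\<close> because the abscissa is a coordinate
  in an orthonormal frame.\<close>

lemma graph_integral_le_arc_integral:
  fixes h :: "real^2 \<Rightarrow> real" and \<psi> :: "real \<Rightarrow> real" and z a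
  assumes \<gamma>: "smooth_arc \<gamma>" and R: "orthogonal_transformation R" and \<psi>: "continuous_on UNIV \<psi>"
    and h: "continuous_on UNIV h" "\<And>x. 0 \<le> h x"
  defines "G \<equiv> {s. \<bar>s\<bar> < a \<and> chart R z s (\<psi> s) \<in> path_image \<gamma>}"
  shows "G \<in> sets lebesgue"
    "(\<integral>\<^sup>+s. ennreal (h (chart R z s (\<psi> s))) * indicator G s \<partial>lebesgue) \<le> (\<integral>\<^sup>+t. ennreal (h (\<gamma> t)) \<partial>arc_length \<gamma>)"
proof -
  obtain g D where g: "smooth g" "\<And>t. t \<in> {0..1} \<Longrightarrow> g t = \<gamma> t" "continuous_on UNIV D"
    "\<And>t. (g has_vector_derivative D t) (at t)"
    "\<And>t. t \<in> {0..1} \<Longrightarrow> vector_derivative \<gamma> (at t within {0..1}) = D t"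
    using smooth_arc_derivative[OF \<gamma>] by blast
  have lR: "linear R" using R by (rule orthogonal_transformation_linear)
  have blR: "bounded_linear R" using lR by (simp add: linear_conv_bounded_linear)
  have cg: "continuous_on UNIV g" using g(1) by (rule smooth_imp_continuous)
  define p where "p t = R (g t - z) $ 1" for t
  define p' where "p' t = R (D t) $ 1" for t
  have cR: "continuous_on UNIV R" using blR by (rule linear_continuous_on)
  have cp: "continuous_on UNIV p"
    unfolding p_def by (intro continuous_intros continuous_on_compose2[OF cR] cg) auto
  have cp': "continuous_on UNIV p'"
    unfolding p'_def by (intro continuous_intros continuous_on_compose2[OF cR] g(3)) auto
  have dp: "(p has_field_derivative p' t) (at t)" for t
  proof -
    have "((\<lambda>t. g t - z) has_vector_derivative D t) (at t)"
      using g(4)[of t] by (auto intro!: derivative_eq_intros)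
    from bounded_linear.has_vector_derivative[OF bounded_linear_compose[OF bounded_linear_vec_nth blR] this]
    show ?thesis by (simp add: p_def[abs_def] p'_def has_real_derivative_iff_has_vector_derivative)
  qed
  define A where "A = {0..1} \<inter> {t. g t = chart R z (p t) (\<psi> (p t))} \<inter> {t. \<bar>p t\<bar> < a}"
  have cc: "continuous_on UNIV (\<lambda>t. chart R z (p t) (\<psi> (p t)))"
    by (intro continuous_intros R cp continuous_on_compose2[OF \<psi> cp]) auto
  have "closed {t. g t = chart R z (p t) (\<psi> (p t))}" by (rule closed_Collect_eq[OF cg cc])
  moreover have "open {t. \<bar>p t\<bar> < a}" by (intro open_Collect_less continuous_intros cp)
  ultimately have "A \<in> sets borel" unfolding A_def by (intro sets.Int) auto
  then have A: "A \<in> sets lebesgue" by simp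
  have inj: "inj_on p A"
  proof (rule inj_onI)
    fix t u assume tu: "t \<in> A" "u \<in> A" "p t = p u"
    then have "g t = g u" unfolding A_def by (metis (mono_tags, lifting) IntD1 IntD2 mem_Collect_eq)
    then have "\<gamma> t = \<gamma> u" "t \<in> {0..1}" "u \<in> {0..1}" using tu g(2) by (auto simp: A_def)
    moreover have "inj_on \<gamma> {0..1}" using \<gamma> by (simp add: smooth_arc_def arc_def)
    ultimately show "t = u" by (meson inj_onD)
  qed
  have img: "p ` A = G"
  proof (intro equalityI subsetI)
    fix s assume "s \<in> p ` A"
    then show "s \<in> G" using g(2) unfolding A_def G_def path_image_def by force
  next
    fix s assume s: "s \<in> G"
    then obtain t where t: "t \<in> {0..1}" "g t = chart R z s (\<psi> s)"
      using g(2) by (auto simp: G_def path_image_def)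
    then have "p t = s" by (simp add: p_def chart_coords[OF R])
    with s t show "s \<in> p ` A" by (auto simp: A_def G_def intro!: image_eqI[of _ _ t])
  qed
  define q where "q t = \<bar>p' t\<bar> * h (g t)" for t
  have cq: "continuous_on UNIV q"
    unfolding q_def by (intro continuous_intros cp' continuous_on_compose2[OF h(1) cg]) auto
  have qA: "q absolutely_integrable_on A"
  proof -
    have "q absolutely_integrable_on {0..1}"
      using absolutely_integrable_continuous_real continuous_on_subset[OF cq] by blast
    then show ?thesis using A by (rule set_integrable_subset) (auto simp: A_def)
  qed
  have eq: "\<bar>p' t\<bar> * h (chart R z (p t) (\<psi> (p t))) = q t" if "t \<in> A" for t
    using that by (auto simp: q_def A_def)
  have "(\<lambda>t. \<bar>p' t\<bar> * h (chart R z (p t) (\<psi> (p t)))) absolutely_integrable_on A \<and>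
      integral A (\<lambda>t. \<bar>p' t\<bar> * h (chart R z (p t) (\<psi> (p t)))) = integral A q"
  proof
    show "integral A (\<lambda>t. \<bar>p' t\<bar> * h (chart R z (p t) (\<psi> (p t)))) = integral A q"
      by (rule Henstock_Kurzweil_Integration.integral_cong) (rule eq)
    have "set_integrable lebesgue A (\<lambda>t. \<bar>p' t\<bar> * h (chart R z (p t) (\<psi> (p t)))) = set_integrable lebesgue A q"
      by (rule set_integrable_cong) (auto simp: eq)
    with qA show "(\<lambda>t. \<bar>p' t\<bar> * h (chart R z (p t) (\<psi> (p t)))) absolutely_integrable_on A" by simp
  qed
  then have F: "(\<lambda>s. h (chart R z s (\<psi> s))) absolutely_integrable_on G"
     "integral G (\<lambda>s. h (chart R z s (\<psi> s))) = integral A q"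
    using has_absolute_integral_change_of_variables_1'[OF A has_field_derivative_at_within[OF dp] inj,
        of "\<lambda>s. h (chart R z s (\<psi> s))" "integral A q"]
    by (simp_all add: img)
  have "p differentiable_on A"
    unfolding differentiable_on_def using dp by (meson differentiable_at_withinI real_differentiable_def)
  from differentiable_image_in_sets_lebesgue[OF A _ this] show "G \<in> sets lebesgue"
    by (simp add: img)
  have "(\<integral>\<^sup>+s. ennreal (h (chart R z s (\<psi> s))) * indicator G s \<partial>lborel) = ennreal (integral A q)"
    unfolding F(2)[symmetric] using h(2) F(1)
    by (intro nn_integral_has_integral_lebesgue' integrable_integral)
       (auto simp: absolutely_integrable_on_def)
  also have "\<dots> = (\<integral>\<^sup>+t. ennreal (q t) * indicator A t \<partial>lborel)"
    using h(2) qA by (intro nn_integral_has_integral_lebesgue'[symmetric] integrable_integral)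
       (auto simp: absolutely_integrable_on_def q_def)
  also have "\<dots> \<le> (\<integral>\<^sup>+t. ennreal (h (g t) * norm (D t)) * indicator {0..1} t \<partial>lborel)"
  proof (rule nn_integral_mono)
    fix t
    have "\<bar>p' t\<bar> \<le> norm (D t)"
      using component_le_norm_cart[of "R (D t)" 1] orthogonal_transformation_norm[OF R, of "D t"] by (simp add: p'_def)
    then have "q t \<le> h (g t) * norm (D t)"
      using mult_right_mono[OF _ h(2)[of "g t"]] by (simp add: q_def mult.commute)
    then show "ennreal (q t) * indicator A t \<le> ennreal (h (g t) * norm (D t)) * indicator {0..1} t"
      by (auto simp: A_def indicator_def intro: ennreal_leI)
  qed
  also have "\<dots> = (\<integral>\<^sup>+t. ennreal (h (g t)) \<partial>arc_length \<gamma>)"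
    using g h by (intro nn_integral_arc_length[symmetric] \<gamma> continuous_on_compose2[OF h(1)] continuous_on_subset[OF cg]) auto
  also have "\<dots> = (\<integral>\<^sup>+t. ennreal (h (\<gamma> t)) \<partial>arc_length \<gamma>)"
    using g(2) by (intro nn_integral_cong) (auto simp: arc_length_def)
  finally show "(\<integral>\<^sup>+s. ennreal (h (chart R z s (\<psi> s))) * indicator G s \<partial>lebesgue) \<le> (\<integral>\<^sup>+t. ennreal (h (\<gamma> t)) \<partial>arc_length \<gamma>)"
    by (simp add: nn_integral_completion)
qed

lemma arc_length_continuous_integrable:
  fixes h :: "real^2 \<Rightarrow> real"
  assumes \<gamma>: "smooth_arc \<gamma>" and h: "continuous_on (path_image \<gamma>) h" and h0: "\<And>x. 0 \<le> h x"
  shows "(h \<circ> \<gamma>) \<in> borel_measurable (arc_length \<gamma>)" "integrable (arc_length \<gamma>) (\<lambda>t. h (\<gamma> t))"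
proof -
  obtain g D where g: "continuous_on UNIV D"
    "\<And>t. t \<in> {0..1} \<Longrightarrow> vector_derivative \<gamma> (at t within {0..1}) = D t"
    using smooth_arc_derivative[OF \<gamma>] by metis
  have "continuous_on {0..1} \<gamma>" using \<gamma> by (simp add: smooth_arc_def arc_def path_def)
  then have c: "continuous_on {0..1} (\<lambda>t. h (\<gamma> t))"
    using continuous_on_compose2[OF h] by (auto simp: path_image_def)
  then have "(\<lambda>t. h (\<gamma> t)) \<in> borel_measurable (lebesgue_on {0..1})"
    by (intro continuous_imp_measurable_on_sets_lebesgue) auto
  then show m: "(h \<circ> \<gamma>) \<in> borel_measurable (arc_length \<gamma>)"
    by (simp add: arc_length_def o_def)
  have "(\<lambda>t. h (\<gamma> t) * norm (D t)) integrable_on {0..1}"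
    by (intro integrable_continuous_real continuous_intros c continuous_on_subset[OF g(1)]) auto
  then obtain I where "((\<lambda>t. h (\<gamma> t) * norm (D t)) has_integral I) {0..1}" by blast
  from nn_integral_has_integral_lebesgue'[OF _ this] h0
  have "(\<integral>\<^sup>+t. ennreal (h (\<gamma> t)) \<partial>arc_length \<gamma>) = ennreal I"
    using nn_integral_arc_length[OF \<gamma> g c] by simp
  with m h0 show "integrable (arc_length \<gamma>) (\<lambda>t. h (\<gamma> t))"
    by (intro integrableI_bounded) (auto simp: o_def)
qed

lemma graph_integral_le_boundary_integral:
  fixes h :: "real^2 \<Rightarrow> real" and \<psi> :: "real \<Rightarrow> real"
  assumes \<Gamma>: "finite \<Gamma>" "\<And>\<gamma>. \<gamma> \<in> \<Gamma> \<Longrightarrow> smooth_arc \<gamma>"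
    and R: "orthogonal_transformation R" and \<psi>: "continuous_on UNIV \<psi>"
    and h: "continuous_on UNIV h" "\<And>x. 0 \<le> h x"
    and cover: "\<And>s. \<bar>s\<bar> < a \<Longrightarrow> chart R z s (\<psi> s) \<in> (\<Union>\<gamma>\<in>\<Gamma>. path_image \<gamma>)"
  shows "(\<integral>\<^sup>+s. ennreal (h (chart R z s (\<psi> s))) * indicator {s. \<bar>s\<bar> < a} s \<partial>lborel) \<le>
    (\<Sum>\<gamma>\<in>\<Gamma>. \<integral>\<^sup>+t. ennreal (h (\<gamma> t)) \<partial>arc_length \<gamma>)"
proof -
  define F where "F s = ennreal (h (chart R z s (\<psi> s)))" for s
  define G where "G \<gamma> = {s. \<bar>s\<bar> < a \<and> chart R z s (\<psi> s) \<in> path_image \<gamma>}" for \<gamma>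
  have Gm: "G \<gamma> \<in> sets lebesgue" and Gle: "(\<integral>\<^sup>+s. F s * indicator (G \<gamma>) s \<partial>lebesgue) \<le> (\<integral>\<^sup>+t. ennreal (h (\<gamma> t)) \<partial>arc_length \<gamma>)"
    if "\<gamma> \<in> \<Gamma>" for \<gamma>
    using graph_integral_le_arc_integral[OF \<Gamma>(2)[OF that] R \<psi> h] by (auto simp: F_def G_def)
  have "continuous_on UNIV (\<lambda>s. h (chart R z s (\<psi> s)))"
    by (intro continuous_on_compose2[OF h(1)] continuous_intros R \<psi>) auto
  then have "(\<lambda>s. h (chart R z s (\<psi> s))) \<in> borel_measurable lebesgue"
    by (intro measurable_completion) (simp add: borel_measurable_continuous_onI)
  then have Fm: "F \<in> borel_measurable lebesgue" unfolding F_def by measurable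
  have "(\<integral>\<^sup>+s. F s * indicator {s. \<bar>s\<bar> < a} s \<partial>lborel) = (\<integral>\<^sup>+s. F s * indicator {s. \<bar>s\<bar> < a} s \<partial>lebesgue)"
    by (simp add: nn_integral_completion)
  also have "\<dots> \<le> (\<integral>\<^sup>+s. (\<Sum>\<gamma>\<in>\<Gamma>. F s * indicator (G \<gamma>) s) \<partial>lebesgue)"
  proof (rule nn_integral_mono)
    fix s
    show "F s * indicator {s. \<bar>s\<bar> < a} s \<le> (\<Sum>\<gamma>\<in>\<Gamma>. F s * indicator (G \<gamma>) s)"
    proof (cases "\<bar>s\<bar> < a")
      case True
      then obtain \<gamma> where \<gamma>: "\<gamma> \<in> \<Gamma>" "s \<in> G \<gamma>" using cover[of s] by (auto simp: G_def)
      have "F s * indicator (G \<gamma>) s \<le> (\<Sum>\<gamma>\<in>\<Gamma>. F s * indicator (G \<gamma>) s)"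
        using \<Gamma>(1) \<gamma>(1) by (intro member_le_sum) auto
      with \<gamma> True show ?thesis by simp
    qed simp
  qed
  also have "\<dots> = (\<Sum>\<gamma>\<in>\<Gamma>. \<integral>\<^sup>+s. F s * indicator (G \<gamma>) s \<partial>lebesgue)"
    using Fm Gm by (intro nn_integral_sum) auto
  also have "\<dots> \<le> (\<Sum>\<gamma>\<in>\<Gamma>. \<integral>\<^sup>+t. ennreal (h (\<gamma> t)) \<partial>arc_length \<gamma>)"
    using Gle by (intro sum_mono)
  finally show ?thesis by (simp add: F_def)
qed

section \<open>The estimate on a boundary strip\<close>

definition strip :: "(real^2) set \<Rightarrow> real \<Rightarrow> (real^2) set" where
  "strip K \<epsilon> = {x \<in> K. infdist x (frontier K) < \<epsilon>}"

abbreviation strip_integral :: "(real^2) set \<Rightarrow> real \<Rightarrow> (real^2 \<Rightarrow> 'b::real_normed_vector) \<Rightarrow> real" where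
  "strip_integral K \<epsilon> f \<equiv> (LINT x|lebesgue_on K. indicator (strip K \<epsilon>) x * (norm (f x))\<^sup>2)"

abbreviation energy_on :: "(real^2) set \<Rightarrow> (real^2 \<Rightarrow> 'b::real_normed_vector) \<Rightarrow> ennreal" where
  "energy_on S f \<equiv> (\<integral>\<^sup>+x. ennreal ((norm (f x))\<^sup>2) * indicator S x \<partial>lborel)"

lemma open_strip: "open K \<Longrightarrow> open (strip K \<epsilon>)"
proof -
  assume K: "open K"
  have "strip K \<epsilon> = K \<inter> {x. infdist x (frontier K) < \<epsilon>}" by (auto simp: strip_def)
  then show ?thesis using K by (auto intro!: open_Int open_Collect_less continuous_intros)
qed

lemma strip_mono: "\<epsilon> \<le> \<delta> \<Longrightarrow> strip K \<epsilon> \<subseteq> strip K \<delta>"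
  by (auto simp: strip_def)

text \<open>The squared norm in \<open>L\<^sup>2(\<partial>K)\<close>. It takes values in \<open>ennreal\<close> because it meets the iterated integrals
  of Tonelli's theorem.\<close>

definition edge_energy :: "(real \<Rightarrow> real^2) set \<Rightarrow> (real^2 \<Rightarrow> real) \<Rightarrow> ennreal" where
  "edge_energy \<Gamma> \<phi> = (\<Sum>\<gamma>\<in>\<Gamma>. \<integral>\<^sup>+t. ennreal ((\<phi> (\<gamma> t))\<^sup>2) \<partial>arc_length \<gamma>)"

lemma measurable_nn_integral_chart:
  fixes f :: "real^2 \<Rightarrow> ennreal"
  assumes R: "orthogonal_transformation R" and f: "f \<in> borel_measurable borel"
  shows "(\<lambda>s. \<integral>\<^sup>+t. f (chart R z s t) \<partial>lborel) \<in> borel_measurable lborel"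
proof -
  have "continuous_on UNIV (\<lambda>p. chart R z (fst p) (snd p))"
    by (intro continuous_intros R)
  then have [measurable]: "(\<lambda>p. chart R z (fst p) (snd p)) \<in> borel \<rightarrow>\<^sub>M borel"
    by (rule borel_measurable_continuous_onI)
  note [measurable] = f
  have "(\<lambda>p. f (chart R z (fst p) (snd p))) \<in> borel_measurable borel" by measurable
  then have "(\<lambda>p. f (chart R z (fst p) (snd p))) \<in> borel_measurable (lborel \<Otimes>\<^sub>M lborel)"
    by (simp add: lborel_prod)
  from lborel.borel_measurable_nn_integral_fst[OF this] show ?thesis by simp
qed

text \<open>The choice of \<open>a\<close> keeps the columns of height \<open>r/2\<close> above the graph inside the ball where \<open>K\<close> is
  described by the graph: \<open>\<bar>s\<bar> + \<bar>t\<bar> < a + L a + r/2 = r\<close>.\<close>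

lemma lipschitz_chart_region:
  assumes K: "open K" and z: "z \<in> frontier K" and r: "r > 0" and R: "orthogonal_transformation R"
    and \<psi>: "L-lipschitz_on UNIV \<psi>"
    and graph: "K \<inter> ball z r = {x \<in> ball z r. R (x - z) $ 2 > \<psi> (R (x - z) $ 1)}"
  defines "a \<equiv> r / (2 * (1 + L))"
  shows "\<And>s t. \<bar>s\<bar> < a \<Longrightarrow> \<psi> s < t \<Longrightarrow> t < \<psi> s + r / 2 \<Longrightarrow> chart R z s t \<in> K"
    "\<And>s. \<bar>s\<bar> < a \<Longrightarrow> chart R z s (\<psi> s) \<in> frontier K"
    "\<And>y. y \<in> frontier K \<Longrightarrow> y \<in> ball z r \<Longrightarrow> R (y - z) $ 2 = \<psi> (R (y - z) $ 1)"
proof -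
  have L: "0 \<le> L" using \<psi> by (rule lipschitz_on_nonneg)
  have lip: "\<bar>\<psi> s - \<psi> t\<bar> \<le> L * \<bar>s - t\<bar>" for s t
    using lipschitz_onD[OF \<psi>, of s t] by (simp add: dist_real_def)
  have c\<psi>: "continuous_on UNIV \<psi>" using \<psi> by (rule lipschitz_on_continuous_on)
  have cR: "continuous_on UNIV R"
    using R by (simp add: linear_continuous_on orthogonal_transformation_linear linear_conv_bounded_linear[symmetric])
  show on_graph: "R (y - z) $ 2 = \<psi> (R (y - z) $ 1)" if y: "y \<in> frontier K" "y \<in> ball z r" for y
  proof -
    have "y \<notin> K" using y(1) K by (simp add: frontier_def interior_open)
    then have "R (y - z) $ 2 \<le> \<psi> (R (y - z) $ 1)" using graph y(2) by force
    moreover have "\<not> R (y - z) $ 2 < \<psi> (R (y - z) $ 1)"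
    proof
      assume lt: "R (y - z) $ 2 < \<psi> (R (y - z) $ 1)"
      define U where "U = ball z r \<inter> {x. R (x - z) $ 2 < \<psi> (R (x - z) $ 1)}"
      have "continuous_on UNIV (\<lambda>x. R (x - z) $ i)" for i
        by (intro continuous_intros continuous_on_compose2[OF cR]) auto
      then have "open U"
        unfolding U_def by (intro open_Int open_Collect_less continuous_on_compose2[OF c\<psi>]) auto
      moreover have "y \<in> U" using lt y by (simp add: U_def)
      moreover have "y \<in> closure K" using y(1) by (simp add: frontier_def)
      ultimately have "K \<inter> U \<noteq> {}" using open_Int_closure_eq_empty[of U K] by blast
      then obtain x where "x \<in> K \<inter> U" by blast
      then have "x \<in> K \<inter> ball z r" "R (x - z) $ 2 < \<psi> (R (x - z) $ 1)" by (auto simp: U_def)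
      then show False unfolding graph by simp
    qed
    ultimately show ?thesis by simp
  qed
  have \<psi>0: "\<psi> 0 = 0"
    using on_graph[OF z] r R by (simp add: linear_0 orthogonal_transformation_linear)
  have "a = (r / 2) / (1 + L)" by (simp add: a_def)
  then have "a * (1 + L) = r / 2" using L by (subst (asm) nonzero_eq_divide_eq) auto
  then have a: "a + L * a = r / 2" "a > 0" using r L by (simp add: algebra_simps, simp add: a_def)
  have in_ball: "chart R z s t \<in> ball z r" if "\<bar>s\<bar> < a" "\<psi> s \<le> t" "t < \<psi> s + r / 2" for s t
  proof -
    have "\<bar>\<psi> s\<bar> \<le> L * a" using lip[of s 0] \<psi>0 that(1) mult_left_mono[of "\<bar>s\<bar>" a L] L by simp
    then have "\<bar>s\<bar> + \<bar>t\<bar> < r" using that a by linarith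
    moreover have "dist z (chart R z s t) \<le> \<bar>s\<bar> + \<bar>t\<bar>"
      using dist_chart[OF R, of z 0 0 s t] chart_center[OF R, of z] sqrt_sum_squares_le_sum_abs[of s t] by simp
    ultimately show ?thesis by simp
  qed
  show inK: "chart R z s t \<in> K" if "\<bar>s\<bar> < a" "\<psi> s < t" "t < \<psi> s + r / 2" for s t
  proof -
    have "chart R z s t \<in> {x \<in> ball z r. R (x - z) $ 2 > \<psi> (R (x - z) $ 1)}"
      using in_ball[of s t] that by (simp add: chart_coords[OF R])
    then show ?thesis using graph by blast
  qed
  show "chart R z s (\<psi> s) \<in> frontier K" if s: "\<bar>s\<bar> < a" for s
  proof -
    have "chart R z s (\<psi> s) \<notin> K"
    proof
      assume "chart R z s (\<psi> s) \<in> K"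
      then have "chart R z s (\<psi> s) \<in> K \<inter> ball z r" using in_ball[of s "\<psi> s"] s r by auto
      then show False unfolding graph by (simp add: chart_coords[OF R])
    qed
    moreover have "chart R z s (\<psi> s) \<in> closure K"
      unfolding closure_approachable
    proof (intro allI impI)
      fix e :: real assume e: "e > 0"
      define t where "t = \<psi> s + min (e / 2) (r / 4)"
      have "chart R z s t \<in> K" using inK[of s t] s e r by (auto simp: t_def)
      moreover have "dist (chart R z s t) (chart R z s (\<psi> s)) < e"
        using e r by (simp add: dist_chart[OF R] t_def)
      ultimately show "\<exists>y\<in>K. dist y (chart R z s (\<psi> s)) < e" by blast
    qed
    ultimately show ?thesis using K by (simp add: frontier_def interior_open)
  qed
qed

text \<open>With \<open>C = 1 + L\<close>, a point of \<open>K\<close> at distance less than \<open>\<epsilon>\<close> from the boundary has height less than \<open>C \<epsilon>\<close>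
  above the graph, and conversely the column of height \<open>C \<epsilon>\<close> above a boundary point stays within
  distance \<open>C \<epsilon>\<close> of the boundary. The one-dimensional inequality is applied to every such column.\<close>

lemma strip_estimate_local:
  assumes P: "curvilinear_polygon K \<Gamma>" and z: "z \<in> frontier K"
  obtains a C where "a > 0" "C \<ge> 1" "\<And>\<epsilon> \<phi>. \<lbrakk>0 < \<epsilon>; \<epsilon> \<le> a; smooth \<phi>\<rbrakk> \<Longrightarrow>
    energy_on (strip K \<epsilon> \<inter> ball z a) \<phi> \<le>
    ennreal (2 * (C * \<epsilon>)) * edge_energy \<Gamma> \<phi> +
    ennreal (2 * (C * \<epsilon>)\<^sup>2) * energy_on (strip K (C * \<epsilon>)) (grad \<phi>)"
proof -
  have K: "open K" and \<Gamma>: "finite \<Gamma>" "\<And>\<gamma>. \<gamma> \<in> \<Gamma> \<Longrightarrow> smooth_arc \<gamma>"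
    and fr: "frontier K = (\<Union>\<gamma>\<in>\<Gamma>. path_image \<gamma>)"
    using P by (auto simp: curvilinear_polygon_def)
  have "lipschitz_boundary K" using P by (simp add: curvilinear_polygon_def)
  then have "\<exists>r > 0. \<exists>R :: real^2 \<Rightarrow> real^2. orthogonal_transformation R \<and>
        (\<exists>\<psi> :: real \<Rightarrow> real. \<exists>L. L-lipschitz_on UNIV \<psi> \<and>
           K \<inter> ball z r = {x \<in> ball z r. R (x - z) $ 2 > \<psi> (R (x - z) $ 1)})"
    unfolding lipschitz_boundary_def using z by (rule bspec)
  then obtain r :: real and R :: "real^2 \<Rightarrow> real^2" and \<psi> :: "real \<Rightarrow> real" and L where r: "r > 0" and R: "orthogonal_transformation R" and \<psi>: "L-lipschitz_on UNIV \<psi>"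
    and graph: "K \<inter> ball z r = {x \<in> ball z r. R (x - z) $ 2 > \<psi> (R (x - z) $ 1)}"
    by blast
  define C where "C = 1 + L"
  define a where "a = r / (2 * (1 + L))"
  have L: "0 \<le> L" using \<psi> by (rule lipschitz_on_nonneg)
  have C: "C \<ge> 1" using L by (simp add: C_def)
  have "a = (r / 2) / C" by (simp add: a_def C_def)
  then have "a * C = r / 2" using C by (subst (asm) nonzero_eq_divide_eq) auto
  then have a: "a > 0" "C * a = r / 2" using r L by (simp add: a_def, simp add: mult.commute)
  have aC: "a \<le> C * a" using C a(1) mult_right_mono[of 1 C a] by simp
  note region = lipschitz_chart_region[OF K z r R \<psi> graph, folded a_def]
  have lip: "\<bar>\<psi> s - \<psi> t\<bar> \<le> L * \<bar>s - t\<bar>" for s t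
    using lipschitz_onD[OF \<psi>, of s t] by (simp add: dist_real_def)
  have c\<psi>: "continuous_on UNIV \<psi>" using \<psi> by (rule lipschitz_on_continuous_on)
  show thesis
  proof (rule that[OF a(1) C])
    fix \<epsilon> :: real and \<phi> :: "real^2 \<Rightarrow> real"
    assume \<epsilon>: "0 < \<epsilon>" "\<epsilon> \<le> a" and sm: "smooth \<phi>"
    define \<delta> where "\<delta> = C * \<epsilon>"
    have \<delta>: "0 < \<delta>" "\<delta> \<le> r / 2" using \<epsilon> C a mult_left_mono[OF \<epsilon>(2), of C] by (auto simp: \<delta>_def)
    have strip_in: "\<bar>s\<bar> < a \<and> \<psi> s < t \<and> t < \<psi> s + \<delta>" if x: "chart R z s t \<in> strip K \<epsilon> \<inter> ball z a" for s t
    proof -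
      let ?x = "chart R z s t"
      have xK: "?x \<in> K" and xd: "infdist ?x (frontier K) < \<epsilon>" and xb: "dist z ?x < a"
        using x by (auto simp: strip_def)
      have "frontier K \<noteq> {}" using z by auto
      then obtain y where y: "y \<in> frontier K" "dist ?x y < \<epsilon>"
        using infdist_attains_inf[OF frontier_closed, of K ?x] xd by metis
      have "dist z y < a + \<epsilon>" using dist_triangle[of z y ?x] xb y by linarith
      then have "dist z y < r" using \<epsilon>(2) a aC by linarith
      then have yb: "y \<in> ball z r" by simp
      define s' where "s' = R (y - z) $ 1"
      have yc: "y = chart R z s' (\<psi> s')"
        using chart_coords(1)[OF R, of z y] region(3)[OF y(1) yb] by (simp add: s'_def)
      have d: "sqrt ((s - s')\<^sup>2 + (t - \<psi> s')\<^sup>2) < \<epsilon>" using y(2) by (simp add: yc dist_chart[OF R])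
      have d1: "\<bar>s - s'\<bar> < \<epsilon>" "\<bar>t - \<psi> s'\<bar> < \<epsilon>"
        using d real_sqrt_sum_squares_ge1[of "s - s'" "t - \<psi> s'"]
          real_sqrt_sum_squares_ge2[of "t - \<psi> s'" "s - s'"]
        by (smt (verit) real_sqrt_ge_abs1 real_sqrt_ge_abs2)+
      have "sqrt (s\<^sup>2 + t\<^sup>2) < a"
        using xb dist_chart[OF R, of z 0 0 s t] by (simp add: chart_center[OF R])
      then have sa: "\<bar>s\<bar> < a" by (smt (verit) real_sqrt_ge_abs1)
      have "dist z ?x < r" using xb a aC by linarith
      then have "?x \<in> K \<inter> ball z r" using xK by simp
      then have "t > \<psi> s" unfolding graph by (simp add: chart_coords[OF R])
      moreover have "t - \<psi> s < \<delta>"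
      proof -
        have "L * \<bar>s' - s\<bar> \<le> L * \<epsilon>" using d1 L by (intro mult_left_mono) auto
        moreover have "t - \<psi> s \<le> \<bar>t - \<psi> s'\<bar> + \<bar>\<psi> s' - \<psi> s\<bar>" by linarith
        ultimately have "t - \<psi> s < \<epsilon> + L * \<epsilon>" using lip[of s' s] d1 by linarith
        then show ?thesis by (simp add: \<delta>_def C_def algebra_simps)
      qed
      ultimately show ?thesis using sa by simp
    qed
    have in_strip: "chart R z s t \<in> strip K \<delta>" if st: "\<bar>s\<bar> < a" "\<psi> s < t" "t < \<psi> s + \<delta>" for s t
    proof -
      have "chart R z s t \<in> K" using region(1)[of s t] st \<delta> by simp
      moreover have "infdist (chart R z s t) (frontier K) \<le> dist (chart R z s t) (chart R z s (\<psi> s))"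
        using region(2)[OF st(1)] by (rule infdist_le)
      moreover have "dist (chart R z s t) (chart R z s (\<psi> s)) = t - \<psi> s" using st by (simp add: dist_chart[OF R])
      ultimately show ?thesis using st by (simp add: strip_def)
    qed
    have c\<phi>: "continuous_on UNIV \<phi>" using sm by (rule smooth_imp_continuous)
    have cg: "continuous_on UNIV (grad \<phi>)" using sm by (rule continuous_on_grad)
    have m1: "(\<lambda>x. ennreal ((norm (\<phi> x))\<^sup>2) * indicator (strip K \<epsilon> \<inter> ball z a) x) \<in> borel_measurable borel"
    proof (rule borel_measurable_times_ennreal)
      show "(\<lambda>x. ennreal ((norm (\<phi> x))\<^sup>2)) \<in> borel_measurable borel"
        using borel_measurable_continuous_onI[OF c\<phi>] by measurable
      show "indicator (strip K \<epsilon> \<inter> ball z a) \<in> borel_measurable borel"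
        using open_strip[OF K] by (intro borel_measurable_indicator borel_open open_Int) auto
    qed
    define f where "f x = ennreal ((norm (grad \<phi> x))\<^sup>2) * indicator (strip K \<delta>) x" for x
    have m2: "f \<in> borel_measurable borel"
      unfolding f_def
    proof (rule borel_measurable_times_ennreal)
      show "(\<lambda>x. ennreal ((norm (grad \<phi> x))\<^sup>2)) \<in> borel_measurable borel"
        using borel_measurable_continuous_onI[OF cg] by measurable
      show "indicator (strip K \<delta>) \<in> borel_measurable borel"
        using open_strip[OF K] by (intro borel_measurable_indicator borel_open)
    qed
    define F where "F s = ennreal ((\<phi> (chart R z s (\<psi> s)))\<^sup>2) * indicator {s. \<bar>s\<bar> < a} s" for s
    have inner: "(\<integral>\<^sup>+t. ennreal ((norm (\<phi> (chart R z s t)))\<^sup>2) * indicator (strip K \<epsilon> \<inter> ball z a) (chart R z s t) \<partial>lborel) \<le>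
        ennreal (2 * \<delta>) * F s + ennreal (2 * \<delta>\<^sup>2) * (\<integral>\<^sup>+t. f (chart R z s t) \<partial>lborel)" for s
    proof (cases "\<bar>s\<bar> < a")
      case True
      define g where "g t = \<phi> (chart R z s t)" for t
      define v where "v = inv R (axis 2 1 :: real^2)"
      define g' where "g' t = grad \<phi> (chart R z s t) \<bullet> v" for t
      have v: "norm v = 1"
        unfolding v_def using orthogonal_transformation_norm[OF orthogonal_transformation_inv[OF R]] by simp
      have D: "(g has_real_derivative g' t) (at t)" for t
        using diff_chain_at[OF chart_vertical_derivative[OF R] has_derivative_grad[OF smooth_imp_differentiable[OF sm]], of z s t]
        by (simp add: g_def[abs_def] g'_def v_def o_def has_field_derivative_def mult_commute_abs)
      have cg': "continuous_on UNIV g'"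
        unfolding g'_def by (intro continuous_intros continuous_on_compose2[OF cg] R) auto
      have "(\<integral>\<^sup>+t. ennreal ((norm (\<phi> (chart R z s t)))\<^sup>2) * indicator (strip K \<epsilon> \<inter> ball z a) (chart R z s t) \<partial>lborel) \<le>
          (\<integral>\<^sup>+t. ennreal ((g t)\<^sup>2) * indicator {\<psi> s<..<\<psi> s + \<delta>} t \<partial>lborel)"
        using strip_in by (intro nn_integral_mono) (auto simp: indicator_def g_def)
      also have "\<dots> \<le> ennreal (2 * \<delta>) * ennreal ((g (\<psi> s))\<^sup>2) +
          ennreal (2 * \<delta>\<^sup>2) * (\<integral>\<^sup>+t. ennreal ((g' t)\<^sup>2) * indicator {\<psi> s<..<\<psi> s + \<delta>} t \<partial>lborel)"
        using D cg' \<delta> by (intro nn_integral_square_le_derivative) auto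
      also have "\<dots> \<le> ennreal (2 * \<delta>) * F s + ennreal (2 * \<delta>\<^sup>2) * (\<integral>\<^sup>+t. f (chart R z s t) \<partial>lborel)"
      proof (intro add_mono mult_left_mono nn_integral_mono)
        show "ennreal ((g (\<psi> s))\<^sup>2) \<le> F s" using True by (simp add: F_def g_def)
        fix t
        have "\<bar>g' t\<bar> \<le> norm (grad \<phi> (chart R z s t))"
          using Cauchy_Schwarz_ineq2[of "grad \<phi> (chart R z s t)" v] v by (simp add: g'_def)
        then have "(g' t)\<^sup>2 \<le> (norm (grad \<phi> (chart R z s t)))\<^sup>2"
          using abs_le_square_iff[of "g' t" "norm (grad \<phi> (chart R z s t))"] by simp
        then show "ennreal ((g' t)\<^sup>2) * indicator {\<psi> s<..<\<psi> s + \<delta>} t \<le> f (chart R z s t)"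
          using in_strip[OF True, of t] by (auto simp: f_def indicator_def intro: ennreal_leI)
      qed auto
      finally show ?thesis .
    next
      case False
      then have "chart R z s t \<notin> strip K \<epsilon> \<inter> ball z a" for t using strip_in by blast
      then show ?thesis by simp
    qed
    have mF: "F \<in> borel_measurable lborel"
    proof -
      have "continuous_on UNIV (\<lambda>s. \<phi> (chart R z s (\<psi> s)))"
        by (intro continuous_on_compose2[OF c\<phi>] continuous_intros R c\<psi>) auto
      then have "(\<lambda>s. \<phi> (chart R z s (\<psi> s))) \<in> borel_measurable borel"
        by (rule borel_measurable_continuous_onI)
      then show ?thesis unfolding F_def by measurable
    qed
    have "energy_on (strip K \<epsilon> \<inter> ball z a) \<phi> =
        (\<integral>\<^sup>+s. \<integral>\<^sup>+t. ennreal ((norm (\<phi> (chart R z s t)))\<^sup>2) * indicator (strip K \<epsilon> \<inter> ball z a) (chart R z s t) \<partial>lborel \<partial>lborel)"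
      using m1 by (rule nn_integral_chart[OF R])
    also have "\<dots> \<le> (\<integral>\<^sup>+s. ennreal (2 * \<delta>) * F s + ennreal (2 * \<delta>\<^sup>2) * (\<integral>\<^sup>+t. f (chart R z s t) \<partial>lborel) \<partial>lborel)"
      using inner by (rule nn_integral_mono)
    also have "\<dots> = ennreal (2 * \<delta>) * (\<integral>\<^sup>+s. F s \<partial>lborel) + ennreal (2 * \<delta>\<^sup>2) * (\<integral>\<^sup>+s. \<integral>\<^sup>+t. f (chart R z s t) \<partial>lborel \<partial>lborel)"
      using mF measurable_nn_integral_chart[OF R m2, of z]
      by (simp add: nn_integral_add nn_integral_cmult)
    also have "(\<integral>\<^sup>+s. \<integral>\<^sup>+t. f (chart R z s t) \<partial>lborel \<partial>lborel) = (\<integral>\<^sup>+x. f x \<partial>lborel)"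
      using nn_integral_chart[OF R m2] by simp
    also have "ennreal (2 * \<delta>) * (\<integral>\<^sup>+s. F s \<partial>lborel) \<le> ennreal (2 * \<delta>) * edge_energy \<Gamma> \<phi>"
    proof (rule mult_left_mono)
      show "(\<integral>\<^sup>+s. F s \<partial>lborel) \<le> edge_energy \<Gamma> \<phi>"
        unfolding F_def edge_energy_def using region(2) fr
        by (intro graph_integral_le_boundary_integral \<Gamma> R c\<psi> continuous_intros c\<phi>) auto
    qed simp
    finally show "energy_on (strip K \<epsilon> \<inter> ball z a) \<phi> \<le>
      ennreal (2 * (C * \<epsilon>)) * edge_energy \<Gamma> \<phi> +
      ennreal (2 * (C * \<epsilon>)\<^sup>2) * energy_on (strip K (C * \<epsilon>)) (grad \<phi>)"
      by (simp add: f_def \<delta>_def add_right_mono)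
  qed
qed

text \<open>The balls of half the radius around finitely many points cover the compact boundary. If \<open>\<epsilon>\<close> is at most
  half of every radius and a half-size ball contains a nearest boundary point of \<open>x\<close>, then the full ball
  contains \<open>x\<close>.\<close>

lemma strip_estimate:
  assumes P: "curvilinear_polygon K \<Gamma>"
  obtains \<rho> B where "\<rho> > 0" "B \<ge> 1" "\<And>\<epsilon> \<phi>. \<lbrakk>0 < \<epsilon>; \<epsilon> \<le> \<rho>; smooth \<phi>\<rbrakk> \<Longrightarrow>
    energy_on (strip K \<epsilon>) \<phi> \<le>
    ennreal (B * \<epsilon>) * edge_energy \<Gamma> \<phi> +
    ennreal (B * \<epsilon>\<^sup>2) * energy_on (strip K (B * \<epsilon>)) (grad \<phi>)"
proof -
  have K: "open K" "bounded K" using P by (auto simp: curvilinear_polygon_def)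
  define S where "S z a C \<longleftrightarrow> a > 0 \<and> C \<ge> 1 \<and> (\<forall>\<epsilon> \<phi>. 0 < \<epsilon> \<longrightarrow> \<epsilon> \<le> a \<longrightarrow> smooth \<phi> \<longrightarrow>
    energy_on (strip K \<epsilon> \<inter> ball z a) \<phi> \<le>
    ennreal (2 * (C * \<epsilon>)) * edge_energy \<Gamma> \<phi> + ennreal (2 * (C * \<epsilon>)\<^sup>2) * energy_on (strip K (C * \<epsilon>)) (grad \<phi>))" for z a C
  have "\<exists>a C. S z a C" if z: "z \<in> frontier K" for z
  proof (rule strip_estimate_local[OF P z])
    fix a C assume aC: "a > 0" "C \<ge> 1" and est: "\<And>\<epsilon> \<phi>. \<lbrakk>0 < \<epsilon>; \<epsilon> \<le> a; smooth \<phi>\<rbrakk> \<Longrightarrow>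
      energy_on (strip K \<epsilon> \<inter> ball z a) \<phi> \<le>
      ennreal (2 * (C * \<epsilon>)) * edge_energy \<Gamma> \<phi> + ennreal (2 * (C * \<epsilon>)\<^sup>2) *
      energy_on (strip K (C * \<epsilon>)) (grad \<phi>)"
    have "S z a C" unfolding S_def using aC est by blast
    then show ?thesis by blast
  qed
  then obtain a C where aC: "\<And>z. z \<in> frontier K \<Longrightarrow> S z (a z) (C z)" by metis
  have cpt: "compact (frontier K)" using K by (simp add: compact_frontier_bounded)
  have cov: "frontier K \<subseteq> (\<Union>z\<in>frontier K. ball z (a z / 2))"
    using aC by (force simp: S_def)
  obtain Z where Z: "Z \<subseteq> frontier K" "finite Z" "frontier K \<subseteq> (\<Union>z\<in>Z. ball z (a z / 2))"
    by (rule compactE_image[OF cpt _ cov]) auto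
  define \<rho> where "\<rho> = Min (insert 1 ((\<lambda>z. a z / 2) ` Z))"
  have a0: "a z > 0" and C1: "C z \<ge> 1" if "z \<in> Z" for z using aC[of z] Z(1) that by (auto simp: S_def)
  have \<epsilon>0: "\<rho> > 0" "\<And>z. z \<in> Z \<Longrightarrow> \<rho> \<le> a z / 2"
    using Z(2) a0 by (simp add: \<rho>_def) (unfold \<rho>_def, rule Min_le, use Z(2) in auto)
  define c where "c = 1 + (\<Sum>z\<in>Z. C z)"
  have s0: "0 \<le> (\<Sum>z\<in>Z. C z)" using C1 by (intro sum_nonneg) (metis C1 order_trans zero_le_one)
  have c: "c \<ge> 1" "C z \<le> c" if "z \<in> Z" for z
  proof -
    have "C z \<le> (\<Sum>z\<in>Z. C z)" using Z(2) that C1 by (intro member_le_sum) (auto intro: order_trans[OF zero_le_one])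
    then show "C z \<le> c" by (simp add: c_def)
    show "c \<ge> 1" using s0 by (simp add: c_def)
  qed
  have c1: "c \<ge> 1" using s0 by (simp add: c_def)
  (* One copy of the local estimate for each chart; the additional one keeps B positive when Z is empty. *)
  define B where "B = real (card Z + 1) * (2 * c\<^sup>2)"
  have cc: "c \<le> c\<^sup>2" using c1 by (simp add: power2_eq_square)
  have B2: "2 * c\<^sup>2 \<le> B" using mult_right_mono[of 1 "real (card Z + 1)" "2 * c\<^sup>2"] by (simp add: B_def)
  have cB: "c \<le> B" using cc B2 c1 by simp
  show thesis
  proof (rule that[OF \<epsilon>0(1), of B])
    show "B \<ge> 1" using cB c1 by simp
    fix \<epsilon> :: real and \<phi> :: "real^2 \<Rightarrow> real"
    assume \<epsilon>: "0 < \<epsilon>" "\<epsilon> \<le> \<rho>" and sm: "smooth \<phi>"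
    have m: "(\<lambda>x. ennreal ((norm (\<phi> x))\<^sup>2) * indicator (strip K \<epsilon> \<inter> ball z r) x) \<in> borel_measurable lborel" for z r
    proof -
      have "\<phi> \<in> borel_measurable borel" using smooth_imp_continuous[OF sm] by (rule borel_measurable_continuous_onI)
      then have 1: "(\<lambda>x. ennreal ((norm (\<phi> x))\<^sup>2)) \<in> borel_measurable borel" by measurable
      have "indicator (strip K \<epsilon> \<inter> ball z r) \<in> borel_measurable borel"
        using open_strip[OF K(1)] by (intro borel_measurable_indicator borel_open open_Int) auto
      from borel_measurable_times_ennreal[OF 1 this] show ?thesis by simp
    qed
    define T where "T = ennreal (2 * c\<^sup>2 * \<epsilon>) * edge_energy \<Gamma> \<phi> + ennreal (2 * c\<^sup>2 * \<epsilon>\<^sup>2) * energy_on (strip K (B * \<epsilon>)) (grad \<phi>)"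
    have "energy_on (strip K \<epsilon>) \<phi> \<le>
        (\<integral>\<^sup>+x. (\<Sum>z\<in>Z. ennreal ((norm (\<phi> x))\<^sup>2) * indicator (strip K \<epsilon> \<inter> ball z (a z)) x) \<partial>lborel)"
    proof (rule nn_integral_mono)
      fix x
      show "ennreal ((norm (\<phi> x))\<^sup>2) * indicator (strip K \<epsilon>) x \<le>
         (\<Sum>z\<in>Z. ennreal ((norm (\<phi> x))\<^sup>2) * indicator (strip K \<epsilon> \<inter> ball z (a z)) x)"
      proof (cases "x \<in> strip K \<epsilon>")
        case True
        then have xK: "x \<in> K" "infdist x (frontier K) < \<epsilon>" by (auto simp: strip_def)
        have "frontier K \<noteq> {}" using K(2) xK(1) by (rule frontier_nonempty_of_bounded)
        then obtain y where y: "y \<in> frontier K" "dist x y < \<epsilon>"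
          using infdist_attains_inf[OF frontier_closed, of K x] xK(2) by metis
        then obtain z where z: "z \<in> Z" "dist z y < a z / 2" using Z(3) by auto
        have "dist z x < a z"
          using dist_triangle[of z x y] y(2) z(2) \<epsilon>(2) \<epsilon>0(2)[OF z(1)] by (simp add: dist_commute)
        then have xz: "x \<in> strip K \<epsilon> \<inter> ball z (a z)" using True by simp
        have "ennreal ((norm (\<phi> x))\<^sup>2) * indicator (strip K \<epsilon> \<inter> ball z (a z)) x \<le>
            (\<Sum>z\<in>Z. ennreal ((norm (\<phi> x))\<^sup>2) * indicator (strip K \<epsilon> \<inter> ball z (a z)) x)"
          using Z(2) z(1) by (intro member_le_sum) auto
        with xz True show ?thesis by simp
      qed simp
    qed
    also have "\<dots> = (\<Sum>z\<in>Z. energy_on (strip K \<epsilon> \<inter> ball z (a z)) \<phi>)"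
      using m by (intro nn_integral_sum)
    also have "\<dots> \<le> (\<Sum>z\<in>Z. T)"
    proof (rule sum_mono)
      fix z assume z: "z \<in> Z"
      have "energy_on (strip K \<epsilon> \<inter> ball z (a z)) \<phi> \<le>
          ennreal (2 * (C z * \<epsilon>)) * edge_energy \<Gamma> \<phi> + ennreal (2 * (C z * \<epsilon>)\<^sup>2) * energy_on (strip K (C z * \<epsilon>)) (grad \<phi>)"
        using aC[of z] z Z(1) \<epsilon> \<epsilon>0(2)[OF z] a0[OF z] sm unfolding S_def by force
      also have "\<dots> \<le> T"
        unfolding T_def
      proof (rule add_mono[OF mult_right_mono mult_mono])
        show "ennreal (2 * (C z * \<epsilon>)) \<le> ennreal (2 * c\<^sup>2 * \<epsilon>)"
          using c(2)[OF z] cc \<epsilon> by (intro ennreal_leI) simp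
        have "(C z)\<^sup>2 \<le> c\<^sup>2" using c(2)[OF z] C1[OF z] by (intro power_mono) auto
        then show "ennreal (2 * (C z * \<epsilon>)\<^sup>2) \<le> ennreal (2 * c\<^sup>2 * \<epsilon>\<^sup>2)"
          by (intro ennreal_leI) (simp add: power_mult_distrib mult_right_mono)
        have "C z * \<epsilon> \<le> B * \<epsilon>" using c(2)[OF z] cB \<epsilon> by (intro mult_right_mono) auto
        then show "energy_on (strip K (C z * \<epsilon>)) (grad \<phi>) \<le> energy_on (strip K (B * \<epsilon>)) (grad \<phi>)"
          using strip_mono[of "C z * \<epsilon>" "B * \<epsilon>" K]
          by (intro nn_integral_mono mult_left_mono) (auto simp: indicator_def)
      qed auto
      finally show "energy_on (strip K \<epsilon> \<inter> ball z (a z)) \<phi> \<le> T" .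
    qed
    also have "\<dots> \<le> of_nat (card Z + 1) * T" by (simp add: mult_right_mono)
    also have "\<dots> = ennreal (B * \<epsilon>) * edge_energy \<Gamma> \<phi> + ennreal (B * \<epsilon>\<^sup>2) * energy_on (strip K (B * \<epsilon>)) (grad \<phi>)"
      using \<epsilon> by (simp add: T_def B_def distrib_left mult.assoc[symmetric] ennreal_mult[symmetric]
        ennreal_of_nat_eq_real_of_nat del: of_nat_add of_nat_Suc)
    finally show "energy_on (strip K \<epsilon>) \<phi> \<le>
      ennreal (B * \<epsilon>) * edge_energy \<Gamma> \<phi> +
      ennreal (B * \<epsilon>\<^sup>2) * energy_on (strip K (B * \<epsilon>)) (grad \<phi>)"
      by simp
  qed
qed

lemma L2_integrable_indicator:
  assumes K: "open K" and S: "open S" and f: "f \<in> L2_on K"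
  shows "integrable (lebesgue_on K) (\<lambda>x. indicator S x * (norm (f x))\<^sup>2)"
proof -
  have "S \<inter> K \<in> sets (lebesgue_on K)" using K S by (auto simp: sets_restrict_space)
  from integrable_mult_indicator[OF this L2_integrable_sq[OF f]]
  have "integrable (lebesgue_on K) (\<lambda>x. indicator (S \<inter> K) x *\<^sub>R (norm (f x))\<^sup>2)" .
  then show ?thesis
    by (rule Bochner_Integration.integrable_cong[THEN iffD1, rotated 2]) (auto simp: indicator_def)
qed

lemma nn_integral_strip:
  fixes f :: "real^2 \<Rightarrow> 'b::euclidean_space"
  assumes K: "open K" "bounded K" and f: "continuous_on UNIV f"
  shows "energy_on (strip K \<delta>) f =
    ennreal (strip_integral K \<delta> f)"
proof -
  have i: "integrable (lebesgue_on K) (\<lambda>x. indicator (strip K \<delta>) x * (norm (f x))\<^sup>2)"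
    using K f by (intro L2_integrable_indicator open_strip continuous_L2)
  have "ennreal (strip_integral K \<delta> f) =
      (\<integral>\<^sup>+x. ennreal (indicator (strip K \<delta>) x * (norm (f x))\<^sup>2) \<partial>lebesgue_on K)"
    using i by (intro nn_integral_eq_integral[symmetric]) auto
  also have "\<dots> = (\<integral>\<^sup>+x. ennreal (indicator (strip K \<delta>) x * (norm (f x))\<^sup>2) * indicator K x \<partial>lebesgue)"
    using K by (intro nn_integral_restrict_space) auto
  also have "\<dots> = energy_on (strip K \<delta>) f"
    unfolding nn_integral_completion
    by (intro nn_integral_cong) (auto simp: indicator_def strip_def)
  finally show ?thesis by simp
qed

lemma edge_energy_eq:
  assumes P: "curvilinear_polygon K \<Gamma>" and sm: "smooth \<phi>"
  shows "edge_energy \<Gamma> \<phi> = ennreal (\<Sum>\<gamma>\<in>\<Gamma>. LINT t|arc_length \<gamma>. (\<phi> (\<gamma> t))\<^sup>2)"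
proof -
  have \<Gamma>: "\<And>\<gamma>. \<gamma> \<in> \<Gamma> \<Longrightarrow> smooth_arc \<gamma>" using P by (auto simp: curvilinear_polygon_def)
  have "(\<integral>\<^sup>+t. ennreal ((\<phi> (\<gamma> t))\<^sup>2) \<partial>arc_length \<gamma>) = ennreal (LINT t|arc_length \<gamma>. (\<phi> (\<gamma> t))\<^sup>2)" if "\<gamma> \<in> \<Gamma>" for \<gamma>
  proof (rule nn_integral_eq_integral)
    show "integrable (arc_length \<gamma>) (\<lambda>t. (\<phi> (\<gamma> t))\<^sup>2)"
      using arc_length_continuous_integrable(2)[OF \<Gamma>[OF that], of "\<lambda>x. (\<phi> x)\<^sup>2"]
      by (simp add: continuous_on_power smooth_imp_continuous[OF sm])
  qed auto
  then show ?thesis unfolding edge_energy_def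
    by (subst sum_ennreal[symmetric]) (auto intro: integral_nonneg_AE)
qed

lemma strip_estimate_integral:
  assumes P: "curvilinear_polygon K \<Gamma>"
  obtains \<rho> B where "\<rho> > 0" "B \<ge> 1" "\<And>\<epsilon> \<phi>. \<lbrakk>0 < \<epsilon>; \<epsilon> \<le> \<rho>; smooth \<phi>\<rbrakk> \<Longrightarrow>
    strip_integral K \<epsilon> \<phi> \<le>
    B * \<epsilon> * (\<Sum>\<gamma>\<in>\<Gamma>. LINT t|arc_length \<gamma>. (\<phi> (\<gamma> t))\<^sup>2) +
    B * \<epsilon>\<^sup>2 * strip_integral K (B * \<epsilon>) (grad \<phi>)"
proof -
  have K: "open K" "bounded K" using P by (auto simp: curvilinear_polygon_def)
  obtain \<rho> B where e: "\<rho> > 0" and B: "B \<ge> 1" and est: "\<And>\<epsilon> \<phi>. \<lbrakk>0 < \<epsilon>; \<epsilon> \<le> \<rho>; smooth \<phi>\<rbrakk> \<Longrightarrow>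
    energy_on (strip K \<epsilon>) \<phi> \<le>
    ennreal (B * \<epsilon>) * edge_energy \<Gamma> \<phi> +
    ennreal (B * \<epsilon>\<^sup>2) * energy_on (strip K (B * \<epsilon>)) (grad \<phi>)"
    by (rule strip_estimate[OF P]) blast
  show thesis
  proof (rule that[OF e B])
    fix \<epsilon> :: real and \<phi> :: "real^2 \<Rightarrow> real"
    assume \<epsilon>: "0 < \<epsilon>" "\<epsilon> \<le> \<rho>" and sm: "smooth \<phi>"
    define a where "a = strip_integral K \<epsilon> \<phi>"
    define b where "b = (\<Sum>\<gamma>\<in>\<Gamma>. LINT t|arc_length \<gamma>. (\<phi> (\<gamma> t))\<^sup>2)"
    define c where "c = strip_integral K (B * \<epsilon>) (grad \<phi>)"
    have b0: "b \<ge> 0" unfolding b_def by (intro sum_nonneg integral_nonneg_AE) auto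
    have c0: "c \<ge> 0" unfolding c_def by (intro integral_nonneg_AE) auto
    have "ennreal a \<le> ennreal (B * \<epsilon>) * ennreal b + ennreal (B * \<epsilon>\<^sup>2) * ennreal c"
      using est[OF \<epsilon> sm] nn_integral_strip[OF K smooth_imp_continuous[OF sm], of \<epsilon>]
        nn_integral_strip[OF K continuous_on_grad[OF sm], of "B * \<epsilon>"] edge_energy_eq[OF P sm]
      by (simp add: a_def b_def c_def)
    also have "\<dots> = ennreal (B * \<epsilon> * b + B * \<epsilon>\<^sup>2 * c)"
      using B \<epsilon> b0 c0 by (simp add: ennreal_mult ennreal_plus)
    finally have "a \<le> B * \<epsilon> * b + B * \<epsilon>\<^sup>2 * c"
      using B \<epsilon> b0 c0 by (subst (asm) ennreal_le_iff) auto
    then show "strip_integral K \<epsilon> \<phi> \<le>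
      B * \<epsilon> * (\<Sum>\<gamma>\<in>\<Gamma>. LINT t|arc_length \<gamma>. (\<phi> (\<gamma> t))\<^sup>2) +
      B * \<epsilon>\<^sup>2 * strip_integral K (B * \<epsilon>) (grad \<phi>)"
      by (simp add: a_def b_def c_def)
  qed
qed

section \<open>Green's formula for functions of zero trace\<close>

text \<open>The approximation property behind \<open>has_trace\<close>, for boundary values 0 and with an arbitrary \<open>G\<close> in place
  of the chosen weak gradient. In this form it passes to differences: no weak gradient of
  a difference has to be identified.\<close>

definition zero_trace_limit ::
  "(real^2) set \<Rightarrow> (real \<Rightarrow> real^2) set \<Rightarrow> (nat \<Rightarrow> real^2 \<Rightarrow> real) \<Rightarrow> (real^2 \<Rightarrow> real) \<Rightarrow> (real^2 \<Rightarrow> real^2) \<Rightarrow> bool" where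
  "zero_trace_limit K \<Gamma> \<phi> u G \<longleftrightarrow> u \<in> L2_on K \<and> G \<in> L2_on K \<and> (\<forall>n. smooth (\<phi> n)) \<and>
    (\<lambda>n. LINT x|lebesgue_on K. (norm (\<phi> n x - u x))\<^sup>2) \<longlonglongrightarrow> 0 \<and>
    (\<lambda>n. LINT x|lebesgue_on K. (norm (grad (\<phi> n) x - G x))\<^sup>2) \<longlonglongrightarrow> 0 \<and>
    (\<lambda>n. \<Sum>\<gamma>\<in>\<Gamma>. LINT t|arc_length \<gamma>. (\<phi> n (\<gamma> t))\<^sup>2) \<longlonglongrightarrow> 0"

lemma L2_indicator_le:
  assumes K: "open K" and S: "open S" and f: "f \<in> L2_on K" and g: "g \<in> L2_on K"
  shows "(LINT x|lebesgue_on K. indicator S x * (norm (f x))\<^sup>2) \<le>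
    2 * (LINT x|lebesgue_on K. (norm (g x - f x))\<^sup>2) + 2 * (LINT x|lebesgue_on K. indicator S x * (norm (g x))\<^sup>2)"
proof -
  note i = L2_integrable_sq[OF L2_diff[OF g f]] L2_integrable_indicator[OF K S g] L2_integrable_indicator[OF K S f]
  have "(LINT x|lebesgue_on K. indicator S x * (norm (f x))\<^sup>2) \<le>
      (LINT x|lebesgue_on K. 2 * (norm (g x - f x))\<^sup>2 + 2 * (indicator S x * (norm (g x))\<^sup>2))"
  proof (intro integral_mono i Bochner_Integration.integrable_add integrable_mult_right)
    fix x
    have "(norm (f x))\<^sup>2 \<le> 2 * (norm (g x))\<^sup>2 + 2 * (norm (g x - f x))\<^sup>2"
      using norm_diff_sq_le[of "g x" "g x - f x"] by simp
    then show "indicator S x * (norm (f x))\<^sup>2 \<le> 2 * (norm (g x - f x))\<^sup>2 + 2 * (indicator S x * (norm (g x))\<^sup>2)"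
      by (auto simp: indicator_def)
  qed
  also have "\<dots> = 2 * (LINT x|lebesgue_on K. (norm (g x - f x))\<^sup>2) + 2 * (LINT x|lebesgue_on K. indicator S x * (norm (g x))\<^sup>2)"
    using i by simp
  finally show ?thesis .
qed

text \<open>In the limit the boundary term of the strip estimate disappears, and the remaining bound is of order
  \<open>\<epsilon>\<^sup>2\<close> instead of \<open>\<epsilon>\<close>.\<close>

lemma zero_trace_strip_estimate:
  assumes P: "curvilinear_polygon K \<Gamma>"
  obtains \<rho> B where "\<rho> > 0" "B \<ge> 1" "\<And>\<epsilon> \<phi> u G. \<lbrakk>0 < \<epsilon>; \<epsilon> \<le> \<rho>; zero_trace_limit K \<Gamma> \<phi> u G\<rbrakk> \<Longrightarrow>
    strip_integral K \<epsilon> u \<le>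
    B * \<epsilon>\<^sup>2 * strip_integral K (B * \<epsilon>) G"
proof -
  have K: "open K" "bounded K" using P by (auto simp: curvilinear_polygon_def)
  obtain \<rho> B where e: "\<rho> > 0" and B: "B \<ge> 1" and est: "\<And>\<epsilon> \<phi>. \<lbrakk>0 < \<epsilon>; \<epsilon> \<le> \<rho>; smooth \<phi>\<rbrakk> \<Longrightarrow>
    strip_integral K \<epsilon> \<phi> \<le>
    B * \<epsilon> * (\<Sum>\<gamma>\<in>\<Gamma>. LINT t|arc_length \<gamma>. (\<phi> (\<gamma> t))\<^sup>2) +
    B * \<epsilon>\<^sup>2 * strip_integral K (B * \<epsilon>) (grad \<phi>)"
    by (rule strip_estimate_integral[OF P]) blast
  show thesis
  proof (rule that[OF e, of "4 * B"])
    show "4 * B \<ge> 1" using B by simp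
    fix \<epsilon> :: real and \<phi> u G assume \<epsilon>: "0 < \<epsilon>" "\<epsilon> \<le> \<rho>" and z: "zero_trace_limit K \<Gamma> \<phi> u G"
    have u: "u \<in> L2_on K" and G: "G \<in> L2_on K" and sm: "\<And>n. smooth (\<phi> n)"
      using z by (auto simp: zero_trace_limit_def)
    define a where "a n = (LINT x|lebesgue_on K. (norm (\<phi> n x - u x))\<^sup>2)" for n
    define b where "b n = (LINT x|lebesgue_on K. (norm (grad (\<phi> n) x - G x))\<^sup>2)" for n
    define c where "c n = (\<Sum>\<gamma>\<in>\<Gamma>. LINT t|arc_length \<gamma>. (\<phi> n (\<gamma> t))\<^sup>2)" for n
    define g where "g = strip_integral K (B * \<epsilon>) G"
    have lim: "a \<longlonglongrightarrow> 0" "b \<longlonglongrightarrow> 0" "c \<longlonglongrightarrow> 0"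
      using z by (auto simp: zero_trace_limit_def a_def[abs_def] b_def[abs_def] c_def[abs_def])
    have le: "strip_integral K \<epsilon> u \<le>
       2 * a n + 2 * (B * \<epsilon> * c n + B * \<epsilon>\<^sup>2 * (2 * b n + 2 * g))" for n
    proof -
      note o = open_strip[OF K(1)]
      have "strip_integral K (B * \<epsilon>) (grad (\<phi> n)) \<le> 2 * b n + 2 * g"
        using L2_indicator_le[OF K(1) o grad_L2[OF sm K] G] by (simp add: b_def g_def norm_minus_commute)
      then have "B * \<epsilon>\<^sup>2 * strip_integral K (B * \<epsilon>) (grad (\<phi> n)) \<le>
          B * \<epsilon>\<^sup>2 * (2 * b n + 2 * g)" using B by (intro mult_left_mono) auto
      then have "strip_integral K \<epsilon> (\<phi> n) \<le>
          B * \<epsilon> * c n + B * \<epsilon>\<^sup>2 * (2 * b n + 2 * g)"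
        using est[OF \<epsilon> sm, of n] unfolding c_def by linarith
      then have "2 * a n + 2 * strip_integral K \<epsilon> (\<phi> n) \<le>
          2 * a n + 2 * (B * \<epsilon> * c n + B * \<epsilon>\<^sup>2 * (2 * b n + 2 * g))"
        by (intro add_left_mono mult_left_mono) auto
      with L2_indicator_le[OF K(1) o u smooth_L2[OF sm K], of \<epsilon> n] show ?thesis
        unfolding a_def by (rule order_trans)
    qed
    have "(\<lambda>n. 2 * a n + 2 * (B * \<epsilon> * c n + B * \<epsilon>\<^sup>2 * (2 * b n + 2 * g))) \<longlonglongrightarrow>
        2 * 0 + 2 * (B * \<epsilon> * 0 + B * \<epsilon>\<^sup>2 * (2 * 0 + 2 * g))"
      by (intro tendsto_intros lim)
    then have "strip_integral K \<epsilon> u \<le>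
        2 * 0 + 2 * (B * \<epsilon> * 0 + B * \<epsilon>\<^sup>2 * (2 * 0 + 2 * g))"
      by (rule LIMSEQ_le_const) (use le in auto)
    also have "\<dots> = 4 * B * \<epsilon>\<^sup>2 * g" by simp
    also have "\<dots> \<le> 4 * B * \<epsilon>\<^sup>2 * strip_integral K (4 * B * \<epsilon>) G"
    proof (rule mult_left_mono)
      show "g \<le> strip_integral K (4 * B * \<epsilon>) G"
        unfolding g_def
      proof (intro integral_mono L2_integrable_indicator K open_strip G)
        fix x
        have "B * \<epsilon> \<le> 4 * B * \<epsilon>" using B \<epsilon> by simp
        from strip_mono[OF this, of K]
        show "indicator (strip K (B * \<epsilon>)) x * (norm (G x))\<^sup>2 \<le> indicator (strip K (4 * B * \<epsilon>)) x * (norm (G x))\<^sup>2"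
          by (auto simp: indicator_def)
      qed
    qed (use B in simp)
    finally show "strip_integral K \<epsilon> u \<le>
      4 * B * \<epsilon>\<^sup>2 * strip_integral K (4 * B * \<epsilon>) G" .
  qed
qed

text \<open>A point of \<open>K\<close> has positive distance to the boundary, so it eventually lies outside the strips. This
  serves both for the indicators of the strips (\<open>c = 0\<close>) and for the cutoffs (\<open>c = 1\<close>).\<close>

lemma integral_tendsto_off_strips:
  fixes b :: "nat \<Rightarrow> real^2 \<Rightarrow> real"
  assumes K: "open K" "bounded K" and h: "integrable (lebesgue_on K) h" and \<delta>: "\<delta> \<longlonglongrightarrow> 0"
    and b: "\<And>n. b n \<in> borel_measurable (lebesgue_on K)" "\<And>n x. \<bar>b n x\<bar> \<le> A"
    "\<And>n x. x \<in> K \<Longrightarrow> \<delta> n < infdist x (frontier K) \<Longrightarrow> b n x = c"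
  shows "(\<lambda>n. LINT x|lebesgue_on K. b n x * h x) \<longlonglongrightarrow> (LINT x|lebesgue_on K. c * h x)"
proof (rule integral_dominated_convergence[where w = "\<lambda>x. A * \<bar>h x\<bar>"])
  show "integrable (lebesgue_on K) (\<lambda>x. A * \<bar>h x\<bar>)" using h by auto
  show "AE x in lebesgue_on K. norm (b n x * h x) \<le> A * \<bar>h x\<bar>" for n
    using b(2) by (intro AE_I2) (auto simp: abs_mult intro!: mult_right_mono)
  show "AE x in lebesgue_on K. (\<lambda>n. b n x * h x) \<longlonglongrightarrow> c * h x"
  proof (rule AE_I2)
    fix x assume "x \<in> space (lebesgue_on K)"
    then have x: "x \<in> K" by simp
    have "\<forall>\<^sub>F n in sequentially. \<delta> n < infdist x (frontier K)"
      using order_tendstoD(2)[OF \<delta> infdist_frontier_pos[OF K x]] .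
    then have "\<forall>\<^sub>F n in sequentially. b n x * h x = c * h x"
      by eventually_elim (use b(3) x in auto)
    then show "(\<lambda>n. b n x * h x) \<longlonglongrightarrow> c * h x" by (rule tendsto_eventually)
  qed
  have m: "h \<in> borel_measurable (lebesgue_on K)" using h by (rule borel_measurable_integrable)
  then show "(\<lambda>x. c * h x) \<in> borel_measurable (lebesgue_on K)" by measurable
  show "(\<lambda>x. b n x * h x) \<in> borel_measurable (lebesgue_on K)" for n
    using b(1) m by (intro borel_measurable_times)
qed

lemma strip_integral_tendsto_0:
  fixes f :: "real^2 \<Rightarrow> 'b::euclidean_space"
  assumes K: "open K" "bounded K" and f: "f \<in> L2_on K" and \<delta>: "\<delta> \<longlonglongrightarrow> 0"
  shows "(\<lambda>n. strip_integral K (\<delta> n) f) \<longlonglongrightarrow> 0"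
proof -
  have "indicat_real (strip K (\<delta> n)) \<in> borel_measurable (lebesgue_on K)" for n
    using open_strip[OF K(1), of "\<delta> n"] by (intro measurable_restrict_space1 borel_measurable_indicator) auto
  from integral_tendsto_off_strips[OF K L2_integrable_sq[OF f] \<delta> this, where A = 1 and c = 0]
  show ?thesis by (simp add: strip_def indicator_def)
qed

lemma L2_dominated:
  fixes f :: "'a \<Rightarrow> 'b::euclidean_space" and g :: "'a \<Rightarrow> 'c::euclidean_space"
  assumes "f \<in> L2 M" "g \<in> borel_measurable M" "\<And>x. norm (g x) \<le> c * norm (f x)"
  shows "g \<in> L2 M"
proof -
  have "integrable M (\<lambda>x. (norm (g x))\<^sup>2)"
  proof (rule Bochner_Integration.integrable_bound)
    show "integrable M (\<lambda>x. c\<^sup>2 * (norm (f x))\<^sup>2)" using L2_integrable_sq[OF assms(1)] by auto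
    show "(\<lambda>x. (norm (g x))\<^sup>2) \<in> borel_measurable M" using assms by measurable
    show "AE x in M. norm ((norm (g x))\<^sup>2) \<le> norm (c\<^sup>2 * (norm (f x))\<^sup>2)"
      using power_mono[OF assms(3) norm_ge_zero, of _ 2] by (intro AE_I2) (simp add: power_mult_distrib)
  qed
  with assms show ?thesis by (simp add: L2_def)
qed

text \<open>The product \<open>\<eta>\<phi>\<^sub>n\<close> is a test function although \<open>\<phi>\<^sub>n\<close> is not. The cutoff is kept fixed while \<open>n\<close>
  tends to infinity.\<close>

lemma green_cutoff:
  assumes K: "open K" "bounded K" and v: "v \<in> L2_on K" and V: "V \<in> L2_on K"
    and wg: "has_weak_grad K v V" and wl: "has_weak_laplacian K v f" and f: "f \<in> L2_on K"
    and z: "zero_trace_limit K \<Gamma> \<phi> u G" and \<eta>: "\<eta> \<in> test_functions K"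
    and A: "\<And>x. \<bar>\<eta> x\<bar> \<le> A" "\<And>x. norm (grad \<eta> x) \<le> A'"
  shows "(LINT x|lebesgue_on K. \<eta> x * (V x \<bullet> G x)) + (LINT x|lebesgue_on K. (V x \<bullet> grad \<eta> x) * u x) =
    - (LINT x|lebesgue_on K. \<eta> x * (f x * u x))" "(\<lambda>x. V x \<bullet> grad \<eta> x) \<in> L2_on K"
proof -
  have u: "u \<in> L2_on K" and G: "G \<in> L2_on K" and sm: "\<And>n. smooth (\<phi> n)"
    using z by (auto simp: zero_trace_limit_def)
  note sm\<eta> = test_function_smooth[OF \<eta>]
  have m\<eta>: "\<eta> \<in> borel_measurable (lebesgue_on K)" using L2_measurable[OF test_function_L2[OF \<eta> K]] .
  have 1: "(\<lambda>x. \<eta> x *\<^sub>R V x) \<in> L2_on K" using V m\<eta> A(1) by (rule L2_bounded_mult)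
  have 3: "(\<lambda>x. \<eta> x * f x) \<in> L2_on K" using L2_bounded_mult[OF f m\<eta> A(1)] by simp
  show 2: "(\<lambda>x. V x \<bullet> grad \<eta> x) \<in> L2_on K"
  proof (rule L2_dominated[OF V])
    show "(\<lambda>x. V x \<bullet> grad \<eta> x) \<in> borel_measurable (lebesgue_on K)"
      using L2_measurable[OF V] L2_measurable[OF grad_L2[OF sm\<eta> K]] by measurable
    show "norm (V x \<bullet> grad \<eta> x) \<le> A' * norm (V x)" for x
      using Cauchy_Schwarz_ineq2[of "V x" "grad \<eta> x"] mult_left_mono[OF A(2)[of x] norm_ge_zero[of "V x"]]
      by (simp add: mult.commute)
  qed
  have id: "(LINT x|lebesgue_on K. grad (\<phi> n) x \<bullet> \<eta> x *\<^sub>R V x) + (LINT x|lebesgue_on K. \<phi> n x \<bullet> (V x \<bullet> grad \<eta> x)) =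
      - (LINT x|lebesgue_on K. \<phi> n x \<bullet> (\<eta> x * f x))" for n
  proof -
    have g: "grad (\<lambda>x. \<eta> x * \<phi> n x) x = \<eta> x *\<^sub>R grad (\<phi> n) x + \<phi> n x *\<^sub>R grad \<eta> x" for x
      by (intro grad_mult smooth_imp_differentiable sm sm\<eta>)
    have "(LINT x|lebesgue_on K. grad (\<phi> n) x \<bullet> \<eta> x *\<^sub>R V x) + (LINT x|lebesgue_on K. \<phi> n x \<bullet> (V x \<bullet> grad \<eta> x)) =
       (LINT x|lebesgue_on K. grad (\<phi> n) x \<bullet> \<eta> x *\<^sub>R V x + \<phi> n x \<bullet> (V x \<bullet> grad \<eta> x))"
      by (intro Bochner_Integration.integral_add[symmetric] L2_integrable_inner grad_L2 smooth_L2 sm K 1 2)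
    also have "\<dots> = (LINT x|lebesgue_on K. V x \<bullet> grad (\<lambda>x. \<eta> x * \<phi> n x) x)"
      by (intro Bochner_Integration.integral_cong) (auto simp: g inner_add_right inner_commute)
    also have "\<dots> = - (LINT x|lebesgue_on K. f x * (\<eta> x * \<phi> n x))"
      by (rule weak_green_test_function[OF K v V wg wl test_functions_mult[OF \<eta> sm]])
    also have "(LINT x|lebesgue_on K. f x * (\<eta> x * \<phi> n x)) = (LINT x|lebesgue_on K. \<phi> n x \<bullet> (\<eta> x * f x))"
      by (intro Bochner_Integration.integral_cong) auto
    finally show ?thesis .
  qed
  have l: "(\<lambda>n. LINT x|lebesgue_on K. (norm (\<phi> n x - u x))\<^sup>2) \<longlonglongrightarrow> 0"
    "(\<lambda>n. LINT x|lebesgue_on K. (norm (grad (\<phi> n) x - G x))\<^sup>2) \<longlonglongrightarrow> 0"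
    using z by (auto simp: zero_trace_limit_def)
  have "(\<lambda>n. (LINT x|lebesgue_on K. grad (\<phi> n) x \<bullet> \<eta> x *\<^sub>R V x) + (LINT x|lebesgue_on K. \<phi> n x \<bullet> (V x \<bullet> grad \<eta> x)))
      \<longlonglongrightarrow> (LINT x|lebesgue_on K. G x \<bullet> \<eta> x *\<^sub>R V x) + (LINT x|lebesgue_on K. u x \<bullet> (V x \<bullet> grad \<eta> x))"
    by (intro tendsto_add L2_tendsto_inner grad_L2 smooth_L2 sm K G u 1 2 l)
  moreover have "(\<lambda>n. - (LINT x|lebesgue_on K. \<phi> n x \<bullet> (\<eta> x * f x))) \<longlonglongrightarrow> - (LINT x|lebesgue_on K. u x \<bullet> (\<eta> x * f x))"
    by (intro tendsto_minus L2_tendsto_inner smooth_L2 sm K u 3 l)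
  ultimately have "(LINT x|lebesgue_on K. G x \<bullet> \<eta> x *\<^sub>R V x) + (LINT x|lebesgue_on K. u x \<bullet> (V x \<bullet> grad \<eta> x)) =
      - (LINT x|lebesgue_on K. u x \<bullet> (\<eta> x * f x))"
    unfolding id by (rule LIMSEQ_unique)
  then show "(LINT x|lebesgue_on K. \<eta> x * (V x \<bullet> G x)) + (LINT x|lebesgue_on K. (V x \<bullet> grad \<eta> x) * u x) =
    - (LINT x|lebesgue_on K. \<eta> x * (f x * u x))"
    by (simp add: inner_commute mult.left_commute mult.commute[of "u _"])
qed

text \<open>The cutoffs are now let approach 1. The term with \<open>\<nabla>\<eta>\<close> is an integral over a strip, where \<open>\<nabla>\<eta>\<close> of size
  \<open>1/\<delta>\<close> meets \<open>u\<close> of size \<open>\<delta>\<close>; what remains are integrals of \<open>\<bar>V\<bar>\<^sup>2\<close> and \<open>\<bar>G\<bar>\<^sup>2\<close> over shrinking strips.\<close>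

lemma zero_trace_green:
  assumes P: "curvilinear_polygon K \<Gamma>" and v: "v \<in> L2_on K" and V: "V \<in> L2_on K"
    and wg: "has_weak_grad K v V" and wl: "has_weak_laplacian K v f" and f: "f \<in> L2_on K"
    and z: "zero_trace_limit K \<Gamma> \<phi> u G"
  shows "(LINT x|lebesgue_on K. V x \<bullet> G x) = - (LINT x|lebesgue_on K. f x * u x)"
proof -
  have K: "open K" "bounded K" using P by (auto simp: curvilinear_polygon_def)
  have u: "u \<in> L2_on K" and G: "G \<in> L2_on K"
    using z by (auto simp: zero_trace_limit_def)
  obtain \<rho> B where e0: "\<rho> > 0" and B: "B \<ge> 1" and est: "\<And>\<epsilon> \<phi> u G. \<lbrakk>0 < \<epsilon>; \<epsilon> \<le> \<rho>; zero_trace_limit K \<Gamma> \<phi> u G\<rbrakk> \<Longrightarrow>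
    strip_integral K \<epsilon> u \<le>
    B * \<epsilon>\<^sup>2 * strip_integral K (B * \<epsilon>) G"
    by (rule zero_trace_strip_estimate[OF P]) blast
  obtain A where A: "A > 0" and cut: "\<And>(K :: (real^2) set) \<epsilon>. open K \<Longrightarrow> bounded K \<Longrightarrow> \<epsilon> > 0 \<Longrightarrow>
    \<exists>\<eta>. boundary_cutoff K \<epsilon> A \<eta>"
    by (rule cutoff_exists) blast
  define \<delta> where "\<delta> n = \<rho> / 2 * inverse (real (Suc n))" for n
  have \<delta>: "\<delta> n > 0" "2 * \<delta> n \<le> \<rho>" for n
    using e0 by (auto simp: \<delta>_def field_simps)
  have "\<delta> \<longlonglongrightarrow> \<rho> / 2 * 0" unfolding \<delta>_def by (intro tendsto_intros LIMSEQ_inverse_real_of_nat)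
  then have \<delta>0: "\<delta> \<longlonglongrightarrow> 0" by simp
  obtain \<eta> where \<eta>: "\<And>n. \<eta> n \<in> test_functions K" "\<And>n x. \<bar>\<eta> n x\<bar> \<le> A" "\<And>n x. norm (grad (\<eta> n) x) \<le> A / \<delta> n"
    "\<And>n x. x \<in> K \<Longrightarrow> infdist x (frontier K) \<ge> \<delta> n \<Longrightarrow> \<eta> n x = 1"
    "\<And>n x. x \<in> K \<Longrightarrow> infdist x (frontier K) > \<delta> n \<Longrightarrow> grad (\<eta> n) x = 0"
    using cut[OF K \<delta>(1)] unfolding boundary_cutoff_def by metis
  have m\<eta>: "\<eta> n \<in> borel_measurable (lebesgue_on K)" for n
    using L2_measurable[OF test_function_L2[OF \<eta>(1) K]] .
  note gc = green_cutoff[OF K v V wg wl f z \<eta>(1) \<eta>(2) \<eta>(3)]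
  have I: "(\<lambda>n. LINT x|lebesgue_on K. \<eta> n x * (V x \<bullet> G x)) \<longlonglongrightarrow> (LINT x|lebesgue_on K. V x \<bullet> G x)"
    using integral_tendsto_off_strips[OF K L2_integrable_inner[OF V G] \<delta>0 m\<eta> \<eta>(2), where c = 1] \<eta>(4) by simp
  have J: "(\<lambda>n. LINT x|lebesgue_on K. \<eta> n x * (f x * u x)) \<longlonglongrightarrow> (LINT x|lebesgue_on K. f x * u x)"
    using integral_tendsto_off_strips[OF K L2_integrable_mult[OF f u] \<delta>0 m\<eta> \<eta>(2), where c = 1] \<eta>(4) by simp
  have R: "(\<lambda>n. LINT x|lebesgue_on K. (V x \<bullet> grad (\<eta> n) x) * u x) \<longlonglongrightarrow> 0"
  proof (rule Lim_null_comparison)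
    (* The strips have width 2 \<delta> because \<nabla>\<eta> may be nonzero at distance exactly \<delta>. *)
    define N where "N n = strip_integral K (2 * \<delta> n) V +
      4 * A\<^sup>2 * B * strip_integral K (B * (2 * \<delta> n)) G" for n
    have "norm (LINT x|lebesgue_on K. (V x \<bullet> grad (\<eta> n) x) * u x) \<le> N n" for n
    proof -
      note o = open_strip[OF K(1)]
      note i = L2_integrable_indicator[OF K(1) o V] L2_integrable_indicator[OF K(1) o u]
      have "norm (LINT x|lebesgue_on K. (V x \<bullet> grad (\<eta> n) x) * u x) \<le>
          (LINT x|lebesgue_on K. norm ((V x \<bullet> grad (\<eta> n) x) * u x))" by (rule integral_norm_bound)
      also have "\<dots> \<le> (LINT x|lebesgue_on K. indicator (strip K (2 * \<delta> n)) x * (norm (V x))\<^sup>2 +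
          (A / \<delta> n)\<^sup>2 * (indicator (strip K (2 * \<delta> n)) x * (norm (u x))\<^sup>2))"
      proof (rule integral_mono)
        show "integrable (lebesgue_on K) (\<lambda>x. norm ((V x \<bullet> grad (\<eta> n) x) * u x))"
          by (intro integrable_norm L2_integrable_mult gc(2) u)
        show "integrable (lebesgue_on K) (\<lambda>x. indicator (strip K (2 * \<delta> n)) x * (norm (V x))\<^sup>2 +
          (A / \<delta> n)\<^sup>2 * (indicator (strip K (2 * \<delta> n)) x * (norm (u x))\<^sup>2))"
          by (intro Bochner_Integration.integrable_add integrable_mult_right i)
        fix x assume "x \<in> space (lebesgue_on K)"
        then have x: "x \<in> K" by simp
        show "norm ((V x \<bullet> grad (\<eta> n) x) * u x) \<le> indicator (strip K (2 * \<delta> n)) x * (norm (V x))\<^sup>2 +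
          (A / \<delta> n)\<^sup>2 * (indicator (strip K (2 * \<delta> n)) x * (norm (u x))\<^sup>2)"
        proof (cases "x \<in> strip K (2 * \<delta> n)")
          case True
          have "norm (V x \<bullet> grad (\<eta> n) x) \<le> norm (V x) * (A / \<delta> n)"
            using Cauchy_Schwarz_ineq2[of "V x" "grad (\<eta> n) x"] mult_left_mono[OF \<eta>(3)[of n x] norm_ge_zero, of "V x"]
            by simp
          then have "norm ((V x \<bullet> grad (\<eta> n) x) * u x) \<le> norm (V x) * (A / \<delta> n * \<bar>u x\<bar>)"
            using mult_right_mono[OF _ abs_ge_zero, of "norm (V x \<bullet> grad (\<eta> n) x)" "norm (V x) * (A / \<delta> n)" "u x"]
            by (simp add: abs_mult mult.assoc)
          also have "\<dots> \<le> (norm (V x))\<^sup>2 + (A / \<delta> n * \<bar>u x\<bar>)\<^sup>2"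
            using inner_le_sum_squares[of "norm (V x)" "A / \<delta> n * \<bar>u x\<bar>"] A \<delta>(1)[of n] by (simp add: abs_mult)
          finally show ?thesis using True by (simp add: power_mult_distrib power_divide)
        next
          case False
          then have "infdist x (frontier K) > \<delta> n" using x \<delta>(1)[of n] by (auto simp: strip_def)
          then show ?thesis using \<eta>(5)[OF x] False by simp
        qed
      qed
      also have "\<dots> = strip_integral K (2 * \<delta> n) V +
          (A / \<delta> n)\<^sup>2 * strip_integral K (2 * \<delta> n) u"
        using i by simp
      also have "\<dots> \<le> strip_integral K (2 * \<delta> n) V +
          (A / \<delta> n)\<^sup>2 * (B * (2 * \<delta> n)\<^sup>2 * strip_integral K (B * (2 * \<delta> n)) G)"
        using est[OF _ \<delta>(2) z, of n] \<delta>(1)[of n] by (intro add_left_mono mult_left_mono) auto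
      also have "\<dots> = N n"
        using \<delta>(1)[of n] by (simp add: N_def power_divide power_mult_distrib)
      finally show ?thesis .
    qed
    then show "\<forall>\<^sub>F n in sequentially. norm (LINT x|lebesgue_on K. (V x \<bullet> grad (\<eta> n) x) * u x) \<le> N n" by simp
    have "(\<lambda>n. 2 * \<delta> n) \<longlonglongrightarrow> 2 * 0" "(\<lambda>n. B * (2 * \<delta> n)) \<longlonglongrightarrow> B * (2 * 0)" by (intro tendsto_intros \<delta>0)+
    then have s: "(\<lambda>n. 2 * \<delta> n) \<longlonglongrightarrow> 0" "(\<lambda>n. B * (2 * \<delta> n)) \<longlonglongrightarrow> 0" by simp_all
    have "N \<longlonglongrightarrow> 0 + 4 * A\<^sup>2 * B * 0"
      unfolding N_def[abs_def] by (intro tendsto_add tendsto_mult_left strip_integral_tendsto_0 K V G s)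
    then show "N \<longlonglongrightarrow> 0" by simp
  qed
  have "(\<lambda>n. - (LINT x|lebesgue_on K. \<eta> n x * (f x * u x))) \<longlonglongrightarrow> (LINT x|lebesgue_on K. V x \<bullet> G x) + 0"
    unfolding gc(1)[symmetric] by (rule tendsto_add[OF I R])
  with tendsto_minus[OF J] show ?thesis using LIMSEQ_unique by fastforce
qed

section \<open>The weak normal derivative\<close>

lemma zero_trace_limit_of_trace_0:
  assumes "has_trace K \<Gamma> v (\<lambda>_. 0)"
  obtains \<phi> where "zero_trace_limit K \<Gamma> \<phi> v (weak_grad K v)"
proof -
  have v: "v \<in> H1 K" using assms by (simp add: has_trace_def)
  show ?thesis
    using assms weak_grad_H1[OF v] that unfolding has_trace_def zero_trace_limit_def by auto
qed

lemma smooth_arc_L2: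
  fixes \<phi> :: "real^2 \<Rightarrow> real"
  assumes P: "curvilinear_polygon K \<Gamma>" and \<gamma>: "\<gamma> \<in> \<Gamma>" and sm: "smooth \<phi>"
  shows "\<phi> \<circ> \<gamma> \<in> L2 (arc_length \<gamma>)"
proof -
  have sa: "smooth_arc \<gamma>" using P \<gamma> by (auto simp: curvilinear_polygon_def)
  have c: "continuous_on {0..1} (\<phi> \<circ> \<gamma>)"
    using sa by (intro continuous_on_compose smooth_imp_continuous[OF sm]) (simp add: smooth_arc_def arc_def path_def)
  then have "\<phi> \<circ> \<gamma> \<in> borel_measurable (lebesgue_on {0..1})"
    by (intro continuous_imp_measurable_on_sets_lebesgue) auto
  then have "\<phi> \<circ> \<gamma> \<in> borel_measurable (arc_length \<gamma>)" by (simp add: arc_length_def)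
  moreover have "integrable (arc_length \<gamma>) (\<lambda>t. (\<phi> (\<gamma> t))\<^sup>2)"
    using arc_length_continuous_integrable(2)[OF sa, of "\<lambda>x. (\<phi> x)\<^sup>2"]
    by (simp add: continuous_on_power smooth_imp_continuous[OF sm])
  ultimately show ?thesis by (simp add: L2_def)
qed

lemma L2_diff_sq_le:
  assumes "f \<in> L2 M" "g \<in> L2 M" "h \<in> L2 M"
  shows "(LINT x|M. (norm (f x - g x))\<^sup>2) \<le> 2 * (LINT x|M. (norm (f x - h x))\<^sup>2) + 2 * (LINT x|M. (norm (g x - h x))\<^sup>2)"
proof -
  note i = L2_integrable_sq[OF L2_diff[OF assms(1,3)]] L2_integrable_sq[OF L2_diff[OF assms(2,3)]]
    L2_integrable_sq[OF L2_diff[OF assms(1,2)]]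
  have "(LINT x|M. (norm (f x - g x))\<^sup>2) \<le> (LINT x|M. 2 * (norm (f x - h x))\<^sup>2 + 2 * (norm (g x - h x))\<^sup>2)"
  proof (intro integral_mono i Bochner_Integration.integrable_add integrable_mult_right)
    show "(norm (f x - g x))\<^sup>2 \<le> 2 * (norm (f x - h x))\<^sup>2 + 2 * (norm (g x - h x))\<^sup>2" for x
      using norm_diff_sq_le[of "f x - h x" "g x - h x"] by simp
  qed
  also have "\<dots> = 2 * (LINT x|M. (norm (f x - h x))\<^sup>2) + 2 * (LINT x|M. (norm (g x - h x))\<^sup>2)"
    using i by simp
  finally show ?thesis .
qed

lemma zero_trace_limit_diff:
  assumes P: "curvilinear_polygon K \<Gamma>" and W: "has_trace K \<Gamma> W g" and w: "has_trace K \<Gamma> w g"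
  obtains \<phi> where "zero_trace_limit K \<Gamma> \<phi> (\<lambda>x. W x - w x) (\<lambda>x. weak_grad K W x - weak_grad K w x)"
proof -
  have K: "open K" "bounded K" using P by (auto simp: curvilinear_polygon_def)
  have H: "W \<in> H1 K" "w \<in> H1 K" and g: "\<And>\<gamma>. \<gamma> \<in> \<Gamma> \<Longrightarrow> g \<circ> \<gamma> \<in> L2 (arc_length \<gamma>)"
    using W w by (auto simp: has_trace_def bdry_L2_def)
  note HW = weak_grad_H1[OF H(1)] and Hw = weak_grad_H1[OF H(2)]
  obtain \<Phi> where \<Phi>: "\<And>n. smooth (\<Phi> n)" "(\<lambda>n. LINT x|lebesgue_on K. (\<Phi> n x - W x)\<^sup>2) \<longlonglongrightarrow> 0"
    "(\<lambda>n. LINT x|lebesgue_on K. (norm (grad (\<Phi> n) x - weak_grad K W x))\<^sup>2) \<longlonglongrightarrow> 0"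
    "(\<lambda>n. \<Sum>\<gamma>\<in>\<Gamma>. LINT t|arc_length \<gamma>. (\<Phi> n (\<gamma> t) - g (\<gamma> t))\<^sup>2) \<longlonglongrightarrow> 0"
    using W unfolding has_trace_def by blast
  obtain \<phi> where \<phi>: "\<And>n. smooth (\<phi> n)" "(\<lambda>n. LINT x|lebesgue_on K. (\<phi> n x - w x)\<^sup>2) \<longlonglongrightarrow> 0"
    "(\<lambda>n. LINT x|lebesgue_on K. (norm (grad (\<phi> n) x - weak_grad K w x))\<^sup>2) \<longlonglongrightarrow> 0"
    "(\<lambda>n. \<Sum>\<gamma>\<in>\<Gamma>. LINT t|arc_length \<gamma>. (\<phi> n (\<gamma> t) - g (\<gamma> t))\<^sup>2) \<longlonglongrightarrow> 0"
    using w unfolding has_trace_def by blast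
  have sq: "X \<longlonglongrightarrow> 0" if "\<And>n. 0 \<le> X n" "\<And>n. X n \<le> 2 * Y n + 2 * Z n" "Y \<longlonglongrightarrow> 0" "Z \<longlonglongrightarrow> 0"
    for X Y Z :: "nat \<Rightarrow> real"
  proof (rule real_tendsto_sandwich[OF _ _ tendsto_const])
    have "(\<lambda>n. 2 * Y n + 2 * Z n) \<longlonglongrightarrow> 2 * 0 + 2 * 0" by (intro tendsto_intros that)
    then show "(\<lambda>n. 2 * Y n + 2 * Z n) \<longlonglongrightarrow> 0" by simp
  qed (use that in auto)
  have gd: "grad (\<lambda>x. \<Phi> n x - \<phi> n x) x = grad (\<Phi> n) x - grad (\<phi> n) x" for n x
    by (intro grad_diff smooth_imp_differentiable \<Phi> \<phi>)
  have "zero_trace_limit K \<Gamma> (\<lambda>n x. \<Phi> n x - \<phi> n x) (\<lambda>x. W x - w x) (\<lambda>x. weak_grad K W x - weak_grad K w x)"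
    unfolding zero_trace_limit_def
  proof (intro conjI allI)
    show "(\<lambda>x. W x - w x) \<in> L2_on K" "(\<lambda>x. weak_grad K W x - weak_grad K w x) \<in> L2_on K"
      using HW Hw by (intro L2_diff; simp)+
    show "smooth (\<lambda>x. \<Phi> n x - \<phi> n x)" for n using \<Phi> \<phi> by (intro smooth_diff)
    show "(\<lambda>n. LINT x|lebesgue_on K. (norm (\<Phi> n x - \<phi> n x - (W x - w x)))\<^sup>2) \<longlonglongrightarrow> 0"
    proof (rule sq[OF _ _ \<Phi>(2) \<phi>(2)])
      fix n
      show "(LINT x|lebesgue_on K. (norm (\<Phi> n x - \<phi> n x - (W x - w x)))\<^sup>2) \<le>
        2 * (LINT x|lebesgue_on K. (\<Phi> n x - W x)\<^sup>2) + 2 * (LINT x|lebesgue_on K. (\<phi> n x - w x)\<^sup>2)"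
        using L2_diff_sq_le[OF L2_diff[OF smooth_L2[OF \<Phi>(1) K] HW(1)] L2_diff[OF smooth_L2[OF \<phi>(1) K] Hw(1)]
          smooth_L2[OF smooth_const K], of n n 0] by (simp add: algebra_simps)
    qed (auto intro: integral_nonneg_AE)
    show "(\<lambda>n. LINT x|lebesgue_on K. (norm (grad (\<lambda>x. \<Phi> n x - \<phi> n x) x - (weak_grad K W x - weak_grad K w x)))\<^sup>2) \<longlonglongrightarrow> 0"
    proof (rule sq[OF _ _ \<Phi>(3) \<phi>(3)])
      fix n
      have "(\<lambda>x. 0 :: real^2) \<in> L2_on K" using K by (intro continuous_L2) auto
      from L2_diff_sq_le[OF L2_diff[OF grad_L2[OF \<Phi>(1) K] HW(2)] L2_diff[OF grad_L2[OF \<phi>(1) K] Hw(2)] this, of n n]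
      show "(LINT x|lebesgue_on K. (norm (grad (\<lambda>x. \<Phi> n x - \<phi> n x) x - (weak_grad K W x - weak_grad K w x)))\<^sup>2) \<le>
        2 * (LINT x|lebesgue_on K. (norm (grad (\<Phi> n) x - weak_grad K W x))\<^sup>2) +
        2 * (LINT x|lebesgue_on K. (norm (grad (\<phi> n) x - weak_grad K w x))\<^sup>2)"
        by (simp add: gd algebra_simps)
    qed (auto intro: integral_nonneg_AE)
    show "(\<lambda>n. \<Sum>\<gamma>\<in>\<Gamma>. LINT t|arc_length \<gamma>. (\<Phi> n (\<gamma> t) - \<phi> n (\<gamma> t))\<^sup>2) \<longlonglongrightarrow> 0"
    proof (rule sq[OF _ _ \<Phi>(4) \<phi>(4)])
      fix n
      have "(LINT t|arc_length \<gamma>. (\<Phi> n (\<gamma> t) - \<phi> n (\<gamma> t))\<^sup>2) \<le>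
        2 * (LINT t|arc_length \<gamma>. (\<Phi> n (\<gamma> t) - g (\<gamma> t))\<^sup>2) + 2 * (LINT t|arc_length \<gamma>. (\<phi> n (\<gamma> t) - g (\<gamma> t))\<^sup>2)"
        if "\<gamma> \<in> \<Gamma>" for \<gamma>
        using L2_diff_sq_le[OF smooth_arc_L2[OF P that \<Phi>(1)] smooth_arc_L2[OF P that \<phi>(1)] g[OF that], of n n] by simp
      then show "(\<Sum>\<gamma>\<in>\<Gamma>. LINT t|arc_length \<gamma>. (\<Phi> n (\<gamma> t) - \<phi> n (\<gamma> t))\<^sup>2) \<le>
        2 * (\<Sum>\<gamma>\<in>\<Gamma>. LINT t|arc_length \<gamma>. (\<Phi> n (\<gamma> t) - g (\<gamma> t))\<^sup>2) +
        2 * (\<Sum>\<gamma>\<in>\<Gamma>. LINT t|arc_length \<gamma>. (\<phi> n (\<gamma> t) - g (\<gamma> t))\<^sup>2)"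
        unfolding sum_distrib_left sum.distrib[symmetric] by (rule sum_mono)
    qed (intro sum_nonneg integral_nonneg_AE; simp)
  qed
  then show ?thesis by (rule that)
qed

text \<open>Green's formula applied to the difference \<open>W - w\<close> of two extensions of \<open>g\<close> shows that the
  description in \<open>normal_deriv\<close> determines a unique number. The chosen weak Laplacian is replaced by the given
  \<open>f\<close>, which agrees with it almost everywhere.\<close>

lemma normal_deriv_eq:
  assumes P: "curvilinear_polygon K \<Gamma>" and v: "v \<in> H1 K" and f: "f \<in> L2_on K"
    and wl: "has_weak_laplacian K v f" and w: "has_trace K \<Gamma> w g"
  shows "normal_deriv K \<Gamma> v g =
    (LINT x|lebesgue_on K. weak_grad K v x \<bullet> weak_grad K w x) + (LINT x|lebesgue_on K. f x * w x)"
proof -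
  have K: "open K" "bounded K" using P by (auto simp: curvilinear_polygon_def)
  note H = weak_grad_H1[OF v]
  note L = weak_laplacian_eq_AE[OF K f wl]
  define \<Psi> where "\<Psi> W = (LINT x|lebesgue_on K. weak_grad K v x \<bullet> weak_grad K W x) +
      (LINT x|lebesgue_on K. weak_laplacian K v x * W x)" for W
  have \<Psi>: "\<Psi> W = \<Psi> w" if W: "has_trace K \<Gamma> W g" for W
  proof -
    obtain \<phi> where z: "zero_trace_limit K \<Gamma> \<phi> (\<lambda>x. W x - w x) (\<lambda>x. weak_grad K W x - weak_grad K w x)"
      by (rule zero_trace_limit_diff[OF P W w])
    have "W \<in> H1 K" "w \<in> H1 K" using W w by (auto simp: has_trace_def)
    note HW = weak_grad_H1[OF this(1)] weak_grad_H1[OF this(2)]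
    show ?thesis
      using zero_trace_green[OF P H(1,2,3) L(2,1) z] L2_integrable_inner[OF H(2) HW(2)] L2_integrable_inner[OF H(2) HW(5)]
        L2_integrable_mult[OF L(1) HW(1)] L2_integrable_mult[OF L(1) HW(4)]
      by (simp add: \<Psi>_def inner_diff_right right_diff_distrib)
  qed
  have "normal_deriv K \<Gamma> v g = (THE r. \<forall>W. has_trace K \<Gamma> W g \<longrightarrow> r = \<Psi> W)"
    by (simp only: normal_deriv_def \<Psi>_def)
  also have "\<dots> = \<Psi> w"
  proof (rule the_equality)
    show "\<forall>W. has_trace K \<Gamma> W g \<longrightarrow> \<Psi> w = \<Psi> W"
      by (intro allI impI \<Psi>[symmetric])
    fix r assume "\<forall>W. has_trace K \<Gamma> W g \<longrightarrow> r = \<Psi> W"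
    with w show "r = \<Psi> w" by blast
  qed
  finally have "normal_deriv K \<Gamma> v g = \<Psi> w" .
  also note \<Psi>_def
  also have "(LINT x|lebesgue_on K. weak_laplacian K v x * w x) = (LINT x|lebesgue_on K. f x * w x)"
  proof (rule integral_cong_AE)
    have "w \<in> L2_on K" using w weak_grad_H1(1) by (auto simp: has_trace_def)
    then show "(\<lambda>x. weak_laplacian K v x * w x) \<in> borel_measurable (lebesgue_on K)"
      "(\<lambda>x. f x * w x) \<in> borel_measurable (lebesgue_on K)"
      using L(1) f by (auto intro!: borel_measurable_times L2_measurable)
    show "AE x in lebesgue_on K. weak_laplacian K v x * w x = f x * w x"
      using L(3) by eventually_elim simp
  qed
  finally show ?thesis .
qed

lemma smooth_has_trace:
  assumes P: "curvilinear_polygon K \<Gamma>" and Q: "smooth Q"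
  shows "has_trace K \<Gamma> Q Q"
proof -
  have K: "open K" "bounded K" using P by (auto simp: curvilinear_polygon_def)
  note H = smooth_H1[OF K Q]
  have "(LINT x|lebesgue_on K. (norm (grad Q x - weak_grad K Q x))\<^sup>2) = (LINT x|lebesgue_on K. 0)"
  proof (rule integral_cong_AE)
    show "(\<lambda>x. (norm (grad Q x - weak_grad K Q x))\<^sup>2) \<in> borel_measurable (lebesgue_on K)"
      using L2_integrable_sq[OF L2_diff[OF grad_L2[OF Q K] weak_grad_H1(2)[OF H(1)]]]
      by (rule borel_measurable_integrable)
    show "AE x in lebesgue_on K. (norm (grad Q x - weak_grad K Q x))\<^sup>2 = 0"
      using H(2) by eventually_elim simp
  qed simp
  then show ?thesis
    unfolding has_trace_def bdry_L2_def using H(1) smooth_arc_L2[OF P _ Q] Q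
    by (auto intro!: exI[of _ "\<lambda>_. Q"])
qed

lemma polys_smooth:
  assumes "p \<in> polys j"
  shows "smooth p"
proof -
  obtain c where "\<And>x. p x = (\<Sum>(a, b) \<in> {(a, b). int a + int b \<le> j}. c a b * (x $ 1) ^ a * (x $ 2) ^ b)"
    using assms by (auto simp: polys_def)
  then have "p = (\<lambda>x. \<Sum>q \<in> {(a, b). int a + int b \<le> j}. c (fst q) (snd q) * (x $ 1) ^ fst q * (x $ 2) ^ snd q)"
    by (auto simp: fun_eq_iff split_def)
  then show ?thesis
    by (simp add: smooth_sum smooth_mult smooth_const smooth_power smooth_bounded_linear bounded_linear_vec_nth)
qed

lemma polys_on_L2:
  assumes "open K" "bounded K" "p \<in> polys_on j K"
  shows "p \<in> L2_on K"
proof -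
  obtain q where q: "q \<in> polys j" "\<And>x. x \<in> K \<Longrightarrow> p x = q x" using assms by (auto simp: polys_on_def)
  have "q \<in> L2_on K" using assms by (intro smooth_L2 polys_smooth[OF q(1)])
  moreover have "p \<in> borel_measurable (lebesgue_on K) \<longleftrightarrow> q \<in> borel_measurable (lebesgue_on K)"
    by (rule measurable_cong) (simp add: q(2))
  moreover have "integrable (lebesgue_on K) (\<lambda>x. (norm (p x))\<^sup>2) \<longleftrightarrow> integrable (lebesgue_on K) (\<lambda>x. (norm (q x))\<^sup>2)"
    by (rule Bochner_Integration.integrable_cong) (simp_all add: q(2))
  ultimately show ?thesis by (simp add: L2_def)
qed

theorem mainTheorem2:
  fixes K :: "(real^2) set" and \<Gamma> :: "(real \<Rightarrow> real^2) set" and m :: int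
  assumes "curvilinear_polygon K \<Gamma>" and "m \<ge> 1"
  shows
    "(\<forall>v \<in> V_bdry m K \<Gamma>. \<forall>w \<in> V_int m K \<Gamma>.
        (LINT x|lebesgue_on K. weak_grad K v x \<bullet> weak_grad K w x) = 0)
   \<and> (\<forall>v \<in> V_bdry m K \<Gamma>. \<forall>w \<in> V_bdry m K \<Gamma>.
        (LINT x|lebesgue_on K. weak_grad K v x \<bullet> weak_grad K w x)
          = normal_deriv K \<Gamma> v (bdry_trace K \<Gamma> w))
   \<and> (\<forall>v \<in> V_int m K \<Gamma>. \<forall>w \<in> V_int m K \<Gamma>.
        \<forall>p \<in> polys_on (m - 2) K. \<forall>q \<in> polys_on (m - 2) K. \<forall>Q \<in> polys m.
          has_weak_laplacian K v p \<longrightarrow> has_weak_laplacian K w q \<longrightarrow>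
          (\<forall>x\<in>K. laplacian Q x = q x) \<longrightarrow>
          (LINT x|lebesgue_on K. weak_grad K v x \<bullet> weak_grad K w x)
            = normal_deriv K \<Gamma> v Q - (LINT x|lebesgue_on K. p x * Q x))"
proof (intro conjI ballI impI)
  note P = assms(1)
  have K: "open K" "bounded K" using P by (auto simp: curvilinear_polygon_def)
  have L0: "(\<lambda>_. 0 :: real) \<in> L2 (lebesgue_on K)" using smooth_L2[OF smooth_const K] .
  {
    fix v w assume v: "v \<in> V_bdry m K \<Gamma>" and w: "w \<in> V_int m K \<Gamma>"
    have v': "v \<in> H1 K" "has_weak_laplacian K v (\<lambda>_. 0)" using v by (auto simp: V_bdry_def)
    have "has_trace K \<Gamma> w (\<lambda>_. 0)" using w by (simp add: V_int_def)
    then obtain \<phi> where "zero_trace_limit K \<Gamma> \<phi> w (weak_grad K w)"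
      by (rule zero_trace_limit_of_trace_0)
    from zero_trace_green[OF P weak_grad_H1[OF v'(1)] v'(2) L0 this]
    show "(LINT x|lebesgue_on K. weak_grad K v x \<bullet> weak_grad K w x) = 0" by simp
  next
    fix v w assume v: "v \<in> V_bdry m K \<Gamma>" and w: "w \<in> V_bdry m K \<Gamma>"
    have v': "v \<in> H1 K" "has_weak_laplacian K v (\<lambda>_. 0)" using v by (auto simp: V_bdry_def)
    have "has_trace K \<Gamma> w (bdry_trace K \<Gamma> w)"
      using w unfolding V_bdry_def bdry_trace_def by (auto intro: someI[of "has_trace K \<Gamma> w"])
    from normal_deriv_eq[OF P v'(1) L0 v'(2) this]
    show "(LINT x|lebesgue_on K. weak_grad K v x \<bullet> weak_grad K w x) = normal_deriv K \<Gamma> v (bdry_trace K \<Gamma> w)"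
      by simp
  next
    fix v w p q Q
    assume v: "v \<in> V_int m K \<Gamma>" and w: "w \<in> V_int m K \<Gamma>"
      and p: "p \<in> polys_on (m - 2) K" and q: "q \<in> polys_on (m - 2) K" and Q: "Q \<in> polys m"
      and vp: "has_weak_laplacian K v p" and wq: "has_weak_laplacian K w q" and Qq: "\<forall>x\<in>K. laplacian Q x = q x"
    have H: "v \<in> H1 K" "w \<in> H1 K" using v w by (auto simp: V_int_def)
    note Hv = weak_grad_H1[OF H(1)] and Hw = weak_grad_H1[OF H(2)]
    note pL = polys_on_L2[OF K p] and qL = polys_on_L2[OF K q]
    note sQ = polys_smooth[OF Q]
    have "has_trace K \<Gamma> v (\<lambda>_. 0)" using v by (simp add: V_int_def)
    then obtain \<phi> where z: "zero_trace_limit K \<Gamma> \<phi> v (weak_grad K v)"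
      by (rule zero_trace_limit_of_trace_0)
    have lQ: "has_weak_laplacian K Q q"
    proof -
      have "(LINT x|lebesgue_on K. laplacian Q x * \<psi> x) = (LINT x|lebesgue_on K. q x * \<psi> x)" for \<psi>
        using Qq by (intro Bochner_Integration.integral_cong) auto
      then show ?thesis
        using has_weak_laplacian_smooth[OF K sQ] unfolding has_weak_laplacian_def by simp
    qed
    note HQ = smooth_H1[OF K sQ]
    (* Both sides are minus the integral of q v, because v has zero trace and both w and Q have Laplacian q. *)
    have "(LINT x|lebesgue_on K. weak_grad K v x \<bullet> weak_grad K w x) = (LINT x|lebesgue_on K. weak_grad K Q x \<bullet> weak_grad K v x)"
      using zero_trace_green[OF P Hw wq qL z] zero_trace_green[OF P weak_grad_H1[OF HQ(1)] lQ qL z]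
      by (simp add: inner_commute)
    moreover have "normal_deriv K \<Gamma> v Q = (LINT x|lebesgue_on K. weak_grad K v x \<bullet> weak_grad K Q x) + (LINT x|lebesgue_on K. p x * Q x)"
      by (rule normal_deriv_eq[OF P H(1) pL vp smooth_has_trace[OF P sQ]])
    ultimately show "(LINT x|lebesgue_on K. weak_grad K v x \<bullet> weak_grad K w x) =
        normal_deriv K \<Gamma> v Q - (LINT x|lebesgue_on K. p x * Q x)"
      by (simp add: inner_commute)
  }
qed

end
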